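(* Let $\mathcal{E},\mathcal{E}_*$ be Hilbert spaces and let $\Theta\in\mathcal{M}_{\mathcal{B}(\mathcal{E},\mathcal{E}_* )}(H^2_n)$ be such that $\operatorname{ran}M_\Theta$ is closed. Let $\mathcal{H}_\Theta=(H^2_n\otimes\mathcal{E}_* )/\operatorname{ran}M_\Theta$ be the quotient Hilbert module. If $\mathcal{H}_\Theta$ is similar to $H^2_n\otimes\mathcal{F}$ for some Hilbert space $\mathcal{F}$, then $\Theta$ has a regular inverse.
   Context: All Hilbert spaces are complex and separable. $H^2_n$ is the Drury–Arveson space on the open unit ball $\mathbb{B}^n\subset\mathbb{C}^n$, i.e. the reproducing kernel Hilbert space with kernel $(1-\langle\boldsymbol{z},\boldsymbol{w}\rangle)^{-1}$, a Hilbert module over $\mathbb{C}[z_1,\dots,z_n]$ under multiplication. $H^2_n\otimes\mathcal{E}$ is viewed as a space of $\mathcal{E}$-valued holomorphic functions with the operators $M_{z_i}\otimes I_{\mathcal{E}}$. $\mathcal{M}_{\mathcal{B}(\mathcal{E},\mathcal{E}_* )}(H^2_n)$ is the set of holomorphic $\Theta:\mathbb{B}^n\to\mathcal{B}(\mathcal{E},\mathcal{E}_* )$ such that $M_\Theta f=\Theta f$ defines a bounded operator $M_\Theta:H^2_n\otimes\mathcal{E}\to H^2_n\otimes\mathcal{E}_*$. The quotient by a submodule $\mathcal{S}$ is identified with $\mathcal{S}^\perp$ with the compressed coordinate multiplication operators. Two Hilbert modules are similar if there is a bounded invertible module map between them. $\Theta$ has a regular inverse if there is $\Psi\in\mathcal{M}_{\mathcal{B}(\mathcal{E}_*,\mathcal{E})}(H^2_n)$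 such that $\Theta(\boldsymbol{z})\Psi(\boldsymbol{z})\Theta(\boldsymbol{z})=\Theta(\boldsymbol{z})$ for all $\boldsymbol{z}\in\mathbb{B}^n$. *)

theory Defs
  imports "HOL-Analysis.Analysis"
begin

section \<open>Complex Hilbert spaces\<close>

text \<open>The inner product is linear in the first argument. Note that the real scalar multiplication
  and the norm of the underlying real normed space are determined by the complex structure.\<close>

class complex_inner = real_normed_vector +
  fixes scaleC :: "complex \<Rightarrow> 'a \<Rightarrow> 'a" (infixr "*\<^sub>C" 75)
    and cinner :: "'a \<Rightarrow> 'a \<Rightarrow> complex"
  assumes scaleC_of_real: "complex_of_real r *\<^sub>C x = r *\<^sub>R x"
    and scaleC_add_right: "a *\<^sub>C (x + y) = a *\<^sub>C x + a *\<^sub>C y"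
    and scaleC_add_left: "(a + b) *\<^sub>C x = a *\<^sub>C x + b *\<^sub>C x"
    and scaleC_scaleC: "a *\<^sub>C b *\<^sub>C x = (a * b) *\<^sub>C x"
    and cinner_commute: "cinner x y = cnj (cinner y x)"
    and cinner_add_left: "cinner (x + y) z = cinner x z + cinner y z"
    and cinner_scaleC_left: "cinner (a *\<^sub>C x) y = a * cinner x y"
    and cinner_self: "cinner x x = complex_of_real ((norm x)\<^sup>2)"

class chilbert_space = complex_inner + complete_space

subclass (in chilbert_space) banach ..

lemma scaleC_one [simp]: "1 *\<^sub>C (x::'a::complex_inner) = x"
  using scaleC_of_real[of 1 x] by simp

lemma scaleC_zero_left [simp]: "0 *\<^sub>C (x::'a::complex_inner) = 0"
  using scaleC_of_real[of 0 x] by simp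

lemma scaleC_zero_right [simp]: "a *\<^sub>C (0::'a::complex_inner) = 0"
  using scaleC_add_right[of a 0 "0::'a"] by simp

lemma scaleC_minus_one: "(- 1) *\<^sub>C (x::'a::complex_inner) = - x"
  using scaleC_of_real[of "-1" x] by simp

lemma scaleC_minus_right: "a *\<^sub>C (- x) = - (a *\<^sub>C (x::'a::complex_inner))"
  using scaleC_add_right[of a x "- x"] by (simp add: eq_neg_iff_add_eq_0 add.commute)

lemma scaleC_diff_right: "a *\<^sub>C (x - y) = a *\<^sub>C x - a *\<^sub>C (y::'a::complex_inner)"
  using scaleC_add_right[of a x "- y"] by (simp add: scaleC_minus_right)

lemma scaleC_sum_left: "(\<Sum>i\<in>A. f i) *\<^sub>C (x::'a::complex_inner) = (\<Sum>i\<in>A. f i *\<^sub>C x)"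
  by (induction A rule: infinite_finite_induct) (auto simp: scaleC_add_left)

lemma cinner_zero_left [simp]: "cinner 0 (y::'a::complex_inner) = 0"
  using cinner_add_left[of 0 0 y] by simp

lemma cinner_zero_right [simp]: "cinner (y::'a::complex_inner) 0 = 0"
  using cinner_commute[of y 0] by simp

lemma cinner_minus_left: "cinner (- x) (y::'a::complex_inner) = - cinner x y"
  using cinner_scaleC_left[of "-1" x y] by (simp add: scaleC_minus_one)

lemma cinner_diff_left: "cinner (x - y) (z::'a::complex_inner) = cinner x z - cinner y z"
  using cinner_add_left[of x "- y" z] by (simp add: cinner_minus_left)

lemma cinner_add_right: "cinner z (x + y) = cinner z x + cinner z (y::'a::complex_inner)"
  by (metis cinner_add_left cinner_commute complex_cnj_add)

lemma cinner_scaleC_right: "cinner x (a *\<^sub>C y) = cnj a * cinner x (y::'a::complex_inner)"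
  by (metis cinner_scaleC_left cinner_commute complex_cnj_mult)

lemma cinner_diff_right: "cinner z (x - y) = cinner z x - cinner z (y::'a::complex_inner)"
  by (metis cinner_diff_left cinner_commute complex_cnj_diff)

lemma norm_scaleC: "norm (a *\<^sub>C x) = cmod a * norm (x::'a::complex_inner)"
proof -
  have "complex_of_real ((norm (a *\<^sub>C x))\<^sup>2) = a * cnj a * of_real ((norm x)\<^sup>2)"
    by (simp only: cinner_self[symmetric] cinner_scaleC_left cinner_scaleC_right) simp
  also have "\<dots> = of_real ((cmod a * norm x)\<^sup>2)"
    by (simp add: complex_norm_square[symmetric] power_mult_distrib)
  finally have "(norm (a *\<^sub>C x))\<^sup>2 = (cmod a * norm x)\<^sup>2"
    using of_real_eq_iff by blast
  then show ?thesis by (simp add: power2_eq_iff_nonneg)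
qed

lemma cinner_cauchy_schwarz: "cmod (cinner x y) \<le> norm x * norm (y::'a::complex_inner)"
proof (cases "y = 0")
  case False
  define c where "c = cinner x y / of_real ((norm y)\<^sup>2)"
  have n: "complex_of_real ((norm y)\<^sup>2) \<noteq> 0" using False by simp
  have "of_real ((norm (x - c *\<^sub>C y))\<^sup>2) =
      of_real ((norm x)\<^sup>2) - c * cinner y x - (cnj c * cinner x y - c * cnj c * of_real ((norm y)\<^sup>2))"
    by (simp only: cinner_self[symmetric] cinner_diff_left cinner_diff_right
        cinner_scaleC_left cinner_scaleC_right) (simp add: algebra_simps)
  also have "c * of_real ((norm y)\<^sup>2) = cinner x y" using n by (simp add: c_def)
  then have "c * cnj c * of_real ((norm y)\<^sup>2) = cnj c * cinner x y" by (simp add: mult_ac)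
  also have "c * cinner y x = of_real ((cmod (cinner x y))\<^sup>2 / (norm y)\<^sup>2)"
    by (subst cinner_commute[of y x]) (simp add: c_def complex_norm_square[symmetric])
  finally have "complex_of_real ((norm (x - c *\<^sub>C y))\<^sup>2) =
      of_real ((norm x)\<^sup>2 - (cmod (cinner x y))\<^sup>2 / (norm y)\<^sup>2)" by simp
  then have "(norm (x - c *\<^sub>C y))\<^sup>2 = (norm x)\<^sup>2 - (cmod (cinner x y))\<^sup>2 / (norm y)\<^sup>2"
    using of_real_eq_iff by blast
  then have "(cmod (cinner x y))\<^sup>2 / (norm y)\<^sup>2 \<le> (norm x)\<^sup>2"
    by (smt (verit) zero_le_power2)
  then have "(cmod (cinner x y))\<^sup>2 \<le> (norm x * norm y)\<^sup>2"
    using False by (simp add: divide_simps power_mult_distrib)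
  then show ?thesis by (simp add: power2_le_iff_abs_le)
qed simp

lemma bounded_linear_cinner_left: "bounded_linear (\<lambda>x. cinner x (y::'a::complex_inner))"
proof (rule bounded_linear_intro[where K = "norm y"])
  show "cinner (r *\<^sub>R x) y = r *\<^sub>R cinner x y" for r x
    by (simp add: scaleC_of_real[symmetric] cinner_scaleC_left scaleR_conv_of_real)
qed (auto simp: cinner_add_left cinner_cauchy_schwarz)

instantiation complex :: chilbert_space
begin

definition scaleC_complex :: "complex \<Rightarrow> complex \<Rightarrow> complex" where
  "scaleC_complex a x = a * x"

definition cinner_complex :: "complex \<Rightarrow> complex \<Rightarrow> complex" where
  "cinner_complex x y = x * cnj y"

instance
proof
  show "cinner x x = complex_of_real ((norm x)\<^sup>2)" for x :: complex
    unfolding cinner_complex_def by (rule complex_norm_square[symmetric])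
qed (simp_all add: scaleC_complex_def cinner_complex_def scaleR_conv_of_real distrib_left
    distrib_right mult.assoc mult.commute)

end

section \<open>Reproducing kernel Hilbert spaces of vector-valued functions\<close>

locale hilbert_function_space =
  fixes H :: "('x \<Rightarrow> 'e::complex_inner) set"
    and ip :: "('x \<Rightarrow> 'e) \<Rightarrow> ('x \<Rightarrow> 'e) \<Rightarrow> complex"
  assumes zero_mem: "(\<lambda>_. 0) \<in> H"
    and add_mem: "f \<in> H \<Longrightarrow> g \<in> H \<Longrightarrow> (\<lambda>x. f x + g x) \<in> H"
    and scale_mem: "f \<in> H \<Longrightarrow> (\<lambda>x. a *\<^sub>C f x) \<in> H"
    and ip_commute: "f \<in> H \<Longrightarrow> g \<in> H \<Longrightarrow> ip f g = cnj (ip g f)"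
    and ip_add: "f \<in> H \<Longrightarrow> g \<in> H \<Longrightarrow> h \<in> H \<Longrightarrow> ip (\<lambda>x. f x + g x) h = ip f h + ip g h"
    and ip_scale: "f \<in> H \<Longrightarrow> g \<in> H \<Longrightarrow> ip (\<lambda>x. a *\<^sub>C f x) g = a * ip f g"
    and ip_nonneg: "f \<in> H \<Longrightarrow> 0 \<le> Re (ip f f)"
    and ip_definite: "f \<in> H \<Longrightarrow> ip f f = 0 \<Longrightarrow> f = (\<lambda>_. 0)"
    and ip_complete: "(\<And>m. X m \<in> H) \<Longrightarrow>
      (\<And>\<epsilon>. \<epsilon> > 0 \<Longrightarrow> \<exists>N. \<forall>m\<ge>N. \<forall>n\<ge>N.
        sqrt (Re (ip (\<lambda>x. X m x - X n x) (\<lambda>x. X m x - X n x))) < \<epsilon>) \<Longrightarrow>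
      \<exists>f\<in>H. (\<lambda>m. sqrt (Re (ip (\<lambda>x. X m x - f x) (\<lambda>x. X m x - f x)))) \<longlonglongrightarrow> 0"

text \<open>The kernel on \<open>B\<close> is the operator-valued kernel \<open>k(z, w) I\<close>; functions on \<open>B\<close> are represented
  by functions on the whole type vanishing off \<open>B\<close>.\<close>

locale vector_rkhs = hilbert_function_space H ip
  for B :: "'x set" and k :: "'x \<Rightarrow> 'x \<Rightarrow> complex"
    and H :: "('x \<Rightarrow> 'e::complex_inner) set"
    and ip :: "('x \<Rightarrow> 'e) \<Rightarrow> ('x \<Rightarrow> 'e) \<Rightarrow> complex" +
  assumes support: "f \<in> H \<Longrightarrow> z \<notin> B \<Longrightarrow> f z = 0"
    and kernel_mem: "w \<in> B \<Longrightarrow> (\<lambda>z. if z \<in> B then k z w *\<^sub>C e else 0) \<in> H"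
    and reproducing: "f \<in> H \<Longrightarrow> w \<in> B \<Longrightarrow>
      ip f (\<lambda>z. if z \<in> B then k z w *\<^sub>C e else 0) = cinner (f w) e"

definition ball_inner :: "complex ^ 'n \<Rightarrow> complex ^ 'n \<Rightarrow> complex" where
  "ball_inner z w = (\<Sum>i\<in>UNIV. z $ i * cnj (w $ i))"

definition drury_arveson_kernel :: "complex ^ 'n \<Rightarrow> complex ^ 'n \<Rightarrow> complex" where
  "drury_arveson_kernel z w = 1 / (1 - ball_inner z w)"

context hilbert_function_space
begin

definition nrm :: "('x \<Rightarrow> 'e) \<Rightarrow> real" where
  "nrm f = sqrt (Re (ip f f))"

lemma minus_mem: "f \<in> H \<Longrightarrow> (\<lambda>x. - f x) \<in> H"
  using scale_mem[of f "-1"] by (simp add: scaleC_minus_one)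

lemma diff_mem: "f \<in> H \<Longrightarrow> g \<in> H \<Longrightarrow> (\<lambda>x. f x - g x) \<in> H"
  using add_mem[of f "\<lambda>x. - g x"] minus_mem[of g] by simp

lemma ip_minus: "f \<in> H \<Longrightarrow> g \<in> H \<Longrightarrow> ip (\<lambda>x. - f x) g = - ip f g"
  using ip_scale[of f g "-1"] by (simp add: scaleC_minus_one)

lemma ip_diff: "f \<in> H \<Longrightarrow> g \<in> H \<Longrightarrow> h \<in> H \<Longrightarrow> ip (\<lambda>x. f x - g x) h = ip f h - ip g h"
  using ip_add[of f "\<lambda>x. - g x" h] minus_mem[of g] ip_minus[of g h] by simp

lemma ip_add_right:
  assumes "f \<in> H" "g \<in> H" "h \<in> H"
  shows "ip h (\<lambda>x. f x + g x) = ip h f + ip h g"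
  unfolding ip_commute[OF assms(3) add_mem[OF assms(1,2)]] ip_add[OF assms]
    ip_commute[OF assms(3,1)] ip_commute[OF assms(3,2)] by simp

lemma ip_diff_right:
  assumes "f \<in> H" "g \<in> H" "h \<in> H"
  shows "ip h (\<lambda>x. f x - g x) = ip h f - ip h g"
  unfolding ip_commute[OF assms(3) diff_mem[OF assms(1,2)]] ip_diff[OF assms]
    ip_commute[OF assms(3,1)] ip_commute[OF assms(3,2)] by simp

lemma ip_scale_right:
  assumes "f \<in> H" "g \<in> H"
  shows "ip f (\<lambda>x. a *\<^sub>C g x) = cnj a * ip f g"
  unfolding ip_commute[OF assms(1) scale_mem[OF assms(2)]] ip_scale[OF assms(2,1)]
    ip_commute[OF assms] by simp

lemma ip_self: "f \<in> H \<Longrightarrow> ip f f = of_real ((nrm f)\<^sup>2)"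
proof -
  assume f: "f \<in> H"
  have "Im (ip f f) = Im (cnj (ip f f))"
    using ip_commute[OF f f] by (rule arg_cong)
  also have "\<dots> = - Im (ip f f)" by (rule cnj.sel(2))
  finally have "Im (ip f f) = - Im (ip f f)" .
  then have "Im (ip f f) = 0" by linarith
  then show ?thesis using ip_nonneg[OF f] by (intro complex_eqI) (simp_all add: nrm_def)
qed

lemma nrm_nonneg: "f \<in> H \<Longrightarrow> 0 \<le> nrm f"
  by (simp add: nrm_def ip_nonneg)

lemma nrm_zero_iff: "f \<in> H \<Longrightarrow> nrm f = 0 \<longleftrightarrow> f = (\<lambda>_. 0)"
proof
  assume "f \<in> H" "nrm f = 0"
  then show "f = (\<lambda>_. 0)" using ip_self[of f] by (intro ip_definite) simp_all
next
  assume "f = (\<lambda>_. 0)"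
  then show "nrm f = 0" using ip_scale[OF zero_mem zero_mem, of 0] by (simp add: nrm_def)
qed

lemma ip_cauchy_schwarz:
  assumes f: "f \<in> H" and g: "g \<in> H"
  shows "cmod (ip f g) \<le> nrm f * nrm g"
proof (cases "nrm g = 0")
  case True
  then have "g = (\<lambda>_. 0)" using nrm_zero_iff g by simp
  then have "ip f g = 0" using ip_scale_right[OF f g, of 0] by simp
  then show ?thesis by (simp add: True)
next
  case False
  define c where "c = ip f g / of_real ((nrm g)\<^sup>2)"
  let ?h = "\<lambda>x. f x - c *\<^sub>C g x"
  have cg: "(\<lambda>x. c *\<^sub>C g x) \<in> H" using g by (rule scale_mem)
  have h: "?h \<in> H" using f cg by (rule diff_mem)
  have n: "complex_of_real ((nrm g)\<^sup>2) \<noteq> 0" using False by simp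
  have "ip ?h ?h =
      of_real ((nrm f)\<^sup>2) - c * ip g f - (cnj c * ip f g - c * cnj c * of_real ((nrm g)\<^sup>2))"
    by (simp only: ip_diff ip_diff_right ip_scale ip_scale_right ip_self[symmetric] f g cg h)
      (simp add: algebra_simps)
  also have "c * of_real ((nrm g)\<^sup>2) = ip f g" using n by (simp add: c_def)
  then have "c * cnj c * of_real ((nrm g)\<^sup>2) = cnj c * ip f g" by (simp add: mult_ac)
  also have "c * ip g f = of_real ((cmod (ip f g))\<^sup>2 / (nrm g)\<^sup>2)"
    by (subst ip_commute[OF g f]) (simp add: c_def complex_norm_square[symmetric])
  finally have "ip ?h ?h = of_real ((nrm f)\<^sup>2 - (cmod (ip f g))\<^sup>2 / (nrm g)\<^sup>2)" by simp
  then have "Re (ip ?h ?h) = (nrm f)\<^sup>2 - (cmod (ip f g))\<^sup>2 / (nrm g)\<^sup>2" by simp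
  then have "(cmod (ip f g))\<^sup>2 / (nrm g)\<^sup>2 \<le> (nrm f)\<^sup>2"
    using ip_nonneg[OF h] by linarith
  then have "(cmod (ip f g))\<^sup>2 \<le> (nrm f * nrm g)\<^sup>2"
    using False by (simp add: divide_simps power_mult_distrib)
  then show ?thesis using f g by (simp add: power2_le_iff_abs_le nrm_nonneg)
qed

lemma nrm_triangle:
  assumes f: "f \<in> H" and g: "g \<in> H"
  shows "nrm (\<lambda>x. f x + g x) \<le> nrm f + nrm g"
proof -
  let ?h = "\<lambda>x. f x + g x"
  have h: "?h \<in> H" using f g by (rule add_mem)
  have "ip ?h ?h = ip f f + ip g g + (ip f g + cnj (ip f g))"
    using ip_commute[OF g f] by (simp add: ip_add ip_add_right f g h)
  then have "of_real ((nrm ?h)\<^sup>2) =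
      complex_of_real ((nrm f)\<^sup>2) + of_real ((nrm g)\<^sup>2) + of_real (2 * Re (ip f g))"
    by (simp only: ip_self f g h complex_add_cnj)
  then have "(nrm ?h)\<^sup>2 = (nrm f)\<^sup>2 + (nrm g)\<^sup>2 + 2 * Re (ip f g)"
    by (simp only: of_real_add[symmetric] of_real_eq_iff)
  also have "\<dots> \<le> (nrm f)\<^sup>2 + (nrm g)\<^sup>2 + 2 * (nrm f * nrm g)"
    using ip_cauchy_schwarz[OF f g] complex_Re_le_cmod[of "ip f g"] by linarith
  also have "\<dots> = (nrm f + nrm g)\<^sup>2" by (simp add: power2_sum)
  finally show ?thesis using f g by (simp add: power2_le_iff_abs_le nrm_nonneg)
qed

end

section \<open>Existence of the vector-valued Drury--Arveson space\<close>

definition ell2 :: "('i \<Rightarrow> 'e::chilbert_space) set" where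
  "ell2 = {a. (\<lambda>i. (norm (a i))\<^sup>2) summable_on UNIV}"

definition ell2_ip :: "('i \<Rightarrow> 'e::chilbert_space) \<Rightarrow> ('i \<Rightarrow> 'e) \<Rightarrow> complex" where
  "ell2_ip a b = (\<Sum>\<^sub>\<infinity>i. cinner (a i) (b i))"

lemma mult_le_sum_squares: "p * q \<le> p\<^sup>2 + q\<^sup>2" for p q :: real
proof -
  have "0 \<le> (p - q)\<^sup>2 + p\<^sup>2 + q\<^sup>2" by simp
  then show ?thesis by (simp add: power2_eq_square algebra_simps)
qed

lemma norm_add_square_le: "(norm (x + y))\<^sup>2 \<le> 2 * (norm x)\<^sup>2 + 2 * (norm y)\<^sup>2"
  for x y :: "'a::real_normed_vector"
proof -
  have "(norm (x + y))\<^sup>2 \<le> (norm x + norm y)\<^sup>2"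
    by (intro power_mono norm_triangle_ineq) simp
  also have "\<dots> \<le> 2 * (norm x)\<^sup>2 + 2 * (norm y)\<^sup>2"
    using zero_le_power2[of "norm x - norm y"] by (simp add: power2_eq_square algebra_simps)
  finally show ?thesis .
qed

lemma ell2_add:
  assumes "a \<in> ell2" "b \<in> ell2"
  shows "(\<lambda>i. a i + b i) \<in> ell2"
proof -
  have "(\<lambda>i. 2 * (norm (a i))\<^sup>2 + 2 * (norm (b i))\<^sup>2) summable_on UNIV"
    using assms by (auto simp: ell2_def intro: summable_on_add summable_on_cmult_right)
  then have "(\<lambda>i. (norm (a i + b i))\<^sup>2) summable_on UNIV"
    by (rule summable_on_comparison_test) (simp_all add: norm_add_square_le)
  then show ?thesis by (simp add: ell2_def)
qed

lemma ell2_scale: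
  assumes "a \<in> ell2"
  shows "(\<lambda>i. c *\<^sub>C a i) \<in> ell2"
  using assms unfolding ell2_def mem_Collect_eq
  by (simp add: norm_scaleC power_mult_distrib summable_on_cmult_right)

lemma ell2_uminus: "a \<in> ell2 \<Longrightarrow> (\<lambda>i. - a i) \<in> ell2"
  by (simp add: ell2_def)

lemma ell2_diff: "a \<in> ell2 \<Longrightarrow> b \<in> ell2 \<Longrightarrow> (\<lambda>i. a i - b i) \<in> ell2"
  using ell2_add[of a "\<lambda>i. - b i"] ell2_uminus[of b] by simp

lemma ell2_ip_summable:
  assumes "a \<in> ell2" "b \<in> ell2"
  shows "(\<lambda>i. cinner (a i) (b i)) summable_on UNIV"
proof (rule Infinite_Sum.abs_summable_summable, rule Infinite_Sum.abs_summable_on_comparison_test')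
  show "(\<lambda>i. (norm (a i))\<^sup>2 + (norm (b i))\<^sup>2) summable_on UNIV"
    using assms by (auto simp: ell2_def intro: summable_on_add)
  show "cmod (cinner (a i) (b i)) \<le> (norm (a i))\<^sup>2 + (norm (b i))\<^sup>2" for i
    using cinner_cauchy_schwarz[of "a i" "b i"] mult_le_sum_squares[of "norm (a i)" "norm (b i)"]
    by linarith
qed

lemma Re_ell2_ip: "a \<in> ell2 \<Longrightarrow> Re (ell2_ip a a) = (\<Sum>\<^sub>\<infinity>i. (norm (a i))\<^sup>2)"
  unfolding ell2_ip_def by (subst infsum_Re[OF ell2_ip_summable, symmetric]) (simp_all add: cinner_self)

lemma ell2_finite_sum_le:
  assumes "a \<in> ell2" "finite F"
  shows "(\<Sum>i\<in>F. (norm (a i))\<^sup>2) \<le> Re (ell2_ip a a)"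
  using assms finite_sum_le_infsum[of "\<lambda>i. (norm (a i))\<^sup>2" UNIV F]
  by (auto simp: Re_ell2_ip ell2_def)

lemma ell2_complete:
  fixes X :: "nat \<Rightarrow> 'i \<Rightarrow> 'e::chilbert_space"
  assumes X: "\<And>m. X m \<in> ell2"
    and cauchy: "\<And>\<epsilon>. \<epsilon> > 0 \<Longrightarrow> \<exists>N. \<forall>m\<ge>N. \<forall>n\<ge>N.
        sqrt (Re (ell2_ip (\<lambda>x. X m x - X n x) (\<lambda>x. X m x - X n x))) < \<epsilon>"
  shows "\<exists>f\<in>ell2. (\<lambda>m. sqrt (Re (ell2_ip (\<lambda>x. X m x - f x) (\<lambda>x. X m x - f x)))) \<longlonglongrightarrow> 0"
proof -
  have fin: "(\<Sum>i\<in>F. (norm (X m i - X n i))\<^sup>2) \<le>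
      Re (ell2_ip (\<lambda>x. X m x - X n x) (\<lambda>x. X m x - X n x))" if "finite F" for F m n
    using ell2_finite_sum_le[OF ell2_diff[OF X X] that] by simp
  have bnd: "\<exists>N. \<forall>m\<ge>N. \<forall>n\<ge>N. \<forall>F. finite F \<longrightarrow> (\<Sum>i\<in>F. (norm (X m i - X n i))\<^sup>2) \<le> \<epsilon>\<^sup>2"
    if \<epsilon>: "\<epsilon> > 0" for \<epsilon>
  proof -
    obtain N where N: "\<forall>m\<ge>N. \<forall>n\<ge>N.
        sqrt (Re (ell2_ip (\<lambda>x. X m x - X n x) (\<lambda>x. X m x - X n x))) < \<epsilon>"
      using cauchy[OF \<epsilon>] by blast
    have "(\<Sum>i\<in>F. (norm (X m i - X n i))\<^sup>2) \<le> \<epsilon>\<^sup>2" if "m \<ge> N" "n \<ge> N" "finite F" for m n F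
    proof -
      have "Re (ell2_ip (\<lambda>x. X m x - X n x) (\<lambda>x. X m x - X n x)) \<le> \<epsilon>\<^sup>2"
        using N that by (intro sqrt_le_D) (auto intro: less_imp_le)
      then show ?thesis using fin[OF that(3), of m n] by linarith
    qed
    then show ?thesis by blast
  qed
  have "Cauchy (\<lambda>m. X m i)" for i
  proof (rule metric_CauchyI)
    fix \<epsilon> :: real assume \<epsilon>: "\<epsilon> > 0"
    obtain N where N: "\<forall>m\<ge>N. \<forall>n\<ge>N. \<forall>F. finite F \<longrightarrow>
        (\<Sum>i\<in>F. (norm (X m i - X n i))\<^sup>2) \<le> (\<epsilon>/2)\<^sup>2"
      using bnd[OF half_gt_zero[OF \<epsilon>]] by blast
    have "dist (X m i) (X n i) < \<epsilon>" if "m \<ge> N" "n \<ge> N" for m n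
    proof -
      have "(norm (X m i - X n i))\<^sup>2 \<le> (\<epsilon>/2)\<^sup>2"
        using N[rule_format, OF that, of "{i}"] by simp
      then have "norm (X m i - X n i) \<le> \<epsilon>/2"
        using \<epsilon> by (simp add: power2_le_iff_abs_le)
      then show ?thesis using \<epsilon> by (simp add: dist_norm)
    qed
    then show "\<exists>M. \<forall>m\<ge>M. \<forall>n\<ge>M. dist (X m i) (X n i) < \<epsilon>" by blast
  qed
  then have "\<forall>i. \<exists>l. (\<lambda>m. X m i) \<longlonglongrightarrow> l"
    using Cauchy_convergent convergent_def by blast
  then obtain f where f: "\<And>i. (\<lambda>m. X m i) \<longlonglongrightarrow> f i" by metis
  have lim: "\<exists>N. \<forall>m\<ge>N. \<forall>F. finite F \<longrightarrow> (\<Sum>i\<in>F. (norm (X m i - f i))\<^sup>2) \<le> \<epsilon>\<^sup>2"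
    if \<epsilon>: "\<epsilon> > 0" for \<epsilon>
  proof -
    obtain N where N: "\<And>m n F. m\<ge>N \<Longrightarrow> n\<ge>N \<Longrightarrow> finite F \<Longrightarrow>
        (\<Sum>i\<in>F. (norm (X m i - X n i))\<^sup>2) \<le> \<epsilon>\<^sup>2"
      using bnd[OF \<epsilon>] by blast
    have "(\<Sum>i\<in>F. (norm (X m i - f i))\<^sup>2) \<le> \<epsilon>\<^sup>2" if "m \<ge> N" "finite F" for m F
    proof (rule LIMSEQ_le_const2)
      show "(\<lambda>n. \<Sum>i\<in>F. (norm (X m i - X n i))\<^sup>2) \<longlonglongrightarrow> (\<Sum>i\<in>F. (norm (X m i - f i))\<^sup>2)"
        by (intro tendsto_intros f)
      show "\<exists>N. \<forall>n\<ge>N. (\<Sum>i\<in>F. (norm (X m i - X n i))\<^sup>2) \<le> \<epsilon>\<^sup>2"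
        using N that by blast
    qed
    then show ?thesis by blast
  qed
  have mem: "(\<lambda>i. X m i - f i) \<in> ell2 \<and> Re (ell2_ip (\<lambda>i. X m i - f i) (\<lambda>i. X m i - f i)) \<le> \<epsilon>\<^sup>2"
    if "\<And>F. finite F \<Longrightarrow> (\<Sum>i\<in>F. (norm (X m i - f i))\<^sup>2) \<le> \<epsilon>\<^sup>2" for m \<epsilon>
  proof -
    have 1: "(\<lambda>i. X m i - f i) \<in> ell2"
      unfolding ell2_def mem_Collect_eq using that
      by (intro nonneg_bdd_above_summable_on bdd_aboveI2[where M = "\<epsilon>\<^sup>2"]) auto
    moreover have "(\<Sum>\<^sub>\<infinity>i. (norm (X m i - f i))\<^sup>2) \<le> \<epsilon>\<^sup>2"
      using 1 that by (intro infsum_le_finite_sums) (auto simp: ell2_def)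
    ultimately show ?thesis by (simp add: Re_ell2_ip)
  qed
  have "f \<in> ell2"
  proof -
    obtain N where "\<forall>m\<ge>N. \<forall>F. finite F \<longrightarrow> (\<Sum>i\<in>F. (norm (X m i - f i))\<^sup>2) \<le> 1\<^sup>2"
      using lim[OF zero_less_one] by blast
    then have "(\<lambda>i. X N i - f i) \<in> ell2" using mem[of N 1] by blast
    from ell2_diff[OF X[of N] this] show ?thesis by simp
  qed
  moreover have "(\<lambda>m. sqrt (Re (ell2_ip (\<lambda>x. X m x - f x) (\<lambda>x. X m x - f x)))) \<longlonglongrightarrow> 0"
  proof (rule LIMSEQ_I)
    fix r :: real assume r: "r > 0"
    obtain N where N: "\<forall>m\<ge>N. \<forall>F. finite F \<longrightarrow> (\<Sum>i\<in>F. (norm (X m i - f i))\<^sup>2) \<le> (r/2)\<^sup>2"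
      using lim[OF half_gt_zero[OF r]] by blast
    have "norm (sqrt (Re (ell2_ip (\<lambda>x. X m x - f x) (\<lambda>x. X m x - f x))) - 0) < r"
      if "m \<ge> N" for m
    proof -
      have m: "(\<lambda>i. X m i - f i) \<in> ell2"
        "Re (ell2_ip (\<lambda>i. X m i - f i) (\<lambda>i. X m i - f i)) \<le> (r/2)\<^sup>2"
        using mem[of m "r/2"] N that by blast+
      have "0 \<le> Re (ell2_ip (\<lambda>i. X m i - f i) (\<lambda>i. X m i - f i))"
        using ell2_finite_sum_le[OF m(1), of "{}"] by simp
      moreover have "sqrt (Re (ell2_ip (\<lambda>i. X m i - f i) (\<lambda>i. X m i - f i))) \<le> r/2"
        using m(2) r by (intro real_le_lsqrt) auto
      ultimately show ?thesis using r by simp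
    qed
    then show "\<exists>N. \<forall>m\<ge>N. norm (sqrt (Re (ell2_ip (\<lambda>x. X m x - f x) (\<lambda>x. X m x - f x))) - 0) < r"
      by blast
  qed
  ultimately show ?thesis by blast
qed

interpretation ell2: hilbert_function_space "ell2 :: ('i \<Rightarrow> 'e::chilbert_space) set" ell2_ip
proof
  show "(\<lambda>_. 0) \<in> ell2" by (simp add: ell2_def)
next
  fix f g :: "'i \<Rightarrow> 'e" assume "f \<in> ell2" "g \<in> ell2"
  show "ell2_ip f g = cnj (ell2_ip g f)"
    unfolding ell2_ip_def infsum_cnj[symmetric] by (simp add: cinner_commute[symmetric])
next
  fix f g h :: "'i \<Rightarrow> 'e" assume "f \<in> ell2" "g \<in> ell2" "h \<in> ell2"
  then show "ell2_ip (\<lambda>x. f x + g x) h = ell2_ip f h + ell2_ip g h"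
    unfolding ell2_ip_def cinner_add_left by (intro infsum_add ell2_ip_summable)
next
  fix f g :: "'i \<Rightarrow> 'e" and a
  show "ell2_ip (\<lambda>x. a *\<^sub>C f x) g = a * ell2_ip f g"
    unfolding ell2_ip_def cinner_scaleC_left by (rule infsum_cmult_right')
next
  fix f :: "'i \<Rightarrow> 'e" assume f: "f \<in> ell2"
  show "0 \<le> Re (ell2_ip f f)" using ell2_finite_sum_le[OF f, of "{}"] by simp
  show "f = (\<lambda>_. 0)" if "ell2_ip f f = 0"
  proof
    fix i
    show "f i = 0" using ell2_finite_sum_le[OF f, of "{i}"] that by simp
  qed
qed (simp_all add: ell2_add ell2_scale ell2_complete)

lemma (in hilbert_function_space) orthogonal_complement:
  assumes W: "W \<subseteq> H"
  shows "hilbert_function_space {f \<in> H. \<forall>g\<in>W. ip f g = 0} ip"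
proof
  fix X assume X: "\<And>m::nat. X m \<in> {f \<in> H. \<forall>g\<in>W. ip f g = 0}"
    and C: "\<And>\<epsilon>. \<epsilon> > 0 \<Longrightarrow> \<exists>N. \<forall>m\<ge>N. \<forall>n\<ge>N.
        sqrt (Re (ip (\<lambda>x. X m x - X n x) (\<lambda>x. X m x - X n x))) < \<epsilon>"
  have XH: "X m \<in> H" for m using X by blast
  obtain f where f: "f \<in> H" and lim: "(\<lambda>m. nrm (\<lambda>x. X m x - f x)) \<longlonglongrightarrow> 0"
    using ip_complete[OF XH C] unfolding nrm_def by blast
  have "ip f g = 0" if g: "g \<in> W" for g
  proof -
    have gH: "g \<in> H" using g W by blast
    have "cmod (ip f g) \<le> nrm (\<lambda>x. X m x - f x) * nrm g" for m
    proof -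
      have "ip (\<lambda>x. X m x - f x) g = - ip f g"
        using ip_diff[OF XH[of m] f gH] X[of m] g by simp
      then show ?thesis using ip_cauchy_schwarz[OF diff_mem[OF XH[of m] f] gH] by simp
    qed
    moreover have "(\<lambda>m. nrm (\<lambda>x. X m x - f x) * nrm g) \<longlonglongrightarrow> 0 * nrm g"
      by (intro tendsto_mult lim tendsto_const)
    ultimately have "cmod (ip f g) \<le> 0 * nrm g" by (intro LIMSEQ_le_const) auto
    then show ?thesis by simp
  qed
  then show "\<exists>f\<in>{f \<in> H. \<forall>g\<in>W. ip f g = 0}.
      (\<lambda>m. sqrt (Re (ip (\<lambda>x. X m x - f x) (\<lambda>x. X m x - f x)))) \<longlonglongrightarrow> 0"
    using f lim unfolding nrm_def by blast
next
  show "(\<lambda>_. 0) \<in> {f \<in> H. \<forall>g\<in>W. ip f g = 0}"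
    using W ip_scale[of "\<lambda>_. 0" _ 0] zero_mem by auto
next
  fix f g
  assume "f \<in> {f \<in> H. \<forall>g\<in>W. ip f g = 0}" "g \<in> {f \<in> H. \<forall>g\<in>W. ip f g = 0}"
  then show "(\<lambda>x. f x + g x) \<in> {f \<in> H. \<forall>g\<in>W. ip f g = 0}"
    using W by (auto simp: add_mem ip_add subset_iff)
next
  fix f a
  assume "f \<in> {f \<in> H. \<forall>g\<in>W. ip f g = 0}"
  then show "(\<lambda>x. a *\<^sub>C f x) \<in> {f \<in> H. \<forall>g\<in>W. ip f g = 0}"
    using W by (auto simp: scale_mem ip_scale subset_iff)
next
  fix f g
  assume "f \<in> {f \<in> H. \<forall>g\<in>W. ip f g = 0}" "g \<in> {f \<in> H. \<forall>g\<in>W. ip f g = 0}"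
  then show "ip f g = cnj (ip g f)" using ip_commute by blast
qed (simp_all add: ip_add ip_scale ip_nonneg ip_definite)

lemma vector_rkhs_exists:
  fixes \<phi> :: "'i \<Rightarrow> 'x \<Rightarrow> complex" and B :: "'x set"
  assumes sq: "\<And>z. z \<in> B \<Longrightarrow> (\<lambda>i. (cmod (\<phi> i z))\<^sup>2) summable_on UNIV"
    and k: "\<And>z w. z \<in> B \<Longrightarrow> w \<in> B \<Longrightarrow> ((\<lambda>i. \<phi> i z * cnj (\<phi> i w)) has_sum k z w) UNIV"
  shows "\<exists>(H :: ('x \<Rightarrow> 'e::chilbert_space) set) ip. vector_rkhs B k H ip"
proof -
  define F where "F a = (\<lambda>z. if z \<in> B then \<Sum>\<^sub>\<infinity>i. \<phi> i z *\<^sub>C a i else 0)" for a :: "'i \<Rightarrow> 'e"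
  define K where "K w e = (\<lambda>i. cnj (\<phi> i w) *\<^sub>C e)" for w and e :: 'e
  define W where "W = {b \<in> ell2. F b = (\<lambda>_. 0)}"
  define A where "A = {a \<in> ell2. \<forall>b\<in>W. ell2_ip a b = 0}"
  have A: "hilbert_function_space A ell2_ip"
    unfolding A_def W_def by (rule ell2.orthogonal_complement) blast
  interpret A: hilbert_function_space A ell2_ip by (rule A)
  have A_ell2: "a \<in> ell2" if "a \<in> A" for a using that by (simp add: A_def)
  have summ: "(\<lambda>i. \<phi> i z *\<^sub>C a i) summable_on UNIV" if "a \<in> ell2" "z \<in> B" for a :: "'i \<Rightarrow> 'e" and z
  proof (rule Infinite_Sum.abs_summable_summable, rule Infinite_Sum.abs_summable_on_comparison_test')
    show "(\<lambda>i. (cmod (\<phi> i z))\<^sup>2 + (norm (a i))\<^sup>2) summable_on UNIV"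
      using that sq by (auto simp: ell2_def intro: summable_on_add)
    show "norm (\<phi> i z *\<^sub>C a i) \<le> (cmod (\<phi> i z))\<^sup>2 + (norm (a i))\<^sup>2" for i
      by (simp add: norm_scaleC mult_le_sum_squares)
  qed
  have F_add: "F (\<lambda>i. a i + b i) = (\<lambda>z. F a z + F b z)" if "a \<in> ell2" "b \<in> ell2" for a b
    using that by (simp add: F_def scaleC_add_right summ infsum_add fun_eq_iff)
  have bl: "bounded_linear ((*\<^sub>C) c :: 'e \<Rightarrow> 'e)" for c
    by (rule bounded_linear_intro[where K = "cmod c"])
      (auto simp: scaleC_add_right norm_scaleC scaleC_of_real[symmetric] scaleC_scaleC mult.commute)
  have F_scale: "F (\<lambda>i. c *\<^sub>C a i) = (\<lambda>z. c *\<^sub>C F a z)" if "a \<in> ell2" for c a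
  proof
    fix z
    have "(\<Sum>\<^sub>\<infinity>i. \<phi> i z *\<^sub>C c *\<^sub>C a i) = c *\<^sub>C (\<Sum>\<^sub>\<infinity>i. \<phi> i z *\<^sub>C a i)" if "z \<in> B"
      using has_sum_bounded_linear[OF bl has_sum_infsum[OF summ[OF \<open>a \<in> ell2\<close> that]], of c]
      by (intro infsumI) (simp add: scaleC_scaleC mult.commute)
    then show "F (\<lambda>i. c *\<^sub>C a i) z = c *\<^sub>C F a z" by (simp add: F_def)
  qed
  have F_diff: "F (\<lambda>i. a i - b i) = (\<lambda>z. F a z - F b z)" if "a \<in> ell2" "b \<in> ell2" for a b
    using F_add[OF that(1) ell2_scale[OF that(2)], of "-1"] F_scale[OF that(2), of "-1"]
    by (simp add: scaleC_minus_one)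
  have inj: "a = b" if "a \<in> A" "b \<in> A" "F a = F b" for a b
  proof -
    let ?d = "\<lambda>i. a i - b i"
    have d: "?d \<in> A" using that by (intro A.diff_mem)
    have "?d \<in> W" using that d F_diff[of a b] by (simp add: W_def A_ell2)
    then have "ell2_ip ?d ?d = 0" using d by (simp add: A_def)
    then have "?d = (\<lambda>_. 0)" by (rule A.ip_definite[OF d])
    then show "a = b" by (simp add: fun_eq_iff)
  qed
  have injA: "inj_on F A" using inj by (auto intro: inj_onI)
  have K_ell2: "K w e \<in> ell2" if "w \<in> B" for w e
    using sq[OF that]
    by (simp add: K_def ell2_def norm_scaleC power_mult_distrib summable_on_cmult_left)
  have ipK: "ell2_ip a (K w e) = cinner (F a w) e" if "a \<in> ell2" "w \<in> B" for a w e
    using has_sum_bounded_linear[OF bounded_linear_cinner_left has_sum_infsum[OF summ[OF that]], of e]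
    by (auto simp: ell2_ip_def K_def F_def that cinner_scaleC_left cinner_scaleC_right intro!: infsumI)
  have K_A: "K w e \<in> A" if w: "w \<in> B" for w e
  proof -
    have "ell2_ip (K w e) b = 0" if "b \<in> W" for b
      using that ipK[of b w e] w ell2.ip_commute[OF K_ell2[OF w], of b e]
      by (simp add: W_def)
    then show ?thesis by (simp add: A_def K_ell2 w)
  qed
  have FK: "F (K w e) = (\<lambda>z. if z \<in> B then k z w *\<^sub>C e else 0)" if w: "w \<in> B" for w e
  proof
    fix z
    have b: "bounded_linear (\<lambda>c. c *\<^sub>C e)"
      by (rule bounded_linear_intro[where K = "norm e"])
        (auto simp: scaleC_add_left norm_scaleC scaleC_of_real[symmetric] scaleC_scaleC
          scaleC_complex_def)
    show "F (K w e) z = (if z \<in> B then k z w *\<^sub>C e else 0)"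
      using has_sum_bounded_linear[OF b k[of z w]] w
      by (auto simp: F_def K_def scaleC_scaleC intro!: infsumI)
  qed
  define J where "J = inv_into A F"
  have JF [simp]: "J (F a) = a" if "a \<in> A" for a
    using that injA by (simp add: J_def)
  define ip where "ip f g = ell2_ip (J f) (J g)" for f g
  have add': "(\<lambda>x. F a x + F b x) = F (\<lambda>i. a i + b i)" if "a \<in> A" "b \<in> A" for a b
    using that by (simp add: F_add A_ell2)
  have scale': "(\<lambda>x. c *\<^sub>C F a x) = F (\<lambda>i. c *\<^sub>C a i)" if "a \<in> A" for a c
    using that by (simp add: F_scale A_ell2)
  have diff': "(\<lambda>x. F a x - F b x) = F (\<lambda>i. a i - b i)" if "a \<in> A" "b \<in> A" for a b
    using that by (simp add: F_diff A_ell2)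
  have F0: "F (\<lambda>_. 0) = (\<lambda>_. 0)" by (auto simp: F_def)
  have "vector_rkhs B k (F ` A) ip"
  proof
    show "(\<lambda>_. 0) \<in> F ` A" using imageI[OF A.zero_mem, of F] by (simp add: F0)
  next
    fix f g assume "f \<in> F ` A" "g \<in> F ` A"
    then show "(\<lambda>x. f x + g x) \<in> F ` A" by (auto simp: add' A.add_mem)
  next
    fix f c assume "f \<in> F ` A"
    then show "(\<lambda>x. c *\<^sub>C f x) \<in> F ` A" by (auto simp: scale' A.scale_mem)
  next
    fix f g assume "f \<in> F ` A" "g \<in> F ` A"
    then obtain a b where "a \<in> A" "b \<in> A" "f = F a" "g = F b" by blast
    then show "ip f g = cnj (ip g f)" using A.ip_commute[of a b] by (simp only: ip_def JF)
  next
    fix f g h assume "f \<in> F ` A" "g \<in> F ` A" "h \<in> F ` A"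
    then show "ip (\<lambda>x. f x + g x) h = ip f h + ip g h"
      by (auto simp: ip_def add' A.add_mem A.ip_add)
  next
    fix f g c assume "f \<in> F ` A" "g \<in> F ` A"
    then show "ip (\<lambda>x. c *\<^sub>C f x) g = c * ip f g"
      by (auto simp: ip_def scale' A.scale_mem A.ip_scale)
  next
    fix f assume "f \<in> F ` A"
    then show "0 \<le> Re (ip f f)" by (auto simp: ip_def A.ip_nonneg)
  next
    fix f assume "f \<in> F ` A" "ip f f = 0"
    then obtain a where "a \<in> A" "f = F a" "ell2_ip a a = 0" by (auto simp: ip_def)
    then show "f = (\<lambda>_. 0)" using A.ip_definite[of a] F0 by simp
  next
    fix X assume X: "\<And>m::nat. X m \<in> F ` A"
      and C: "\<And>\<epsilon>. \<epsilon> > 0 \<Longrightarrow> \<exists>N. \<forall>m\<ge>N. \<forall>n\<ge>N.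
          sqrt (Re (ip (\<lambda>x. X m x - X n x) (\<lambda>x. X m x - X n x))) < \<epsilon>"
    have "\<exists>a\<in>A. X m = F a" for m using X[of m] by blast
    then obtain Y where Y: "\<And>m. Y m \<in> A" "\<And>m. X m = F (Y m)" by metis
    have eq: "ip (\<lambda>x. X m x - F a x) (\<lambda>x. X m x - F a x)
        = ell2_ip (\<lambda>x. Y m x - a x) (\<lambda>x. Y m x - a x)" if "a \<in> A" for m a
      using that Y by (simp add: ip_def diff' A.diff_mem)
    have eq2: "ip (\<lambda>x. X m x - X n x) (\<lambda>x. X m x - X n x)
        = ell2_ip (\<lambda>x. Y m x - Y n x) (\<lambda>x. Y m x - Y n x)" for m n
      using Y(1) by (simp add: Y(2) ip_def diff' A.diff_mem)
    have "\<exists>a\<in>A. (\<lambda>m. sqrt (Re (ell2_ip (\<lambda>x. Y m x - a x) (\<lambda>x. Y m x - a x)))) \<longlonglongrightarrow> 0"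
    proof (rule A.ip_complete)
      fix \<epsilon> :: real assume "\<epsilon> > 0"
      from C[OF this] show "\<exists>N. \<forall>m\<ge>N. \<forall>n\<ge>N.
          sqrt (Re (ell2_ip (\<lambda>x. Y m x - Y n x) (\<lambda>x. Y m x - Y n x))) < \<epsilon>"
        by (simp only: eq2)
    qed (rule Y)
    then show "\<exists>f\<in>F ` A. (\<lambda>m. sqrt (Re (ip (\<lambda>x. X m x - f x) (\<lambda>x. X m x - f x)))) \<longlonglongrightarrow> 0"
      by (auto simp: eq)
  next
    show "f z = 0" if "f \<in> F ` A" "z \<notin> B" for f z using that by (auto simp: F_def)
  next
    show "(\<lambda>z. if z \<in> B then k z w *\<^sub>C e else 0) \<in> F ` A" if "w \<in> B" for w e
      unfolding FK[OF that, symmetric] using K_A[OF that] by blast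
  next
    show "ip f (\<lambda>z. if z \<in> B then k z w *\<^sub>C e else 0) = cinner (f w) e"
      if "f \<in> F ` A" "w \<in> B" for f w e
      unfolding FK[OF that(2), symmetric] using that K_A[OF that(2)] ipK A_ell2
      by (auto simp: ip_def)
  qed
  then show ?thesis by blast
qed

text \<open>Summing over words rather than multi-indices expands the kernel without multinomial
  coefficients: words of length \<open>m\<close> contribute the \<open>m\<close>-th power of the inner product.\<close>

definition word_monomial :: "'n list \<Rightarrow> complex ^ 'n \<Rightarrow> complex" where
  "word_monomial u z = prod_list (map (($) z) u)"

lemma sum_words_of_length:
  fixes z w :: "complex ^ 'n"
  shows "(\<Sum>u | length u = m. word_monomial u z * cnj (word_monomial u w)) = ball_inner z w ^ m"
proof (induction m)
  case 0
  then show ?case by (simp add: word_monomial_def)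
next
  case (Suc m)
  have bij: "bij_betw (\<lambda>(i, u). i # u) (UNIV \<times> {u. length u = m}) {u :: 'n list. length u = Suc m}"
    by (auto simp: bij_betw_def inj_on_def image_iff length_Suc_conv)
  have "(\<Sum>u | length u = Suc m. word_monomial u z * cnj (word_monomial u w)) =
      (\<Sum>(i, u)\<in>UNIV \<times> {u. length u = m}.
        (z $ i * cnj (w $ i)) * (word_monomial u z * cnj (word_monomial u w)))"
    by (subst sum.reindex_bij_betw[OF bij, symmetric])
      (auto simp: word_monomial_def mult_ac intro!: sum.cong)
  also have "\<dots> = ball_inner z w * (\<Sum>u | length u = m. word_monomial u z * cnj (word_monomial u w))"
    by (simp add: sum.cartesian_product[symmetric] ball_inner_def sum_product)
  finally show ?case by (simp add: Suc)
qed

lemma finite_words: "finite {u :: 'n::finite list. length u < M}"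
  by (rule finite_subset[OF _ finite_lists_length_le[of "UNIV :: 'n set" M]]) auto

lemma sum_words:
  fixes z w :: "complex ^ 'n"
  shows "(\<Sum>u | length u < M. word_monomial u z * cnj (word_monomial u w)) =
    (\<Sum>m<M. ball_inner z w ^ m)"
proof (induction M)
  case (Suc M)
  let ?f = "\<lambda>u. word_monomial u z * cnj (word_monomial u w)"
  have eq: "{u :: 'n list. length u < Suc M} = {u. length u < M} \<union> {u. length u = M}" by auto
  have fin: "finite {u :: 'n list. length u = M}"
    using finite_lists_length_eq[of "UNIV :: 'n set" M] by simp
  have "sum ?f {u. length u < Suc M} = sum ?f {u. length u < M} + sum ?f {u. length u = M}"
    unfolding eq by (rule sum.union_disjoint[OF finite_words fin]) auto
  then show ?case by (simp add: Suc sum_words_of_length)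
qed simp

lemma ball_inner_self: "ball_inner z z = of_real ((norm z)\<^sup>2)"
  by (simp add: ball_inner_def norm_vec_def L2_set_def sum_nonneg complex_norm_square del: of_real_power)

lemma ball_inner_bound: "cmod (ball_inner z w) \<le> norm z * norm w"
proof -
  have "cmod (ball_inner z w) \<le> (\<Sum>i\<in>UNIV. \<bar>cmod (z $ i)\<bar> * \<bar>cmod (w $ i)\<bar>)"
    unfolding ball_inner_def by (rule order_trans[OF norm_sum]) (simp add: norm_mult)
  also have "\<dots> \<le> norm z * norm w"
    unfolding norm_vec_def by (rule L2_set_mult_ineq)
  finally show ?thesis .
qed

lemma word_monomial_square_summable:
  fixes z :: "complex ^ 'n"
  assumes "z \<in> ball 0 1"
  shows "(\<lambda>u. (cmod (word_monomial u z))\<^sup>2) summable_on UNIV"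
proof (rule nonneg_bdd_above_summable_on)
  have z: "(norm z)\<^sup>2 < 1" using assms by (simp add: power_less_one_iff abs_square_less_1)
  have W: "(\<Sum>u | length u < M. (cmod (word_monomial u z))\<^sup>2) = (\<Sum>m<M. ((norm z)\<^sup>2) ^ m)" for M
  proof -
    have "complex_of_real (\<Sum>u | length u < M. (cmod (word_monomial u z))\<^sup>2) =
        of_real (\<Sum>m<M. ((norm z)\<^sup>2) ^ m)"
      using sum_words[where M = M and z = z and w = z]
      by (simp only: ball_inner_self complex_norm_square[symmetric] of_real_sum of_real_power[symmetric])
    then show ?thesis using of_real_eq_iff by blast
  qed
  show "bdd_above (sum (\<lambda>u. (cmod (word_monomial u z))\<^sup>2) ` {F. F \<subseteq> UNIV \<and> finite F})"
  proof (rule bdd_aboveI2)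
    fix F :: "'n list set" assume F: "F \<in> {F. F \<subseteq> UNIV \<and> finite F}"
    define M where "M = Suc (Max (insert 0 (length ` F)))"
    have "F \<subseteq> {u. length u < M}" using F by (auto simp: M_def less_Suc_eq_le)
    then have "(\<Sum>u\<in>F. (cmod (word_monomial u z))\<^sup>2) \<le> (\<Sum>m<M. ((norm z)\<^sup>2) ^ m)"
      unfolding W[symmetric] by (intro sum_mono2 finite_words) auto
    also have "\<dots> \<le> (\<Sum>m. ((norm z)\<^sup>2) ^ m)"
      using z by (intro sum_le_suminf summable_geometric) auto
    finally show "(\<Sum>u\<in>F. (cmod (word_monomial u z))\<^sup>2) \<le> (\<Sum>m. ((norm z)\<^sup>2) ^ m)" .
  qed
qed simp

lemma drury_arveson_kernel_expansion:
  fixes z w :: "complex ^ 'n"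
  assumes z: "z \<in> ball 0 1" and w: "w \<in> ball 0 1"
  shows "((\<lambda>u. word_monomial u z * cnj (word_monomial u w)) has_sum drury_arveson_kernel z w) UNIV"
proof -
  let ?f = "\<lambda>u. word_monomial u z * cnj (word_monomial u w)"
  have "?f summable_on UNIV"
  proof (rule Infinite_Sum.abs_summable_summable, rule Infinite_Sum.abs_summable_on_comparison_test')
    show "(\<lambda>u. (cmod (word_monomial u z))\<^sup>2 + (cmod (word_monomial u w))\<^sup>2) summable_on UNIV"
      by (intro summable_on_add word_monomial_square_summable z w)
    show "cmod (?f u) \<le> (cmod (word_monomial u z))\<^sup>2 + (cmod (word_monomial u w))\<^sup>2" for u
      by (simp add: norm_mult mult_le_sum_squares)
  qed
  then have "(?f has_sum infsum ?f UNIV) UNIV" by (rule has_sum_infsum)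
  then have 1: "(sum ?f \<longlongrightarrow> infsum ?f UNIV) (finite_subsets_at_top UNIV)"
    by (simp add: has_sum_def)
  have "filterlim (\<lambda>M. {u :: 'n list. length u < M}) (finite_subsets_at_top UNIV) sequentially"
    unfolding filterlim_finite_subsets_at_top
  proof safe
    fix F :: "'n list set" assume F: "finite F"
    show "\<forall>\<^sub>F M in sequentially. finite {u :: 'n list. length u < M} \<and>
        F \<subseteq> {u. length u < M} \<and> {u :: 'n list. length u < M} \<subseteq> UNIV"
      using eventually_ge_at_top[of "Suc (Max (insert 0 (length ` F)))"]
    proof eventually_elim
      case (elim M)
      have "length u < M" if "u \<in> F" for u
      proof -
        have "length u \<le> Max (insert 0 (length ` F))" using F that by (intro Max_ge) auto
        then show ?thesis using elim by simp
      qed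
      then show ?case using finite_words by blast
    qed
  qed
  from filterlim_compose[OF 1 this]
  have "(\<lambda>M. \<Sum>m<M. ball_inner z w ^ m) \<longlonglongrightarrow> infsum ?f UNIV"
    by (simp add: sum_words)
  moreover have "norm z * norm w < 1 * 1"
    using z w by (intro mult_strict_mono') auto
  then have "cmod (ball_inner z w) < 1" using ball_inner_bound[of z w] by simp
  then have "(\<lambda>M. \<Sum>m<M. ball_inner z w ^ m) \<longlonglongrightarrow> 1 / (1 - ball_inner z w)"
    using geometric_sums[of "ball_inner z w"] by (simp add: sums_def)
  ultimately have "infsum ?f UNIV = drury_arveson_kernel z w"
    unfolding drury_arveson_kernel_def by (rule LIMSEQ_unique)
  then show ?thesis using \<open>(?f has_sum infsum ?f UNIV) UNIV\<close> by simp
qed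

theorem drury_arveson_rkhs_exists:
  "\<exists>(H :: (complex ^ 'n \<Rightarrow> 'e::chilbert_space) set) ip.
    vector_rkhs (ball 0 1) drury_arveson_kernel H ip"
  by (rule vector_rkhs_exists[OF word_monomial_square_summable drury_arveson_kernel_expansion])

section \<open>The Drury--Arveson module\<close>

text \<open>A reproducing kernel Hilbert space is determined by its kernel (as a set of functions together
  with the inner product on it), so the choice below is the vector-valued Drury--Arveson space.\<close>

definition drury_arveson_data ::
    "(complex ^ 'n \<Rightarrow> 'e::chilbert_space) set
      \<times> ((complex ^ 'n \<Rightarrow> 'e) \<Rightarrow> (complex ^ 'n \<Rightarrow> 'e) \<Rightarrow> complex)" where
  "drury_arveson_data =
    (SOME p. vector_rkhs (ball 0 1) drury_arveson_kernel (fst p) (snd p))"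

interpretation da: vector_rkhs "ball 0 1" drury_arveson_kernel
    "fst (drury_arveson_data :: (complex ^ 'n \<Rightarrow> 'e::chilbert_space) set \<times> _)"
    "snd (drury_arveson_data :: (complex ^ 'n \<Rightarrow> 'e::chilbert_space) set \<times> _)"
  unfolding drury_arveson_data_def
  using drury_arveson_rkhs_exists[where 'n = 'n and 'e = 'e]
  by (intro someI_ex[where P = "\<lambda>p. vector_rkhs (ball 0 1) drury_arveson_kernel (fst p) (snd p)"])
    (metis fst_conv snd_conv)

text \<open>The type \<open>('n, 'e) drury_arveson\<close> is the tensor product of the scalar Drury--Arveson space in
  \<open>CARD('n)\<close> variables with \<open>'e\<close>, as a space of functions: \<open>eval f z\<close> is the value at \<open>z\<close>.\<close>

typedef (overloaded) ('n::finite, 'e::chilbert_space) drury_arveson =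
    "fst (drury_arveson_data :: (complex ^ 'n \<Rightarrow> 'e) set \<times> _)"
  morphisms eval Abs_drury_arveson
  using da.zero_mem by blast

instantiation drury_arveson :: (finite, chilbert_space) complex_inner
begin

definition zero_drury_arveson :: "('a, 'b) drury_arveson" where
  "0 = Abs_drury_arveson (\<lambda>_. 0)"

definition plus_drury_arveson ::
    "('a, 'b) drury_arveson \<Rightarrow> ('a, 'b) drury_arveson \<Rightarrow> ('a, 'b) drury_arveson" where
  "f + g = Abs_drury_arveson (\<lambda>z. eval f z + eval g z)"

definition uminus_drury_arveson :: "('a, 'b) drury_arveson \<Rightarrow> ('a, 'b) drury_arveson" where
  "- f = Abs_drury_arveson (\<lambda>z. - eval f z)"

definition minus_drury_arveson ::
    "('a, 'b) drury_arveson \<Rightarrow> ('a, 'b) drury_arveson \<Rightarrow> ('a, 'b) drury_arveson" where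
  "f - g = Abs_drury_arveson (\<lambda>z. eval f z - eval g z)"

definition scaleC_drury_arveson ::
    "complex \<Rightarrow> ('a, 'b) drury_arveson \<Rightarrow> ('a, 'b) drury_arveson" where
  "c *\<^sub>C f = Abs_drury_arveson (\<lambda>z. c *\<^sub>C eval f z)"

definition scaleR_drury_arveson ::
    "real \<Rightarrow> ('a, 'b) drury_arveson \<Rightarrow> ('a, 'b) drury_arveson" where
  "r *\<^sub>R f = Abs_drury_arveson (\<lambda>z. r *\<^sub>R eval f z)"

definition cinner_drury_arveson ::
    "('a, 'b) drury_arveson \<Rightarrow> ('a, 'b) drury_arveson \<Rightarrow> complex" where
  "cinner f g = snd drury_arveson_data (eval f) (eval g)"

definition norm_drury_arveson :: "('a, 'b) drury_arveson \<Rightarrow> real" where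
  "norm (f :: ('a, 'b) drury_arveson) = sqrt (Re (cinner f f))"

definition dist_drury_arveson :: "('a, 'b) drury_arveson \<Rightarrow> ('a, 'b) drury_arveson \<Rightarrow> real" where
  "dist f (g :: ('a, 'b) drury_arveson) = norm (f - g)"

definition sgn_drury_arveson :: "('a, 'b) drury_arveson \<Rightarrow> ('a, 'b) drury_arveson" where
  "sgn (f :: ('a, 'b) drury_arveson) = inverse (norm f) *\<^sub>R f"

definition uniformity_drury_arveson ::
    "(('a, 'b) drury_arveson \<times> ('a, 'b) drury_arveson) filter" where
  "uniformity = (INF e\<in>{0 <..}. principal {(x, y :: ('a, 'b) drury_arveson). dist x y < e})"

definition open_drury_arveson :: "('a, 'b) drury_arveson set \<Rightarrow> bool" where
  "open (U :: ('a, 'b) drury_arveson set) =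
    (\<forall>x\<in>U. eventually (\<lambda>(x', y). x' = x \<longrightarrow> y \<in> U) uniformity)"

lemma eval_zero: "eval (0 :: ('a, 'b) drury_arveson) = (\<lambda>_. 0)"
  by (simp add: zero_drury_arveson_def Abs_drury_arveson_inverse da.zero_mem)

lemma eval_add: "eval (f + g :: ('a, 'b) drury_arveson) = (\<lambda>z. eval f z + eval g z)"
  by (simp add: plus_drury_arveson_def Abs_drury_arveson_inverse da.add_mem eval)

lemma eval_uminus: "eval (- f :: ('a, 'b) drury_arveson) = (\<lambda>z. - eval f z)"
  by (simp add: uminus_drury_arveson_def Abs_drury_arveson_inverse da.minus_mem eval)

lemma eval_diff: "eval (f - g :: ('a, 'b) drury_arveson) = (\<lambda>z. eval f z - eval g z)"
  by (simp add: minus_drury_arveson_def Abs_drury_arveson_inverse da.diff_mem eval)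

lemma eval_scaleC: "eval (c *\<^sub>C f :: ('a, 'b) drury_arveson) = (\<lambda>z. c *\<^sub>C eval f z)"
  by (simp add: scaleC_drury_arveson_def Abs_drury_arveson_inverse da.scale_mem eval)

lemma scaleR_eq_scaleC: "r *\<^sub>R f = complex_of_real r *\<^sub>C (f :: ('a, 'b) drury_arveson)"
  by (simp add: scaleC_drury_arveson_def scaleR_drury_arveson_def scaleC_of_real)

lemma eval_scaleR: "eval (r *\<^sub>R f :: ('a, 'b) drury_arveson) = (\<lambda>z. r *\<^sub>R eval f z)"
  by (simp add: scaleR_eq_scaleC eval_scaleC scaleC_of_real)

lemma norm_eq_nrm: "norm (f :: ('a, 'b) drury_arveson) = da.nrm (eval f)"
  by (simp add: norm_drury_arveson_def cinner_drury_arveson_def da.nrm_def)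

lemma cinner_self_aux: "cinner f f = complex_of_real ((norm (f :: ('a, 'b) drury_arveson))\<^sup>2)"
  by (simp only: norm_eq_nrm cinner_drury_arveson_def da.ip_self[OF eval])

lemma cinner_scaleC_aux: "cinner (c *\<^sub>C f) g = c * cinner f (g :: ('a, 'b) drury_arveson)"
  by (simp add: cinner_drury_arveson_def eval_scaleC da.ip_scale eval)

instance
proof
  fix f g h :: "('a, 'b) drury_arveson" and a b :: real and c d :: complex
  note ev = eval_inject[symmetric] eval_zero eval_add eval_uminus eval_diff eval_scaleC eval_scaleR
    fun_eq_iff
  show "f + g + h = f + (g + h)" by (simp add: ev add.assoc)
  show "f + g = g + f" by (simp add: ev add.commute)
  show "0 + f = f" by (simp add: ev)
  show "- f + f = 0" by (simp add: ev)
  show "f - g = f + - g" by (simp add: ev)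
  show "a *\<^sub>R (f + g) = a *\<^sub>R f + a *\<^sub>R g" by (simp add: ev scaleR_add_right)
  show "(a + b) *\<^sub>R f = a *\<^sub>R f + b *\<^sub>R f" by (simp add: ev scaleR_add_left)
  show "a *\<^sub>R b *\<^sub>R f = (a * b) *\<^sub>R f" by (simp add: ev)
  show "1 *\<^sub>R f = f" by (simp add: ev)
  show "dist f g = norm (f - g)" by (rule dist_drury_arveson_def)
  show "sgn f = inverse (norm f) *\<^sub>R f" by (rule sgn_drury_arveson_def)
  show "(uniformity :: (('a, 'b) drury_arveson \<times> _) filter) =
      (INF e\<in>{0 <..}. principal {(x, y). dist x y < e})"
    by (rule uniformity_drury_arveson_def)
  show "open U = (\<forall>x\<in>U. eventually (\<lambda>(x', y). x' = x \<longrightarrow> y \<in> U) uniformity)"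
    for U :: "('a, 'b) drury_arveson set" by (rule open_drury_arveson_def)
  show "norm f = 0 \<longleftrightarrow> f = 0"
    by (simp add: norm_eq_nrm da.nrm_zero_iff[OF eval] eval_zero[symmetric] eval_inject)
  show "norm (f + g) \<le> norm f + norm g"
    by (simp add: norm_eq_nrm eval_add da.nrm_triangle eval)
  show comm: "cinner f g = cnj (cinner g f)" for f g :: "('a, 'b) drury_arveson"
    unfolding cinner_drury_arveson_def by (rule da.ip_commute[OF eval eval])
  show "norm (a *\<^sub>R f) = \<bar>a\<bar> * norm f"
  proof -
    have "cinner (a *\<^sub>R f) (a *\<^sub>R f) = complex_of_real (a\<^sup>2) * cinner f f"
      unfolding scaleR_eq_scaleC cinner_scaleC_aux
      by (subst comm) (simp add: cinner_scaleC_aux comm[of f f, symmetric] power2_eq_square)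
    then show ?thesis by (simp add: norm_drury_arveson_def real_sqrt_mult)
  qed
  show "complex_of_real a *\<^sub>C f = a *\<^sub>R f" by (rule scaleR_eq_scaleC[symmetric])
  show "c *\<^sub>C (f + g) = c *\<^sub>C f + c *\<^sub>C g" by (simp add: ev scaleC_add_right)
  show "(c + d) *\<^sub>C f = c *\<^sub>C f + d *\<^sub>C f" by (simp add: ev scaleC_add_left)
  show "c *\<^sub>C d *\<^sub>C f = (c * d) *\<^sub>C f" by (simp add: ev scaleC_scaleC)
  show "cinner (f + g) h = cinner f h + cinner g h"
    by (simp add: cinner_drury_arveson_def eval_add da.ip_add eval)
  show "cinner (c *\<^sub>C f) g = c * cinner f g" by (rule cinner_scaleC_aux)
  show "cinner f f = complex_of_real ((norm f)\<^sup>2)" by (rule cinner_self_aux)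
qed

end

instance drury_arveson :: (finite, chilbert_space) chilbert_space
proof
  fix X :: "nat \<Rightarrow> ('a, 'b) drury_arveson"
  assume X: "Cauchy X"
  have d: "dist f g = sqrt (Re (snd drury_arveson_data
      (\<lambda>x. eval f x - eval g x) (\<lambda>x. eval f x - eval g x)))" for f g :: "('a, 'b) drury_arveson"
    by (simp add: dist_drury_arveson_def norm_drury_arveson_def cinner_drury_arveson_def eval_diff)
  have "\<exists>f\<in>fst drury_arveson_data. (\<lambda>m. sqrt (Re (snd drury_arveson_data
      (\<lambda>x. eval (X m) x - f x) (\<lambda>x. eval (X m) x - f x)))) \<longlonglongrightarrow> 0"
  proof (rule da.ip_complete[OF eval])
    fix \<epsilon> :: real assume "\<epsilon> > 0"
    then have "\<exists>N. \<forall>m\<ge>N. \<forall>n\<ge>N. dist (X m) (X n) < \<epsilon>" by (rule metric_CauchyD[OF X])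
    then show "\<exists>N. \<forall>m\<ge>N. \<forall>n\<ge>N. sqrt (Re (snd drury_arveson_data
        (\<lambda>x. eval (X m) x - eval (X n) x) (\<lambda>x. eval (X m) x - eval (X n) x))) < \<epsilon>"
      by (simp only: d)
  qed
  then obtain f where f: "f \<in> fst drury_arveson_data"
    and lim: "(\<lambda>m. sqrt (Re (snd drury_arveson_data
      (\<lambda>x. eval (X m) x - f x) (\<lambda>x. eval (X m) x - f x)))) \<longlonglongrightarrow> 0" by blast
  have g: "eval (Abs_drury_arveson f) = f" using f by (rule Abs_drury_arveson_inverse)
  have "(\<lambda>m. dist (X m) (Abs_drury_arveson f)) \<longlonglongrightarrow> 0" using lim by (simp only: d g)
  then show "convergent X" unfolding convergent_def tendsto_dist_iff[symmetric] by blast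
qed

theorem reproducing_property:
  fixes f :: "('n::finite, 'e::chilbert_space) drury_arveson"
  assumes "w \<in> ball 0 1"
  shows "\<exists>k. (\<forall>z\<in>ball 0 1. eval k z = drury_arveson_kernel z w *\<^sub>C e) \<and>
    cinner f k = cinner (eval f w) e"
proof -
  let ?k = "\<lambda>z. if z \<in> ball 0 1 then drury_arveson_kernel z w *\<^sub>C e else 0"
  have "eval (Abs_drury_arveson ?k) = ?k"
    by (rule Abs_drury_arveson_inverse[OF da.kernel_mem[OF assms]])
  then show ?thesis
    using da.reproducing[OF eval assms, of f e]
    by (intro exI[of _ "Abs_drury_arveson ?k"]) (simp add: cinner_drury_arveson_def)
qed

text \<open>Multiplication by an operator-valued function. The value is meaningful only if the pointwise
  product lies in the space, because \<open>Abs_drury_arveson\<close> is unspecified elsewhere. The definition of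
  \<open>multipliers\<close> demands this explicitly; for \<open>coord_mult\<close> it is a standard property of the space.\<close>

definition mult_op ::
    "(complex ^ 'n \<Rightarrow> 'e \<Rightarrow> 'f) \<Rightarrow> ('n, 'e::chilbert_space) drury_arveson
      \<Rightarrow> ('n, 'f::chilbert_space) drury_arveson" where
  "mult_op \<Phi> f = Abs_drury_arveson (\<lambda>z. if z \<in> ball 0 1 then \<Phi> z (eval f z) else 0)"

definition coord_mult ::
    "'n \<Rightarrow> ('n::finite, 'e::chilbert_space) drury_arveson \<Rightarrow> ('n, 'e) drury_arveson" where
  "coord_mult i = mult_op (\<lambda>z. scaleC (z $ i))"

text \<open>Bounded complex-linear operators are elements of the library type of bounded real-linear
  operators (with the same operator norm) that commute with complex scalars.\<close>

definition complex_linear :: "('e::complex_inner \<Rightarrow>\<^sub>L 'f::complex_inner) \<Rightarrow> bool" where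
  "complex_linear T \<longleftrightarrow> (\<forall>c x. T (c *\<^sub>C x) = c *\<^sub>C T x)"

definition operator_holomorphic_on ::
    "(complex ^ 'n \<Rightarrow> 'e::complex_inner \<Rightarrow>\<^sub>L 'f::complex_inner) \<Rightarrow> (complex ^ 'n) set \<Rightarrow> bool" where
  "operator_holomorphic_on \<Theta> U \<longleftrightarrow>
    (\<forall>z\<in>U. \<exists>D. (\<Theta> has_derivative D) (at z) \<and>
      (\<forall>c v x. blinfun_apply (D (c *s v)) x = c *\<^sub>C blinfun_apply (D v) x))"

definition multipliers ::
    "(complex ^ 'n \<Rightarrow> 'e::chilbert_space \<Rightarrow>\<^sub>L 'f::chilbert_space) set" where
  "multipliers = {\<Theta>.
    (\<forall>z\<in>ball 0 1. complex_linear (\<Theta> z)) \<and>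
    operator_holomorphic_on \<Theta> (ball 0 1) \<and>
    (\<forall>f :: ('n, 'e) drury_arveson. \<exists>g :: ('n, 'f) drury_arveson.
      \<forall>z\<in>ball 0 1. eval g z = \<Theta> z (eval f z)) \<and>
    bounded_linear (mult_op (\<lambda>z. blinfun_apply (\<Theta> z)) ::
      ('n, 'e) drury_arveson \<Rightarrow> ('n, 'f) drury_arveson)}"

definition mult_range ::
    "(complex ^ 'n \<Rightarrow> 'e::chilbert_space \<Rightarrow>\<^sub>L 'f::chilbert_space) \<Rightarrow> ('n, 'f) drury_arveson set" where
  "mult_range \<Theta> = range (mult_op (\<lambda>z. blinfun_apply (\<Theta> z)))"

definition regular_inverse ::
    "(complex ^ 'n \<Rightarrow> 'e::chilbert_space \<Rightarrow>\<^sub>L 'f::chilbert_space)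
      \<Rightarrow> (complex ^ 'n \<Rightarrow> 'f \<Rightarrow>\<^sub>L 'e) \<Rightarrow> bool" where
  "regular_inverse \<Theta> \<Psi> \<longleftrightarrow> \<Psi> \<in> multipliers \<and>
    (\<forall>z\<in>ball 0 1. \<Theta> z o\<^sub>L \<Psi> z o\<^sub>L \<Theta> z = \<Theta> z)"

section \<open>Quotients and similarity of Hilbert modules\<close>

definition orth_complement :: "'h::complex_inner set \<Rightarrow> 'h set" where
  "orth_complement S = {x. \<forall>s\<in>S. cinner x s = 0}"

definition orth_projection :: "'h::complex_inner set \<Rightarrow> 'h \<Rightarrow> 'h" where
  "orth_projection M x = (THE p. p \<in> M \<and> x - p \<in> orth_complement M)"

text \<open>The quotient by a closed submodule \<open>S\<close> has underlying space \<open>orth_complement S\<close>; its coordinate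
  operators are the compressions of the coordinate operators \<open>T i\<close>.\<close>

definition quotient_action ::
    "('i \<Rightarrow> 'h::complex_inner \<Rightarrow> 'h) \<Rightarrow> 'h set \<Rightarrow> 'i \<Rightarrow> 'h \<Rightarrow> 'h" where
  "quotient_action T S i x = orth_projection (orth_complement S) (T i x)"

text \<open>A Hilbert module over the polynomials is given by a closed subspace \<open>M\<close> of a Hilbert space and
  the operators \<open>T i\<close> on it by which the coordinates act; commuting with these is the same as being a
  module map.\<close>

definition similar_modules ::
    "'h::complex_inner set \<Rightarrow> ('i \<Rightarrow> 'h \<Rightarrow> 'h) \<Rightarrow> 'k::complex_inner set \<Rightarrow> ('i \<Rightarrow> 'k \<Rightarrow> 'k) \<Rightarrow> bool"
  where
  "similar_modules M T N S \<longleftrightarrow> (\<exists>X.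
    bij_betw X M N \<and>
    (\<forall>x\<in>M. \<forall>y\<in>M. X (x + y) = X x + X y) \<and>
    (\<forall>c. \<forall>x\<in>M. X (c *\<^sub>C x) = c *\<^sub>C X x) \<and>
    (\<exists>C. \<forall>x\<in>M. norm (X x) \<le> C * norm x) \<and>
    (\<exists>C. \<forall>x\<in>M. norm x \<le> C * norm (X x)) \<and>
    (\<forall>i. \<forall>x\<in>M. X (T i x) = S i (X x)))"

end

theory Submission
  imports Defs
begin

text \<open>Let \<open>B i\<close> be the adjoint of multiplication by the \<open>i\<close>-th coordinate. The identity
  \<open>\<parallel>f\<parallel>\<^sup>2 = (\<Sum>i. \<parallel>B i f\<parallel>\<^sup>2) + \<parallel>f 0\<parallel>\<^sup>2\<close> says that the kernel is a complete Pick kernel, and it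
  makes the Drury--Arveson modules projective: if \<open>A\<close> and \<open>B'\<close> are module maps and the range of \<open>B'\<close>
  lies in that of \<open>A\<close>, then \<open>B' = A C\<close> for a module map \<open>C\<close>. Indeed \<open>Y: A\<^sup>* x \<mapsto> B'\<^sup>* x\<close> is bounded
  by Banach--Steinhaus and commutes with the \<open>B i\<close>; it is extended from the closure of the range of
  \<open>A\<^sup>*\<close> to the whole space by a transfer-function realisation whose state space is that closure with
  the equivalent inner product \<open>\<kappa>\<langle>f, g\<rangle> - \<langle>Y f, Y g\<rangle>\<close>, and the adjoint of the extension is \<open>C\<close>.

  The similarity gives a surjective module map \<open>\<rho>\<close> onto a free module with kernel \<open>ran M\<^sub>\<Theta>\<close>. Factoring
  the identity through \<open>\<rho>\<close> yields a right inverse \<open>\<Gamma>\<close>; then \<open>Q = I - \<Gamma> \<rho>\<close> is a module map onto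
  \<open>ran M\<^sub>\<Theta>\<close> fixing that range, and factoring \<open>Q = M\<^sub>\<Theta> C\<close> gives \<open>M\<^sub>\<Theta> C M\<^sub>\<Theta> = M\<^sub>\<Theta>\<close>. Since the joint
  eigenvectors of the \<open>B i\<close> are the kernel functions, \<open>C\<close> is multiplication by a multiplier.\<close>

section \<open>Bounded operators on Hilbert spaces\<close>

text \<open>Closedness is left out: domains of relations, ranges of operators and spans of kernel
  functions are subspaces that need not be closed.\<close>

definition csubspace :: "'a::complex_inner set \<Rightarrow> bool" where
  "csubspace V \<longleftrightarrow> 0 \<in> V \<and> (\<forall>x\<in>V. \<forall>y\<in>V. x + y \<in> V) \<and> (\<forall>c. \<forall>x\<in>V. c *\<^sub>C x \<in> V)"

definition cblinear :: "('a::complex_inner \<Rightarrow> 'b::complex_inner) \<Rightarrow> bool" where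
  "cblinear T \<longleftrightarrow> (\<forall>x y. T (x + y) = T x + T y) \<and> (\<forall>c x. T (c *\<^sub>C x) = c *\<^sub>C T x) \<and>
    (\<exists>K. \<forall>x. norm (T x) \<le> K * norm x)"

lemma cinner_sum_left: "cinner (\<Sum>i\<in>A. f i) (y::'a::complex_inner) = (\<Sum>i\<in>A. cinner (f i) y)"
  by (induction A rule: infinite_finite_induct) (auto simp: cinner_add_left)

lemma cinner_sum_right: "cinner (y::'a::complex_inner) (\<Sum>i\<in>A. f i) = (\<Sum>i\<in>A. cinner y (f i))"
  by (induction A rule: infinite_finite_induct) (auto simp: cinner_add_right)

lemma scaleC_sum_right: "c *\<^sub>C (\<Sum>i\<in>A. f i) = (\<Sum>i\<in>A. c *\<^sub>C (f i :: 'a::complex_inner))"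
  by (induction A rule: infinite_finite_induct) (auto simp: scaleC_add_right)

lemma norm_sq_Re_cinner: "(norm x)\<^sup>2 = Re (cinner x (x::'a::complex_inner))"
  by (simp add: cinner_self)

lemma cinner_scaleR_right: "cinner x (r *\<^sub>R (y::'a::complex_inner)) = of_real r * cinner x y"
  by (simp add: scaleC_of_real[symmetric] cinner_scaleC_right)

lemma Re_cinner_commute: "Re (cinner x y) = Re (cinner y (x::'a::complex_inner))"
  by (subst cinner_commute) simp

lemma norm_add_sq: "(norm (x + y))\<^sup>2 = (norm x)\<^sup>2 + 2 * Re (cinner x y) + (norm (y::'a::complex_inner))\<^sup>2"
  unfolding norm_sq_Re_cinner cinner_add_left cinner_add_right
  by (simp add: Re_cinner_commute[of y x])

lemma norm_diff_sq: "(norm (x - y))\<^sup>2 = (norm x)\<^sup>2 - 2 * Re (cinner x y) + (norm (y::'a::complex_inner))\<^sup>2"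
  unfolding norm_sq_Re_cinner cinner_diff_left cinner_diff_right
  by (simp add: Re_cinner_commute[of y x])

lemma cinner_eqI: "(\<And>y. cinner x y = cinner x' y) \<Longrightarrow> x = (x'::'a::complex_inner)"
  using cinner_self[of "x - x'"] cinner_diff_left[of x x' "x - x'"] by simp

lemma cinner_eqI_right: "(\<And>y. cinner y x = cinner y x') \<Longrightarrow> x = (x'::'a::complex_inner)"
  by (metis cinner_eqI cinner_commute)

lemma bounded_linear_cinner_right: "bounded_linear (\<lambda>x. cinner (y::'a::complex_inner) x)"
proof (rule bounded_linear_intro[where K = "norm y"])
  show "cmod (cinner y x) \<le> norm x * norm y" for x
    using cinner_cauchy_schwarz[of y x] by (simp add: mult.commute)
qed (auto simp: cinner_add_right cinner_scaleR_right scaleR_conv_of_real)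

lemma cblinear_add: "cblinear T \<Longrightarrow> T (x + y) = T x + T y"
  and cblinear_scaleC: "cblinear T \<Longrightarrow> T (c *\<^sub>C x) = c *\<^sub>C T x"
  by (auto simp: cblinear_def)

lemma cblinear_bounded_linear: "cblinear T \<Longrightarrow> bounded_linear T"
proof -
  assume T: "cblinear T"
  then obtain K where "\<And>x. norm (T x) \<le> K * norm x" by (auto simp: cblinear_def)
  with T show ?thesis
    by (intro bounded_linear_intro[where K = K])
      (auto simp: cblinear_add cblinear_scaleC scaleC_of_real[symmetric] mult.commute)
qed

lemma cblinear_iff: "cblinear T \<longleftrightarrow> bounded_linear T \<and> (\<forall>c x. T (c *\<^sub>C x) = c *\<^sub>C T x)"
proof
  assume *: "bounded_linear T \<and> (\<forall>c x. T (c *\<^sub>C x) = c *\<^sub>C T x)"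
  then interpret bounded_linear T by simp
  show "cblinear T" using * bounded unfolding cblinear_def
    by (auto simp: add mult.commute)
qed (simp add: cblinear_bounded_linear cblinear_scaleC)

lemma cblinearI:
  assumes "\<And>x y. T (x + y) = T x + T y" "\<And>c x. T (c *\<^sub>C x) = c *\<^sub>C T x"
    "\<And>x. norm (T x) \<le> K * norm x"
  shows "cblinear T"
  using assms unfolding cblinear_def by blast

lemma cblinear_bound:
  assumes "cblinear T"
  obtains K where "K \<ge> 0" "\<And>x. norm (T x) \<le> K * norm x"
  using bounded_linear.nonneg_bounded[OF cblinear_bounded_linear[OF assms]]
  by (metis mult.commute)

lemma cblinear_diff: "cblinear T \<Longrightarrow> T (x - y) = T x - T y"
  by (intro linear_diff bounded_linear.linear cblinear_bounded_linear)

lemma cblinear_0: "cblinear T \<Longrightarrow> T 0 = 0"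
  by (intro linear_0 bounded_linear.linear cblinear_bounded_linear)

lemma cblinear_sum: "cblinear T \<Longrightarrow> T (\<Sum>i\<in>A. f i) = (\<Sum>i\<in>A. T (f i))"
  by (intro linear_sum bounded_linear.linear cblinear_bounded_linear)

lemma cblinear_tendsto: "cblinear T \<Longrightarrow> (f \<longlongrightarrow> a) F \<Longrightarrow> ((\<lambda>x. T (f x)) \<longlongrightarrow> T a) F"
  by (rule bounded_linear.tendsto[OF cblinear_bounded_linear])

lemma cblinear_continuous: "cblinear T \<Longrightarrow> continuous_on S T"
  by (intro linear_continuous_on cblinear_bounded_linear)

lemma cblinear_ident: "cblinear (\<lambda>x. x)"
  by (rule cblinearI[where K = 1]) auto

lemma cblinear_zero: "cblinear (\<lambda>x. 0)"
  by (rule cblinearI[where K = 0]) auto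

lemma cblinear_compose:
  assumes "cblinear S" "cblinear T"
  shows "cblinear (\<lambda>x. S (T x))"
  using bounded_linear_compose[of S T] assms unfolding cblinear_iff by auto

lemma cblinear_add_fun: "cblinear S \<Longrightarrow> cblinear T \<Longrightarrow> cblinear (\<lambda>x. S x + T x)"
  unfolding cblinear_iff by (auto intro!: bounded_linear_add simp: scaleC_add_right)

lemma cblinear_diff_fun: "cblinear S \<Longrightarrow> cblinear T \<Longrightarrow> cblinear (\<lambda>x. S x - T x)"
  unfolding cblinear_iff by (auto intro!: bounded_linear_sub simp: scaleC_diff_right)

lemma cblinear_scaleC_const: "cblinear (\<lambda>x. c *\<^sub>C x)"
  by (rule cblinearI[where K = "cmod c"])
    (auto simp: scaleC_add_right scaleC_scaleC mult.commute norm_scaleC)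

lemma cblinear_scaleC_fun: "cblinear T \<Longrightarrow> cblinear (\<lambda>x. c *\<^sub>C T x)"
  by (rule cblinear_compose[OF cblinear_scaleC_const])

lemma cblinear_sum_fun: "(\<And>i. i \<in> A \<Longrightarrow> cblinear (T i)) \<Longrightarrow> cblinear (\<lambda>x. \<Sum>i\<in>A. T i x)"
  by (induction A rule: infinite_finite_induct) (auto simp: cblinear_zero intro!: cblinear_add_fun)

lemma cblinear_cinner: "cblinear (\<lambda>x. cinner x y)"
  using bounded_linear_cinner_left by (auto simp: cblinear_iff cinner_scaleC_left scaleC_complex_def)

lemma csubspace_diff: "csubspace V \<Longrightarrow> x \<in> V \<Longrightarrow> y \<in> V \<Longrightarrow> x - y \<in> V"
  using scaleC_minus_one[of y] unfolding csubspace_def by (metis add_uminus_conv_diff)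

lemma csubspace_UNIV: "csubspace UNIV"
  by (simp add: csubspace_def)

lemma csubspace_sum: "csubspace V \<Longrightarrow> (\<And>i. i \<in> A \<Longrightarrow> f i \<in> V) \<Longrightarrow> (\<Sum>i\<in>A. f i) \<in> V"
  by (induction A rule: infinite_finite_induct) (auto simp: csubspace_def)

lemma csubspace_closure:
  assumes "csubspace V"
  shows "csubspace (closure V)"
proof -
  have "x + y \<in> closure V" if xy: "x \<in> closure V" "y \<in> closure V" for x y
  proof -
    obtain f g where "\<And>n. f n \<in> V" "f \<longlonglongrightarrow> x" "\<And>n. g n \<in> V" "g \<longlonglongrightarrow> y"
      using xy unfolding closure_sequential by blast
    then show ?thesis using assms unfolding closure_sequential csubspace_def
      by (intro exI[of _ "\<lambda>n. f n + g n"]) (auto intro: tendsto_add)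
  qed
  moreover have "c *\<^sub>C x \<in> closure V" if x: "x \<in> closure V" for c x
  proof -
    obtain f where "\<And>n. f n \<in> V" "f \<longlonglongrightarrow> x"
      using x unfolding closure_sequential by blast
    then show ?thesis using assms unfolding closure_sequential csubspace_def
      by (intro exI[of _ "\<lambda>n. c *\<^sub>C f n"]) (auto intro: cblinear_tendsto[OF cblinear_scaleC_const])
  qed
  ultimately show ?thesis using assms closure_subset[of V] unfolding csubspace_def by auto
qed

lemma csubspace_range: "cblinear T \<Longrightarrow> csubspace (range T)"
  unfolding csubspace_def
  by (safe; metis cblinear_0 cblinear_add cblinear_scaleC rangeI)

lemma cblinear_in_closure:
  assumes "cblinear T" "\<And>x. x \<in> V \<Longrightarrow> T x \<in> closure W" "x \<in> closure V"
  shows "T x \<in> closure W"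
  using image_closure_subset[where S = V and T = "closure W",
    OF cblinear_continuous[OF assms(1)] closed_closure] assms(2,3) by auto

lemma cblinear_eq_on_closure:
  assumes "cblinear S" "cblinear T" "\<And>x. x \<in> V \<Longrightarrow> S x = T x" "x \<in> closure V"
  shows "S x = T x"
  using cblinear_in_closure[OF cblinear_diff_fun[OF assms(1,2)] _ assms(4), of "{0}"] assms(3) by auto

lemma cinner_zero_on_closure:
  assumes "\<And>x. x \<in> V \<Longrightarrow> cinner x y = 0" "x \<in> closure V"
  shows "cinner x y = 0"
  using cblinear_eq_on_closure[OF cblinear_cinner cblinear_zero, of V y] assms by blast

section \<open>Riesz representation on subspaces\<close>

lemma quadratic_nonneg_imp_zero:
  fixes s N :: real
  assumes "N \<ge> 0" "\<And>t. 0 \<le> 2 * t * s + t\<^sup>2 * N"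
  shows "s = 0"
proof (rule ccontr)
  assume s: "s \<noteq> 0"
  \<comment> \<open>Close to the minimiser \<open>- s / N\<close>; the \<open>+ 1\<close> also
    covers \<open>N = 0\<close>.\<close>
  define t where "t = - s / (N + 1)"
  have "2 * t * s + t\<^sup>2 * N = - (s\<^sup>2 * (N + 2)) / (N + 1)\<^sup>2"
    using assms(1) by (simp add: t_def divide_simps power2_eq_square) (simp add: algebra_simps)
  also have "\<dots> < 0" using s assms(1) by (auto intro!: divide_neg_pos)
  finally show False using assms(2)[of t] by linarith
qed

text \<open>The functional need only be defined on a subspace that is not closed: minimising sequences of
  \<open>\<parallel>x\<parallel>\<^sup>2 - 2 Re \<phi>(x)\<close> converge to a point of the closure.\<close>

lemma riesz_on_subspace:
  fixes V :: "'a::chilbert_space set"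
  assumes V: "csubspace V"
    and add: "\<And>x y. x \<in> V \<Longrightarrow> y \<in> V \<Longrightarrow> \<phi> (x + y) = \<phi> x + \<phi> y"
    and scale: "\<And>c x. x \<in> V \<Longrightarrow> \<phi> (c *\<^sub>C x) = c * \<phi> x"
    and bound: "\<And>x. x \<in> V \<Longrightarrow> cmod (\<phi> x) \<le> K * norm x"
  obtains y where "y \<in> closure V" "\<And>x. x \<in> V \<Longrightarrow> \<phi> x = cinner x y"
proof -
  define J where "J x = (norm x)\<^sup>2 - 2 * Re (\<phi> x)" for x
  have V': "x + y \<in> V" "c *\<^sub>C x \<in> V" "0 \<in> V" "r *\<^sub>R x \<in> V" if "x \<in> V" "y \<in> V" for x y c r
    using V that by (auto simp: csubspace_def scaleC_of_real[symmetric])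
  have V0: "0 \<in> V" using V by (simp add: csubspace_def)
  have scaleR: "\<phi> (r *\<^sub>R x) = of_real r * \<phi> x" if "x \<in> V" for r x
    using scale[OF that, of "of_real r"] by (simp add: scaleC_of_real)
  \<comment> \<open>Completing the square bounds \<open>J\<close> from below, so its infimum
    exists.\<close>
  have lower: "- K\<^sup>2 \<le> J x" if "x \<in> V" for x
  proof -
    have "Re (\<phi> x) \<le> K * norm x" using bound[OF that] complex_Re_le_cmod[of "\<phi> x"] by linarith
    moreover have "0 \<le> (norm x - K)\<^sup>2" by simp
    ultimately show ?thesis by (simp add: J_def power2_eq_square algebra_simps)
  qed
  define m where "m = Inf (J ` V)"
  have bdd: "bdd_below (J ` V)" using lower by (rule bdd_belowI2)
  have m_le: "m \<le> J x" if "x \<in> V" for x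
    unfolding m_def using that bdd by (auto intro: cInf_lower)
  have "\<exists>x\<in>V. J x < m + 1 / real (Suc n)" for n
  proof -
    have "Inf (J ` V) < m + 1 / real (Suc n)" by (simp add: m_def)
    then show ?thesis using cInf_less_iff[OF _ bdd] V0 by blast
  qed
  then obtain X where X: "\<And>n. X n \<in> V" "\<And>n. J (X n) < m + 1 / real (Suc n)" by metis
  \<comment> \<open>The parallelogram law, with the midpoint tested against the infimum
    \<open>m\<close>: almost minimal points are close to each other.\<close>
  have par: "(norm (x - y))\<^sup>2 \<le> 2 * (J x - m) + 2 * (J y - m)" if "x \<in> V" "y \<in> V" for x y
  proof -
    have "m \<le> J ((1/2) *\<^sub>R (x + y))" using that V' by (intro m_le) auto
    also have "\<dots> = (norm (x + y))\<^sup>2 / 4 - Re (\<phi> x) - Re (\<phi> y)"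
      unfolding J_def scaleR[OF V'(1)[OF that]] norm_scaleR
      by (simp add: add that power2_eq_square field_simps)
    finally have "4 * m \<le> (norm (x + y))\<^sup>2 - 4 * Re (\<phi> x) - 4 * Re (\<phi> y)" by simp
    moreover have "(norm (x + y))\<^sup>2 + (norm (x - y))\<^sup>2 = 2 * (norm x)\<^sup>2 + 2 * (norm y)\<^sup>2"
      using norm_add_sq[of x y] norm_diff_sq[of x y] by simp
    ultimately show ?thesis unfolding J_def by argo
  qed
  have "Cauchy X"
  proof (rule metric_CauchyI)
    fix e :: real assume e: "e > 0"
    then obtain N where N: "inverse (real (Suc N)) < e\<^sup>2 / 4"
      using reals_Archimedean[of "e\<^sup>2 / 4"] by auto
    have "dist (X p) (X q) < e" if "p \<ge> N" "q \<ge> N" for p q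
    proof -
      have "1 / real (Suc p) \<le> 1 / real (Suc N)" "1 / real (Suc q) \<le> 1 / real (Suc N)"
        using that by (auto intro!: divide_left_mono)
      then have "(norm (X p - X q))\<^sup>2 < e\<^sup>2"
        using par[OF X(1) X(1), of p q] X(2)[of p] X(2)[of q] N by (simp add: inverse_eq_divide)
      then show ?thesis using e by (simp add: dist_norm power2_less_imp_less)
    qed
    then show "\<exists>M. \<forall>m\<ge>M. \<forall>n\<ge>M. dist (X m) (X n) < e" by blast
  qed
  then obtain y where y: "X \<longlonglongrightarrow> y" using Cauchy_convergent convergent_def by blast
  have Re: "Re (\<phi> x) = Re (cinner x y)" if x: "x \<in> V" for x
  proof -
    \<comment> \<open>Perturbing \<open>X n\<close> by \<open>t *\<^sub>R x\<close> cannot push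
      \<open>J\<close> below \<open>m\<close>, and \<open>J (X n)\<close> exceeds \<open>m\<close>
      by less than \<open>1 / real (Suc n)\<close>.\<close>
    have "0 \<le> 2 * t * (Re (cinner x y) - Re (\<phi> x)) + t\<^sup>2 * (norm x)\<^sup>2" for t
    proof (rule LIMSEQ_le_const)
      have "(\<lambda>n. 1 / real (Suc n) + (2 * t * (Re (cinner x (X n)) - Re (\<phi> x)) + t\<^sup>2 * (norm x)\<^sup>2))
        \<longlonglongrightarrow> 0 + (2 * t * (Re (cinner x y) - Re (\<phi> x)) + t\<^sup>2 * (norm x)\<^sup>2)"
        by (intro tendsto_intros y bounded_linear.tendsto[OF bounded_linear_cinner_right]
            LIMSEQ_Suc lim_1_over_n)
      then show "(\<lambda>n. 1 / real (Suc n) + (2 * t * (Re (cinner x (X n)) - Re (\<phi> x)) + t\<^sup>2 * (norm x)\<^sup>2))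
        \<longlonglongrightarrow> 2 * t * (Re (cinner x y) - Re (\<phi> x)) + t\<^sup>2 * (norm x)\<^sup>2" by simp
      have "0 \<le> 1 / real (Suc n) + (2 * t * (Re (cinner x (X n)) - Re (\<phi> x)) + t\<^sup>2 * (norm x)\<^sup>2)" for n
      proof -
        have "m \<le> J (X n + t *\<^sub>R x)" using x X V' by (intro m_le) auto
        also have "\<dots> = J (X n) + 2 * t * (Re (cinner x (X n)) - Re (\<phi> x)) + t\<^sup>2 * (norm x)\<^sup>2"
          using x X V' by (simp add: J_def add scaleR norm_add_sq cinner_scaleR_right
              Re_cinner_commute[of "X n"] power_mult_distrib algebra_simps)
        finally show ?thesis using X(2)[of n] by linarith
      qed
      then show "\<exists>N. \<forall>n\<ge>N. 0 \<le> 1 / real (Suc n) +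
          (2 * t * (Re (cinner x (X n)) - Re (\<phi> x)) + t\<^sup>2 * (norm x)\<^sup>2)" by blast
    qed
    then show ?thesis
      using quadratic_nonneg_imp_zero[of "(norm x)\<^sup>2" "Re (cinner x y) - Re (\<phi> x)"] by simp
  qed
  have "\<phi> x = cinner x y" if x: "x \<in> V" for x
  proof (rule complex_eqI)
    show "Re (\<phi> x) = Re (cinner x y)" by (rule Re[OF x])
    \<comment> \<open>Up to sign, complex homogeneity turns the imaginary part at \<open>x\<close>
      into a real part at \<open>\<i> *\<^sub>C x\<close>.\<close>
    show "Im (\<phi> x) = Im (cinner x y)"
      using Re[of "\<i> *\<^sub>C x"] scale[OF x, of \<i>] V x by (simp add: csubspace_def cinner_scaleC_left)
  qed
  moreover have "y \<in> closure V" using X(1) y unfolding closure_sequential by blast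
  ultimately show ?thesis using that by blast
qed

section \<open>Adjoints and extension of bounded operators\<close>

lemma cblinear_riesz:
  fixes \<phi> :: "'a::chilbert_space \<Rightarrow> complex"
  assumes "cblinear \<phi>"
  obtains y where "\<And>x. \<phi> x = cinner x y"
proof -
  obtain K where K: "\<And>x. cmod (\<phi> x) \<le> K * norm x" using assms by (auto simp: cblinear_def)
  show ?thesis
    by (rule riesz_on_subspace[OF csubspace_UNIV, of \<phi> K])
      (use K that in \<open>auto simp: cblinear_add[OF assms] cblinear_scaleC[OF assms] scaleC_complex_def\<close>)
qed

text \<open>The choice is meaningful only for \<open>cblinear\<close> operators, where the Riesz
  representation supplies the vector.\<close>

definition adj :: "('a::chilbert_space \<Rightarrow> 'b::chilbert_space) \<Rightarrow> 'b \<Rightarrow> 'a" where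
  "adj T y = (SOME z. \<forall>x. cinner (T x) y = cinner x z)"

lemma cinner_adj_right:
  assumes "cblinear T"
  shows "cinner x (adj T y) = cinner (T x) y"
proof -
  obtain z where "\<And>x. cinner (T x) y = cinner x z"
    using cblinear_riesz[OF cblinear_compose[OF cblinear_cinner assms], of y] by blast
  then have "\<forall>x. cinner (T x) y = cinner x (adj T y)"
    unfolding adj_def by (intro someI_ex[of "\<lambda>z. \<forall>x. cinner (T x) y = cinner x z"]) blast
  then show ?thesis by simp
qed

lemma cinner_adj_left: "cblinear T \<Longrightarrow> cinner (adj T y) x = cinner y (T x)"
  by (metis cinner_adj_right cinner_commute)

lemma adj_eqI:
  assumes "cblinear T" "\<And>x. cinner (T x) y = cinner x z"
  shows "adj T y = z"
  by (rule cinner_eqI_right) (simp add: cinner_adj_right assms)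

text \<open>Turns a Cauchy-Schwarz estimate with \<open>x\<close> on both sides into a norm bound by
  cancelling one factor \<open>norm x\<close>; it bounds adjoints, projections and point
  evaluations.\<close>

lemma norm_le_if_cinner_le:
  fixes x :: "'a::complex_inner"
  assumes "cmod (cinner x x) \<le> K * norm x" "K \<ge> 0"
  shows "norm x \<le> K"
  using assms by (cases "x = 0") (auto simp: cinner_self power2_eq_square norm_mult)

lemma cblinear_adj:
  assumes T: "cblinear T"
  shows "cblinear (adj T)"
proof -
  obtain K where K: "K \<ge> 0" "\<And>x. norm (T x) \<le> K * norm x" using cblinear_bound[OF T] by blast
  have "norm (adj T y) \<le> K * norm y" for y
  proof (rule norm_le_if_cinner_le)
    have "cmod (cinner (adj T y) (adj T y)) \<le> norm y * norm (T (adj T y))"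
      unfolding cinner_adj_left[OF T] by (rule cinner_cauchy_schwarz)
    also have "\<dots> \<le> norm y * (K * norm (adj T y))" by (intro mult_left_mono K) simp
    finally show "cmod (cinner (adj T y) (adj T y)) \<le> K * norm y * norm (adj T y)"
      by (simp add: mult_ac)
  qed (use K in simp)
  then show ?thesis
    by (intro cblinearI[where K = K])
      (auto intro!: adj_eqI[OF T] simp: cinner_add_right cinner_scaleC_right cinner_adj_right[OF T])
qed

lemma adj_adj: "cblinear T \<Longrightarrow> adj (adj T) = T"
  by (intro ext adj_eqI) (auto simp: cblinear_adj cinner_adj_left)

lemma adj_compose:
  assumes "cblinear S" "cblinear T"
  shows "adj (\<lambda>x. S (T x)) y = adj T (adj S y)"
  by (rule adj_eqI[OF cblinear_compose[OF assms]]) (simp add: cinner_adj_right assms)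

text \<open>Linearity and boundedness make the relation single-valued, so callers need not show that
  images are well defined. The extension is the adjoint of \<open>s\<close>, where
  \<open>s z\<close> represents \<open>x \<mapsto> cinner (t x) z\<close>; it vanishes on the
  orthogonal complement of the domain.\<close>

lemma extend_bounded_relation:
  fixes R :: "('a::chilbert_space \<times> 'b::chilbert_space) set"
  assumes add: "\<And>x y x' y'. (x, y) \<in> R \<Longrightarrow> (x', y') \<in> R \<Longrightarrow> (x + x', y + y') \<in> R"
    and scale: "\<And>c x y. (x, y) \<in> R \<Longrightarrow> (c *\<^sub>C x, c *\<^sub>C y) \<in> R"
    and bound: "\<And>x y. (x, y) \<in> R \<Longrightarrow> norm y \<le> K * norm x"
    and "R \<noteq> {}"
  obtains T where "cblinear T" "\<And>x y. (x, y) \<in> R \<Longrightarrow> T x = y"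
proof -
  have zero: "(0, 0) \<in> R" using \<open>R \<noteq> {}\<close> scale[of _ _ 0] by auto
  define V where "V = Domain R"
  have V: "csubspace V"
    unfolding csubspace_def V_def using zero add scale by blast
  have unique: "y = y'" if "(x, y) \<in> R" "(x, y') \<in> R" for x y y'
    using bound[OF add[OF that(1) scale[OF that(2), of "-1"]]] by (simp add: scaleC_minus_one)
  define t where "t x = (THE y. (x, y) \<in> R)" for x
  have t: "t x = y" if "(x, y) \<in> R" for x y
    unfolding t_def using that unique by blast
  have tR: "(x, t x) \<in> R" if "x \<in> V" for x using that t by (auto simp: V_def)
  have t_add: "t (x + x') = t x + t x'" if "x \<in> V" "x' \<in> V" for x x'
    by (intro t add tR that)
  have t_scale: "t (c *\<^sub>C x) = c *\<^sub>C t x" if "x \<in> V" for c x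
    by (intro t scale tR that)
  have K': "norm (t x) \<le> \<bar>K\<bar> * norm x" if "x \<in> V" for x
    using bound[OF tR[OF that]] by (meson abs_ge_self mult_right_mono norm_ge_zero order_trans)
  \<comment> \<open>Taking the representing vector in the closure of \<open>V\<close> makes it
    unique, which gives linearity of \<open>s\<close>.\<close>
  have "\<exists>y\<in>closure V. \<forall>x\<in>V. cinner (t x) z = cinner x y" for z
  proof -
    have b: "cmod (cinner (t x) z) \<le> \<bar>K\<bar> * norm z * norm x" if "x \<in> V" for x
      using cinner_cauchy_schwarz[of "t x" z] mult_right_mono[OF K'[OF that], of "norm z"]
      by (simp add: mult_ac)
    show ?thesis
    proof (rule riesz_on_subspace[OF V])
      show "cinner (t (x + y)) z = cinner (t x) z + cinner (t y) z" if "x \<in> V" "y \<in> V" for x y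
        by (simp add: t_add that cinner_add_left)
      show "cinner (t (c *\<^sub>C x)) z = c * cinner (t x) z" if "x \<in> V" for c x
        by (simp add: t_scale that cinner_scaleC_left)
    qed (use b in auto)
  qed
  then obtain s where s: "\<And>z. s z \<in> closure V" "\<And>z x. x \<in> V \<Longrightarrow> cinner (t x) z = cinner x (s z)"
    by metis
  have cl: "csubspace (closure V)" by (rule csubspace_closure[OF V])
  have s_unique: "s z = y" if "y \<in> closure V" "\<And>x. x \<in> V \<Longrightarrow> cinner (t x) z = cinner x y" for y z
  proof -
    have "cinner x (s z - y) = 0" if "x \<in> V" for x
      unfolding cinner_diff_right using \<open>\<And>x. x \<in> V \<Longrightarrow> cinner (t x) z = cinner x y\<close>[OF that]
        s(2)[OF that, of z] by simp
    then have "cinner (s z - y) (s z - y) = 0"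
      using csubspace_diff[OF cl s(1) that(1)] by (rule cinner_zero_on_closure)
    then show ?thesis by (simp add: cinner_self)
  qed
  have "norm (s z) \<le> \<bar>K\<bar> * norm z" for z
  proof (rule norm_le_if_cinner_le)
    have "closed {x. cmod (cinner x (s z)) \<le> \<bar>K\<bar> * norm z * norm x}"
      by (intro closed_Collect_le continuous_intros cblinear_continuous cblinear_cinner)
    moreover have "V \<subseteq> {x. cmod (cinner x (s z)) \<le> \<bar>K\<bar> * norm z * norm x}"
    proof
      fix x assume x: "x \<in> V"
      show "x \<in> {x. cmod (cinner x (s z)) \<le> \<bar>K\<bar> * norm z * norm x}"
        using cinner_cauchy_schwarz[of "t x" z] mult_right_mono[OF K'[OF x], of "norm z"] s(2)[OF x]
        by (simp add: mult_ac)
    qed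
    ultimately show "cmod (cinner (s z) (s z)) \<le> \<bar>K\<bar> * norm z * norm (s z)"
      using s(1) closure_minimal by blast
  qed simp
  moreover have "s (z + z') = s z + s z'" for z z'
    using s cl by (intro s_unique) (auto simp: csubspace_def cinner_add_right)
  moreover have "s (c *\<^sub>C z) = c *\<^sub>C s z" for c z
    using s cl by (intro s_unique) (auto simp: csubspace_def cinner_scaleC_right)
  ultimately have S: "cblinear s" by (intro cblinearI[where K = "\<bar>K\<bar>"])
  show ?thesis
  proof
    show "cblinear (adj s)" by (rule cblinear_adj[OF S])
    show "adj s x = y" if "(x, y) \<in> R" for x y
    proof (rule adj_eqI[OF S])
      have "x \<in> V" using that by (auto simp: V_def)
      then have "cinner y z = cinner x (s z)" for z using s(2)[of x z] t[OF that] by simp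
      then show "cinner (s z) x = cinner z y" for z by (metis cinner_commute)
    qed
  qed
qed

section \<open>Orthogonal projections and coercive equations\<close>

lemma orth_projection_unique:
  assumes M: "csubspace M" and "p \<in> M" "x - p \<in> orth_complement M"
  shows "orth_projection M x = p"
  unfolding orth_projection_def
proof (rule the_equality)
  fix q assume q: "q \<in> M \<and> x - q \<in> orth_complement M"
  have "q - p \<in> M" using q assms by (intro csubspace_diff) auto
  then have "cinner (x - p) (q - p) = 0" "cinner (x - q) (q - p) = 0"
    using q assms by (auto simp: orth_complement_def)
  then have "cinner ((x - p) - (x - q)) (q - p) = 0" by (subst cinner_diff_left) simp
  then show "q = p" by (simp add: cinner_self)
qed (use assms in simp)

lemma orth_projection_props:
  fixes M :: "'a::chilbert_space set"
  assumes M: "csubspace M" "closed M"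
  shows orth_projection_mem: "orth_projection M x \<in> M"
    and orth_projection_orth: "x - orth_projection M x \<in> orth_complement M"
proof -
  have "cmod (cinner y x) \<le> norm x * norm y" for y
    using cinner_cauchy_schwarz[of y x] by (simp add: mult.commute)
  \<comment> \<open>The projection of \<open>x\<close> is the vector of \<open>M\<close> that
    represents \<open>y \<mapsto> cinner y x\<close> on \<open>M\<close>.\<close>
  then obtain p where p: "p \<in> closure M" "\<And>y. y \<in> M \<Longrightarrow> cinner y x = cinner y p"
    using riesz_on_subspace[OF M(1), of "\<lambda>y. cinner y x" "norm x"]
    by (auto simp: cinner_add_left cinner_scaleC_left)
  have "cinner (x - p) y = 0" if "y \<in> M" for y
  proof -
    have "cinner y (x - p) = 0" using p(2)[OF that] by (simp add: cinner_diff_right)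
    then show ?thesis by (metis cinner_commute complex_cnj_zero)
  qed
  then have "p \<in> M" "x - p \<in> orth_complement M" using p(1) M(2) by (auto simp: orth_complement_def)
  moreover from this have "orth_projection M x = p" by (rule orth_projection_unique[OF M(1)])
  ultimately show "orth_projection M x \<in> M" "x - orth_projection M x \<in> orth_complement M" by auto
qed

lemma orth_complement_cinner_right:
  "x \<in> orth_complement M \<Longrightarrow> y \<in> M \<Longrightarrow> cinner y x = 0"
  unfolding orth_complement_def by (metis (mono_tags, lifting) cinner_commute complex_cnj_zero mem_Collect_eq)

lemma csubspace_orth_complement: "csubspace (orth_complement M)"
  by (auto simp: csubspace_def orth_complement_def cinner_add_left cinner_scaleC_left)

lemma closed_orth_complement: "closed (orth_complement M)"
proof -
  have "orth_complement M = (\<Inter>s\<in>M. {x. cinner x s = 0})" by (auto simp: orth_complement_def)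
  then show ?thesis
    by (auto intro!: closed_Collect_eq cblinear_continuous cblinear_cinner continuous_intros)
qed

lemma norm_orth_projection_le:
  fixes M :: "'a::chilbert_space set"
  assumes M: "csubspace M" "closed M"
  shows "norm (orth_projection M x) \<le> norm x"
proof (rule norm_le_if_cinner_le)
  let ?p = "orth_projection M x"
  have "cinner (x - ?p) ?p = 0"
    using orth_projection_props[OF M, of x] by (auto simp: orth_complement_def)
  then have "cinner ?p ?p = cinner x ?p" by (simp add: cinner_diff_left)
  then show "cmod (cinner ?p ?p) \<le> norm x * norm ?p" using cinner_cauchy_schwarz by metis
qed simp

lemma cblinear_orth_projection:
  fixes M :: "'a::chilbert_space set"
  assumes M: "csubspace M" "closed M"
  shows "cblinear (orth_projection M)"
proof (rule cblinearI[where K = 1])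
  note p = orth_projection_props[OF M]
  note C = csubspace_orth_complement[of M]
  show "orth_projection M (x + y) = orth_projection M x + orth_projection M y" for x y
  proof (rule orth_projection_unique[OF M(1)])
    have "(x - orth_projection M x) + (y - orth_projection M y) \<in> orth_complement M"
      using p C unfolding csubspace_def by blast
    then show "x + y - (orth_projection M x + orth_projection M y) \<in> orth_complement M"
      by (simp add: algebra_simps)
  qed (use p M in \<open>auto simp: csubspace_def\<close>)
  show "orth_projection M (c *\<^sub>C x) = c *\<^sub>C orth_projection M x" for c x
  proof (rule orth_projection_unique[OF M(1)])
    have "c *\<^sub>C (x - orth_projection M x) \<in> orth_complement M"
      using p C unfolding csubspace_def by blast
    then show "c *\<^sub>C x - c *\<^sub>C orth_projection M x \<in> orth_complement M"
      by (simp add: scaleC_diff_right)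
  qed (use p M in \<open>auto simp: csubspace_def\<close>)
qed (use norm_orth_projection_le[OF M] in simp)

lemma orth_projection_id:
  "csubspace M \<Longrightarrow> x \<in> M \<Longrightarrow> orth_projection M x = x"
  by (rule orth_projection_unique) (auto simp: orth_complement_def)

lemma orth_projection_orth_complement:
  fixes M :: "'a::chilbert_space set"
  assumes M: "csubspace M" "closed M"
  shows "orth_projection (orth_complement M) x = x - orth_projection M x"
proof (rule orth_projection_unique[OF csubspace_orth_complement])
  note p = orth_projection_props[OF M, of x]
  show "x - orth_projection M x \<in> orth_complement M" by (rule p)
  have "cinner (orth_projection M x) s = 0" if "s \<in> orth_complement M" for s
    using orth_complement_cinner_right[OF that p(1)] .
  then show "x - (x - orth_projection M x) \<in> orth_complement (orth_complement M)"
    by (simp add: orth_complement_def)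
qed

text \<open>Banach's fixed point theorem for
  \<open>x \<mapsto> P (x - r *\<^sub>C (T x - y))\<close> on \<open>F\<close>. The equation is only
  tested against \<open>F\<close>, which \<open>T\<close> need not preserve.\<close>

lemma lax_milgram:
  fixes F :: "'a::chilbert_space set"
  assumes F: "csubspace F" "closed F" and T: "cblinear T"
    and d: "\<delta> > 0" and coercive: "\<And>x. x \<in> F \<Longrightarrow> \<delta> * (norm x)\<^sup>2 \<le> Re (cinner (T x) x)"
  obtains x where "x \<in> F" "\<And>f. f \<in> F \<Longrightarrow> cinner (T x) f = cinner y f"
proof -
  obtain K0 where K0: "\<And>x. norm (T x) \<le> K0 * norm x" using cblinear_bound[OF T] by blast
  \<comment> \<open>At least \<open>\<delta>\<close>, so that \<open>K\<close> is positive and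
    \<open>c\<close> is the root of a nonnegative number.\<close>
  define K where "K = max K0 \<delta>"
  have K: "norm (T x) \<le> K * norm x" for x
    using K0[of x] mult_right_mono[of K0 K "norm x"] by (simp add: K_def)
  have Kd: "\<delta> \<le> K" "K > 0" using d by (auto simp: K_def)
  \<comment> \<open>This step size minimises
    \<open>1 - 2 * r * \<delta> + r\<^sup>2 * K\<^sup>2\<close>, the bound for the squared Lipschitz
    constant.\<close>
  define r where "r = \<delta> / K\<^sup>2"
  have r: "r > 0" using d Kd by (simp add: r_def)
  define c where "c = sqrt (1 - \<delta>\<^sup>2 / K\<^sup>2)"
  have c: "0 \<le> c" "c < 1" "c\<^sup>2 = 1 - \<delta>\<^sup>2 / K\<^sup>2"
    using d Kd power_mono[of \<delta> K 2] by (auto simp: c_def divide_simps)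
  define P where "P = orth_projection F"
  note P = orth_projection_props[OF F, folded P_def] and P_lin = cblinear_orth_projection[OF F, folded P_def]
  define h where "h x = P (x - r *\<^sub>C (T x - y))" for x
  have "\<exists>!x\<in>F. h x = x"
  proof (rule Banach_fix[OF _ _ c(1,2)])
    show "complete F" using F(2) by (simp add: complete_eq_closed)
    show "F \<noteq> {}" using F(1) by (auto simp: csubspace_def)
    show "h ` F \<subseteq> F" using P by (auto simp: h_def)
  next
    fix x x' assume "x \<in> F" "x' \<in> F"
    define z where "z = x - x'"
    have z: "z \<in> F" unfolding z_def using \<open>x \<in> F\<close> \<open>x' \<in> F\<close> by (rule csubspace_diff[OF F(1)])
    have "h x - h x' = P ((x - r *\<^sub>C (T x - y)) - (x' - r *\<^sub>C (T x' - y)))"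
      unfolding h_def by (rule cblinear_diff[OF P_lin, symmetric])
    also have "(x - r *\<^sub>C (T x - y)) - (x' - r *\<^sub>C (T x' - y)) = z - r *\<^sub>C T z"
      by (simp add: z_def cblinear_diff[OF T] scaleC_diff_right algebra_simps)
    finally have "norm (h x - h x') \<le> norm (z - r *\<^sub>C T z)"
      using norm_orth_projection_le[OF F] by (simp add: P_def)
    then have "(norm (h x - h x'))\<^sup>2 \<le> (norm (z - r *\<^sub>C T z))\<^sup>2" by (intro power_mono) auto
    also have "\<dots> = (norm z)\<^sup>2 - 2 * r * Re (cinner (T z) z) + r\<^sup>2 * (norm (T z))\<^sup>2"
      by (simp add: norm_diff_sq cinner_scaleC_right norm_scaleC Re_cinner_commute[of z]
          power_mult_distrib)
    also have "\<dots> \<le> (norm z)\<^sup>2 - 2 * r * (\<delta> * (norm z)\<^sup>2) + r\<^sup>2 * (K * norm z)\<^sup>2"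
      using coercive[OF z] r K[of z]
      by (intro add_mono diff_mono mult_left_mono power_mono) auto
    also have "\<dots> = (1 - \<delta>\<^sup>2 / K\<^sup>2) * (norm z)\<^sup>2"
      using Kd by (simp add: r_def field_simps power2_eq_square)
    also have "\<dots> = (c * norm z)\<^sup>2" by (simp only: power_mult_distrib c(3))
    finally show "dist (h x) (h x') \<le> c * dist x x'"
      using c by (simp add: dist_norm z_def power2_le_iff_abs_le)
  qed
  then obtain x where x: "x \<in> F" "h x = x" by blast
  have "cinner (T x) f = cinner y f" if f: "f \<in> F" for f
  proof -
    have "cinner ((x - r *\<^sub>C (T x - y)) - x) f = 0"
      using P(2)[of "x - r *\<^sub>C (T x - y)"] f x(2) by (simp add: h_def orth_complement_def)
    then have "of_real r * cinner (T x - y) f = 0"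
      by (simp add: cinner_minus_left cinner_scaleC_left)
    then show ?thesis using r by (simp add: cinner_diff_left)
  qed
  then show ?thesis using x that by blast
qed

section \<open>Kernel functions and the backward shifts\<close>

text \<open>The kernel function at \<open>w\<close> in direction \<open>e\<close>, meaningful for
  \<open>w\<close> in the ball only, since \<open>Abs_drury_arveson\<close> is unspecified on
  functions outside the space.\<close>

definition kern :: "complex ^ 'n \<Rightarrow> 'e \<Rightarrow> ('n::finite, 'e::chilbert_space) drury_arveson" where
  "kern w e = Abs_drury_arveson (\<lambda>z. if z \<in> ball 0 1 then drury_arveson_kernel z w *\<^sub>C e else 0)"

lemma eval_kern:
  "w \<in> ball 0 1 \<Longrightarrow> eval (kern w e) z = (if z \<in> ball 0 1 then drury_arveson_kernel z w *\<^sub>C e else 0)"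
  unfolding kern_def by (subst Abs_drury_arveson_inverse[OF da.kernel_mem]) auto

lemma cinner_kern_right: "w \<in> ball 0 1 \<Longrightarrow> cinner f (kern w e) = cinner (eval f w) e"
  unfolding cinner_drury_arveson_def kern_def
  by (subst Abs_drury_arveson_inverse[OF da.kernel_mem]) (assumption, rule da.reproducing[OF eval])

lemma cinner_kern_left: "w \<in> ball 0 1 \<Longrightarrow> cinner (kern w e) f = cinner e (eval f w)"
  by (metis cinner_commute cinner_kern_right)

lemma eval_off_ball: "z \<notin> ball 0 1 \<Longrightarrow> eval f z = 0"
  by (rule da.support[OF eval])

lemma drury_arveson_eqI:
  fixes f g :: "('n::finite, 'e::chilbert_space) drury_arveson"
  assumes "\<And>z. z \<in> ball 0 1 \<Longrightarrow> eval f z = eval g z"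
  shows "f = g"
proof -
  have "eval f z = eval g z" for z using assms eval_off_ball by (metis (no_types))
  then show ?thesis by (auto simp: eval_inject[symmetric])
qed

lemma ball_inner_less_1:
  assumes "z \<in> ball 0 1" "w \<in> ball 0 1"
  shows "cmod (ball_inner z w) < 1"
proof -
  have "norm z * norm w < 1 * 1"
    using assms by (intro mult_strict_mono') auto
  then show ?thesis using ball_inner_bound[of z w] by simp
qed

text \<open>The scalar form of the complete Pick property; the norm recurrences below come from
  it.\<close>

lemma kernel_recurrence:
  assumes "z \<in> ball 0 1" "w \<in> ball 0 1"
  shows "ball_inner z w * drury_arveson_kernel z w + 1 = drury_arveson_kernel z w"
proof -
  have "1 - ball_inner z w \<noteq> 0" using ball_inner_less_1[OF assms] by auto
  then show ?thesis by (simp add: drury_arveson_kernel_def field_simps)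
qed

lemma kernel_at_0 [simp]: "drury_arveson_kernel 0 w = 1" "drury_arveson_kernel z 0 = 1"
  by (simp_all add: drury_arveson_kernel_def ball_inner_def)

lemma norm_vec_square: "(norm (w :: complex ^ 'n))\<^sup>2 = (\<Sum>i\<in>UNIV. (cmod (w $ i))\<^sup>2)"
  by (simp add: norm_vec_def L2_set_def sum_nonneg)

lemma kern_add: "w \<in> ball 0 1 \<Longrightarrow> kern w (e + e') = kern w e + kern w e'"
  by (rule drury_arveson_eqI) (simp add: eval_kern eval_add scaleC_add_right)

lemma kern_scaleC: "w \<in> ball 0 1 \<Longrightarrow> kern w (c *\<^sub>C e) = c *\<^sub>C kern w e"
  by (rule drury_arveson_eqI) (simp add: eval_kern eval_scaleC scaleC_scaleC mult.commute)

lemma cinner_kern_kern: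
  "w \<in> ball 0 1 \<Longrightarrow> v \<in> ball 0 1 \<Longrightarrow>
    cinner (kern w x) (kern v y) = drury_arveson_kernel v w * cinner x y"
  by (simp add: cinner_kern_right eval_kern cinner_scaleC_left)

lemma norm_kern_le:
  assumes "w \<in> ball 0 1"
  shows "norm (kern w e) \<le> 1 / (1 - norm w) * norm e"
proof (rule power2_le_imp_le)
  let ?r = "norm w"
  have r: "0 \<le> ?r" "?r < 1" using assms by auto
  then have r2: "?r\<^sup>2 < 1" by (simp add: power_less_one_iff abs_square_less_1)
  have "complex_of_real ((norm (kern w e))\<^sup>2) = of_real (1 / (1 - ?r\<^sup>2) * (norm e)\<^sup>2)"
    unfolding cinner_self[symmetric] cinner_kern_kern[OF assms assms]
    by (simp add: drury_arveson_kernel_def ball_inner_self cinner_self)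
  then have eq: "(norm (kern w e))\<^sup>2 = 1 / (1 - ?r\<^sup>2) * (norm e)\<^sup>2" by (simp only: of_real_eq_iff)
  have "(1 - ?r)\<^sup>2 \<le> (1 - ?r) * (1 + ?r)"
    unfolding power2_eq_square using r by (intro mult_left_mono) auto
  also have "\<dots> = 1 - ?r\<^sup>2" by (simp add: power2_eq_square algebra_simps)
  finally have "1 / (1 - ?r\<^sup>2) \<le> 1 / (1 - ?r)\<^sup>2"
    using r r2 by (intro divide_left_mono mult_pos_pos) auto
  then show "(norm (kern w e))\<^sup>2 \<le> (1 / (1 - ?r) * norm e)\<^sup>2"
    unfolding eq power_mult_distrib power_one_over by (intro mult_right_mono) auto
  show "0 \<le> 1 / (1 - norm w) * norm e" using r by simp
qed

lemma cblinear_kern: "w \<in> ball 0 1 \<Longrightarrow> cblinear (kern w)"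
  by (rule cblinearI[OF kern_add kern_scaleC norm_kern_le])

lemma norm_eval_le:
  assumes "w \<in> ball 0 1"
  shows "norm (eval f w) \<le> 1 / (1 - norm w) * norm f"
proof (rule norm_le_if_cinner_le)
  have "cmod (cinner (eval f w) (eval f w)) \<le> norm f * norm (kern w (eval f w))"
    unfolding cinner_kern_right[OF assms, symmetric] by (rule cinner_cauchy_schwarz)
  also have "\<dots> \<le> norm f * (1 / (1 - norm w) * norm (eval f w))"
    by (intro mult_left_mono norm_kern_le assms) simp
  finally show "cmod (cinner (eval f w) (eval f w)) \<le> 1 / (1 - norm w) * norm f * norm (eval f w)"
    by (simp add: mult_ac)
qed (use assms in simp)

lemma cblinear_eval: "cblinear (\<lambda>f. eval f w)"
proof (cases "w \<in> ball 0 1")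
  case True
  then show ?thesis
    by (intro cblinearI[where K = "1 / (1 - norm w)"] norm_eval_le) (auto simp: eval_add eval_scaleC)
next
  case False
  then show ?thesis by (simp add: eval_off_ball cblinear_zero)
qed

text \<open>By the reproducing property the adjoint of \<open>S - T\<close> maps every vector to a
  function vanishing on the ball. Operator identities can therefore be checked on kernel
  functions.\<close>

lemma cblinear_kern_eqI:
  fixes S T :: "('n::finite, 'e::chilbert_space) drury_arveson \<Rightarrow> 'b::chilbert_space"
  assumes S: "cblinear S" and T: "cblinear T"
    and eq: "\<And>w e. w \<in> ball 0 1 \<Longrightarrow> S (kern w e) = T (kern w e)"
  shows "S x = T x"
proof -
  define D where "D x = S x - T x" for x
  have D: "cblinear D" unfolding D_def by (rule cblinear_diff_fun[OF S T])
  have "adj D y = 0" for y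
  proof (rule drury_arveson_eqI)
    fix w :: "complex ^ 'n" assume w: "w \<in> ball 0 1"
    have "cinner (eval (adj D y) w) e = cinner 0 e" for e
      using cinner_kern_right[OF w, of "adj D y" e] cinner_adj_left[OF D, of y "kern w e"]
      by (simp add: D_def eq[OF w])
    then show "eval (adj D y) w = eval 0 w" by (auto simp: eval_zero intro: cinner_eqI)
  qed
  then have "cinner (D x) y = cinner 0 y" for y using cinner_adj_right[OF D, of x y] by simp
  then have "D x = 0" by (rule cinner_eqI)
  then show ?thesis by (simp add: D_def)
qed

section \<open>Finite combinations of kernel functions\<close>

definition kern_span :: "('n::finite, 'e::chilbert_space) drury_arveson set" where
  "kern_span = {\<Sum>w\<in>J. kern w (e w) | J e. finite J \<and> J \<subseteq> ball 0 1}"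

text \<open>With one coefficient per point, adding two combinations means passing to the union of
  the index sets and padding with zeros.\<close>

lemma sum_union_add:
  fixes \<zeta> :: "'w \<Rightarrow> 'e::complex_inner \<Rightarrow> 'b::complex_inner"
  assumes "finite J" "finite J'"
    and add: "\<And>w x y. w \<in> J \<union> J' \<Longrightarrow> \<zeta> w (x + y) = \<zeta> w x + \<zeta> w y"
  shows "(\<Sum>w\<in>J. \<zeta> w (e w)) + (\<Sum>w\<in>J'. \<zeta> w (e' w)) =
    (\<Sum>w\<in>J \<union> J'. \<zeta> w ((if w \<in> J then e w else 0) + (if w \<in> J' then e' w else 0)))"
proof -
  have z: "\<zeta> w 0 = 0" if "w \<in> J \<union> J'" for w using add[OF that, of 0 0] by simp
  have "(\<Sum>w\<in>J. \<zeta> w (e w)) = (\<Sum>w\<in>J \<union> J'. \<zeta> w (if w \<in> J then e w else 0))"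
    using assms z by (intro sum.mono_neutral_cong_left) auto
  moreover have "(\<Sum>w\<in>J'. \<zeta> w (e' w)) = (\<Sum>w\<in>J \<union> J'. \<zeta> w (if w \<in> J' then e' w else 0))"
    using assms z by (intro sum.mono_neutral_cong_left) auto
  ultimately show ?thesis by (simp add: sum.distrib[symmetric] add)
qed

text \<open>An operator may be prescribed on kernel functions once a single bound holds for all
  finite combinations; the same bound makes the prescription consistent.\<close>

lemma extend_from_kern:
  fixes \<zeta> :: "complex ^ 'n \<Rightarrow> 'e::chilbert_space \<Rightarrow> 'b::chilbert_space"
  assumes add: "\<And>w x y. w \<in> ball 0 1 \<Longrightarrow> \<zeta> w (x + y) = \<zeta> w x + \<zeta> w y"
    and scale: "\<And>w c x. w \<in> ball 0 1 \<Longrightarrow> \<zeta> w (c *\<^sub>C x) = c *\<^sub>C \<zeta> w x"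
    and bound: "\<And>J e. finite J \<Longrightarrow> J \<subseteq> ball 0 1 \<Longrightarrow>
      norm (\<Sum>w\<in>J. \<zeta> w (e w)) \<le> K * norm (\<Sum>w\<in>J. kern w (e w))"
  obtains T where "cblinear T" "\<And>w e. w \<in> ball 0 1 \<Longrightarrow> T (kern w e) = \<zeta> w e"
proof -
  define R where "R = {(\<Sum>w\<in>J. kern w (e w), \<Sum>w\<in>J. \<zeta> w (e w)) | J e. finite J \<and> J \<subseteq> ball 0 1}"
  have R: "(\<Sum>w\<in>J. kern w (e w), \<Sum>w\<in>J. \<zeta> w (e w)) \<in> R" if "finite J" "J \<subseteq> ball 0 1" for J e
    using that by (auto simp: R_def)
  have 1: "(x + x', y + y') \<in> R" if xy: "(x, y) \<in> R" "(x', y') \<in> R" for x y x' y'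
  proof -
    obtain J e J' e' where J: "finite J" "J \<subseteq> ball 0 1" "finite J'" "J' \<subseteq> ball 0 1"
      and eq: "x = (\<Sum>w\<in>J. kern w (e w))" "y = (\<Sum>w\<in>J. \<zeta> w (e w))"
        "x' = (\<Sum>w\<in>J'. kern w (e' w))" "y' = (\<Sum>w\<in>J'. \<zeta> w (e' w))"
      using xy unfolding R_def by blast
    have sub: "w \<in> ball 0 1" if "w \<in> J \<union> J'" for w using that J by blast
    let ?s = "\<lambda>w. (if w \<in> J then e w else 0) + (if w \<in> J' then e' w else 0)"
    have "x + x' = (\<Sum>w\<in>J \<union> J'. kern w (?s w))"
      unfolding eq by (rule sum_union_add[OF J(1,3)]) (rule kern_add, erule sub)
    moreover have "y + y' = (\<Sum>w\<in>J \<union> J'. \<zeta> w (?s w))"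
      unfolding eq by (rule sum_union_add[OF J(1,3)]) (rule add, erule sub)
    ultimately show ?thesis using R[of "J \<union> J'" ?s] J by (simp only: finite_Un Un_subset_iff)
  qed
  have 2: "(c *\<^sub>C x, c *\<^sub>C y) \<in> R" if xy: "(x, y) \<in> R" for c x y
  proof -
    obtain J e where J: "finite J" "J \<subseteq> ball 0 1"
      and eq: "x = (\<Sum>w\<in>J. kern w (e w))" "y = (\<Sum>w\<in>J. \<zeta> w (e w))"
      using xy unfolding R_def by blast
    have "c *\<^sub>C x = (\<Sum>w\<in>J. kern w (c *\<^sub>C e w))" "c *\<^sub>C y = (\<Sum>w\<in>J. \<zeta> w (c *\<^sub>C e w))"
      unfolding eq scaleC_sum_right
      by (intro sum.cong refl kern_scaleC[symmetric] scale[symmetric] subsetD[OF J(2)]; assumption)+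
    then show ?thesis using R[OF J] by simp
  qed
  have 3: "norm y \<le> K * norm x" if "(x, y) \<in> R" for x y
    using that bound by (auto simp: R_def)
  have "R \<noteq> {}" using R[of "{}"] by auto
  obtain T where T: "cblinear T" "\<And>x y. (x, y) \<in> R \<Longrightarrow> T x = y"
    using extend_bounded_relation[OF 1 2 3 \<open>R \<noteq> {}\<close>] by blast
  have "T (kern w e) = \<zeta> w e" if "w \<in> ball 0 1" for w e
    using T(2)[OF R[of "{w}" "\<lambda>_. e"]] that by simp
  then show ?thesis using T(1) that by blast
qed

text \<open>The projection onto the closure fixes all kernel functions, so it is the
  identity.\<close>

lemma closure_kern_span: "closure (kern_span :: ('n::finite, 'e::chilbert_space) drury_arveson set) = UNIV"
proof -
  let ?V = "kern_span :: ('n, 'e) drury_arveson set"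
  have V: "csubspace ?V"
    unfolding csubspace_def
  proof (intro conjI ballI allI)
    show "0 \<in> ?V" unfolding kern_span_def by (auto intro!: exI[of _ "{}"])
  next
    fix x y assume "x \<in> ?V" "y \<in> ?V"
    then obtain J e J' e' where J: "finite J" "J \<subseteq> ball 0 1" "finite J'" "J' \<subseteq> ball 0 1"
      and eq: "x = (\<Sum>w\<in>J. kern w (e w))" "y = (\<Sum>w\<in>J'. kern w (e' w))"
      unfolding kern_span_def by blast
    have sub: "w \<in> ball 0 1" if "w \<in> J \<union> J'" for w using that J by blast
    let ?s = "\<lambda>w. (if w \<in> J then e w else 0) + (if w \<in> J' then e' w else 0)"
    have "x + y = (\<Sum>w\<in>J \<union> J'. kern w (?s w))"
      unfolding eq by (rule sum_union_add[OF J(1,3)]) (rule kern_add, erule sub)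
    then show "x + y \<in> ?V"
      unfolding kern_span_def mem_Collect_eq using J
      by (intro exI[of _ "J \<union> J'"] exI[of _ ?s]) simp
  next
    fix c x assume "x \<in> ?V"
    then obtain J e where J: "finite J" "J \<subseteq> ball 0 1" and eq: "x = (\<Sum>w\<in>J. kern w (e w))"
      unfolding kern_span_def by blast
    have "c *\<^sub>C x = (\<Sum>w\<in>J. kern w (c *\<^sub>C e w))"
      unfolding eq scaleC_sum_right
      by (intro sum.cong refl kern_scaleC[symmetric] subsetD[OF J(2)])
    then show "c *\<^sub>C x \<in> ?V"
      unfolding kern_span_def mem_Collect_eq using J
      by (intro exI[of _ J] exI[of _ "\<lambda>w. c *\<^sub>C e w"]) simp
  qed
  have "kern w e \<in> ?V" if "w \<in> ball 0 1" for w e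
    unfolding kern_span_def using that by (auto intro!: exI[of _ "{w}"] exI[of _ "\<lambda>_. e"])
  then have k: "kern w e \<in> closure ?V" if "w \<in> ball 0 1" for w e
    using that closure_subset by blast
  note C = csubspace_closure[OF V] closed_closure
  have "orth_projection (closure ?V) x = x" for x
    by (rule cblinear_kern_eqI[OF cblinear_orth_projection[OF C] cblinear_ident])
      (simp add: orth_projection_id[OF C(1)] k)
  then have "x \<in> closure ?V" for x using orth_projection_mem[OF C, of x] by metis
  then show ?thesis by blast
qed

text \<open>Expanding the norms into Gram sums reduces the claim to
  \<open>kernel_recurrence\<close>. This is the norm identity of the backward shifts on
  \<open>kern_span\<close>, available before the shifts exist; it yields their boundedness.\<close>

lemma kern_gram_identity:
  fixes e :: "complex ^ 'n \<Rightarrow> 'e::chilbert_space"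
  assumes J: "J \<subseteq> ball 0 1"
  shows "(\<Sum>i\<in>UNIV. (norm (\<Sum>w\<in>J. kern w (cnj (w $ i) *\<^sub>C e w)))\<^sup>2) + (norm (\<Sum>w\<in>J. e w))\<^sup>2 =
    (norm (\<Sum>w\<in>J. kern w (e w)))\<^sup>2"
proof -
  have b: "w \<in> ball 0 1" "norm w < 1" if "w \<in> J" for w using that J by auto
  have ss: "cinner (\<Sum>w\<in>A. f w) (\<Sum>v\<in>A. g v) = (\<Sum>w\<in>A. \<Sum>v\<in>A. cinner (f w) (g v))"
    for A :: "'w set" and f g :: "'w \<Rightarrow> 'b::complex_inner"
    unfolding cinner_sum_left by (simp only: cinner_sum_right)
  let ?c = "\<lambda>w v. cinner (e w) (e v)"
  have "complex_of_real ((\<Sum>i\<in>UNIV. (norm (\<Sum>w\<in>J. kern w (cnj (w $ i) *\<^sub>C e w)))\<^sup>2) +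
      (norm (\<Sum>w\<in>J. e w))\<^sup>2) =
      (\<Sum>i\<in>UNIV. \<Sum>w\<in>J. \<Sum>v\<in>J. cnj (w $ i) * v $ i * (drury_arveson_kernel v w * ?c w v)) +
      (\<Sum>w\<in>J. \<Sum>v\<in>J. ?c w v)"
    by (simp add: cinner_self[symmetric] ss cinner_kern_kern b
        cinner_scaleC_left cinner_scaleC_right mult_ac cong: sum.cong del: of_real_power)
  also have "(\<Sum>i\<in>UNIV. \<Sum>w\<in>J. \<Sum>v\<in>J. cnj (w $ i) * v $ i * (drury_arveson_kernel v w * ?c w v)) =
      (\<Sum>w\<in>J. \<Sum>v\<in>J. \<Sum>i\<in>UNIV. cnj (w $ i) * v $ i * (drury_arveson_kernel v w * ?c w v))"
    by (subst sum.swap, intro sum.cong refl, rule sum.swap)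
  also have "\<dots> = (\<Sum>w\<in>J. \<Sum>v\<in>J. ball_inner v w * drury_arveson_kernel v w * ?c w v)"
    by (intro sum.cong refl) (simp add: ball_inner_def sum_distrib_left sum_distrib_right mult_ac)
  also have "\<dots> + (\<Sum>w\<in>J. \<Sum>v\<in>J. ?c w v) =
      (\<Sum>w\<in>J. \<Sum>v\<in>J. (ball_inner v w * drury_arveson_kernel v w + 1) * ?c w v)"
    by (simp add: sum.distrib[symmetric] distrib_right)
  also have "\<dots> = (\<Sum>w\<in>J. \<Sum>v\<in>J. drury_arveson_kernel v w * ?c w v)"
    by (intro sum.cong refl) (simp only: kernel_recurrence b)
  also have "\<dots> = complex_of_real ((norm (\<Sum>w\<in>J. kern w (e w)))\<^sup>2)"
    by (simp add: cinner_self[symmetric] ss cinner_kern_kern b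
        cong: sum.cong del: of_real_power)
  finally show ?thesis by (simp only: of_real_eq_iff)
qed

section \<open>Backward shifts\<close>

definition bshift ::
    "'n::finite \<Rightarrow> ('n, 'e::chilbert_space) drury_arveson \<Rightarrow> ('n, 'e) drury_arveson" where
  "bshift i = (SOME T. cblinear T \<and> (\<forall>w\<in>ball 0 1. \<forall>e. T (kern w e) = cnj (w $ i) *\<^sub>C kern w e))"

lemma bshift_spec:
  "cblinear (bshift i :: ('n::finite, 'e::chilbert_space) drury_arveson \<Rightarrow> _) \<and>
    (\<forall>w\<in>ball 0 1. \<forall>e :: 'e. bshift i (kern w e) = cnj (w $ i) *\<^sub>C kern w e)"
proof -
  have b: "norm (\<Sum>w\<in>J. kern w (cnj (w $ i) *\<^sub>C e w)) \<le> 1 * norm (\<Sum>w\<in>J. kern w (e w))"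
    if "J \<subseteq> ball 0 1" for J and e :: "complex ^ 'n \<Rightarrow> 'e"
  proof -
    have "(norm (\<Sum>w\<in>J. kern w (cnj (w $ i) *\<^sub>C e w)))\<^sup>2 \<le>
        (\<Sum>i\<in>UNIV. (norm (\<Sum>w\<in>J. kern w (cnj (w $ i) *\<^sub>C e w)))\<^sup>2)"
      by (rule member_le_sum) auto
    also have "\<dots> \<le> (norm (\<Sum>w\<in>J. kern w (e w)))\<^sup>2" using kern_gram_identity[OF that, of e]
      by (smt (verit) zero_le_power2)
    finally show ?thesis by (simp add: power2_le_iff_abs_le)
  qed
  have "\<exists>T :: ('n, 'e) drury_arveson \<Rightarrow> ('n, 'e) drury_arveson.
      cblinear T \<and> (\<forall>w\<in>ball 0 1. \<forall>e. T (kern w e) = cnj (w $ i) *\<^sub>C kern w e)"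
  proof (rule extend_from_kern)
    show "kern w (cnj (w $ i) *\<^sub>C (x + y)) = kern w (cnj (w $ i) *\<^sub>C x) + kern w (cnj (w $ i) *\<^sub>C y)"
      if "w \<in> ball 0 1" for w and x y :: 'e by (simp add: scaleC_add_right kern_add[OF that])
    show "kern w (cnj (w $ i) *\<^sub>C c *\<^sub>C x) = c *\<^sub>C kern w (cnj (w $ i) *\<^sub>C x)"
      if "w \<in> ball 0 1" for w c and x :: 'e
      by (simp add: kern_scaleC[OF that] scaleC_scaleC mult.commute)
    show "norm (\<Sum>w\<in>J. kern w (cnj (w $ i) *\<^sub>C e w)) \<le> 1 * norm (\<Sum>w\<in>J. kern w (e w))"
      if "J \<subseteq> ball 0 1" for J and e :: "complex ^ 'n \<Rightarrow> 'e" by (rule b[OF that])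
  qed (auto simp: kern_scaleC)
  then show ?thesis unfolding bshift_def by (rule someI_ex)
qed

lemma cblinear_bshift: "cblinear (bshift i)"
  and bshift_kern: "w \<in> ball 0 1 \<Longrightarrow> bshift i (kern w e) = cnj (w $ i) *\<^sub>C kern w e"
  using bshift_spec by blast+

lemma eval_adj_bshift: "eval (adj (bshift i) f) z = z $ i *\<^sub>C eval f z"
proof (cases "z \<in> ball 0 1")
  case True
  have "cinner (eval (adj (bshift i) f) z) e = cinner (z $ i *\<^sub>C eval f z) e" for e
    by (simp add: cinner_kern_right[OF True, symmetric] cinner_adj_left[OF cblinear_bshift]
        bshift_kern[OF True] cinner_scaleC_right cinner_scaleC_left)
  then show ?thesis by (rule cinner_eqI)
qed (simp add: eval_off_ball)

lemma coord_mult_eq_adj: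
  "(coord_mult i :: ('n::finite, 'e::chilbert_space) drury_arveson \<Rightarrow> _) = adj (bshift i)"
proof
  fix f :: "('n, 'e) drury_arveson"
  have "(\<lambda>z. if z \<in> ball 0 1 then z $ i *\<^sub>C eval f z else 0) = eval (adj (bshift i) f)"
    by (auto simp: eval_adj_bshift eval_off_ball)
  then show "coord_mult i f = adj (bshift i) f"
    unfolding coord_mult_def mult_op_def by (simp add: eval_inverse)
qed

lemma cblinear_coord_mult: "cblinear (coord_mult i)"
  unfolding coord_mult_eq_adj by (rule cblinear_adj[OF cblinear_bshift])

lemma eval_coord_mult: "eval (coord_mult i f) z = z $ i *\<^sub>C eval f z"
  unfolding coord_mult_eq_adj by (rule eval_adj_bshift)

lemma adj_coord_mult: "adj (coord_mult i) = bshift i"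
  unfolding coord_mult_eq_adj by (rule adj_adj[OF cblinear_bshift])

text \<open>\<open>kernel_recurrence\<close> in operator form: the products of each coordinate
  multiplication with its adjoint add up to the identity minus the projection onto the constants
  \<open>kern 0 e\<close>.\<close>

lemma bshift_expansion:
  fixes f :: "('n::finite, 'e::chilbert_space) drury_arveson"
  shows "(\<Sum>i\<in>UNIV. coord_mult i (bshift i f)) + kern 0 (eval f 0) = f"
proof (rule cblinear_kern_eqI[where T = "\<lambda>f. f"])
  show "cblinear (\<lambda>f :: ('n, 'e) drury_arveson. (\<Sum>i\<in>UNIV. coord_mult i (bshift i f)) + kern 0 (eval f 0))"
    by (intro cblinear_add_fun cblinear_sum_fun cblinear_compose[OF cblinear_coord_mult cblinear_bshift]
        cblinear_compose[OF cblinear_kern cblinear_eval]) auto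
  fix w :: "complex ^ 'n" and e :: 'e assume w: "w \<in> ball 0 1"
  have eval_sum: "eval (\<Sum>i\<in>A. g i) z = (\<Sum>i\<in>A. eval (g i) z)"
    for A and g :: "'n \<Rightarrow> ('n, 'e) drury_arveson" and z by (rule cblinear_sum[OF cblinear_eval])
  show "(\<Sum>i\<in>UNIV. coord_mult i (bshift i (kern w e))) + kern 0 (eval (kern w e) 0) = kern w e"
  proof (rule drury_arveson_eqI)
    fix z :: "complex ^ 'n" assume z: "z \<in> ball 0 1"
    have "eval ((\<Sum>i\<in>UNIV. coord_mult i (bshift i (kern w e))) + kern 0 (eval (kern w e) 0)) z =
        (\<Sum>i\<in>UNIV. (z $ i * cnj (w $ i) * drury_arveson_kernel z w) *\<^sub>C e) + 1 *\<^sub>C e"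
      using z w by (simp add: eval_add eval_sum eval_coord_mult bshift_kern eval_scaleC eval_kern
          scaleC_scaleC mult_ac)
    also have "\<dots> = (ball_inner z w * drury_arveson_kernel z w + 1) *\<^sub>C e"
      by (simp only: scaleC_add_left ball_inner_def sum_distrib_right scaleC_sum_left)
    also have "\<dots> = eval (kern w e) z" using z by (simp only: kernel_recurrence[OF z w] eval_kern[OF w] if_True)
    finally show "eval ((\<Sum>i\<in>UNIV. coord_mult i (bshift i (kern w e))) + kern 0 (eval (kern w e) 0)) z =
      eval (kern w e) z" .
  qed
qed (rule cblinear_ident)

lemma cinner_bshift:
  "cinner f g = (\<Sum>i\<in>UNIV. cinner (bshift i f) (bshift i g)) + cinner (eval f 0) (eval g 0)"
proof -
  have "cinner f g = cinner ((\<Sum>i\<in>UNIV. coord_mult i (bshift i f)) + kern 0 (eval f 0)) g"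
    by (simp only: bshift_expansion)
  also have "\<dots> = (\<Sum>i\<in>UNIV. cinner (bshift i f) (bshift i g)) + cinner (eval f 0) (eval g 0)"
    by (simp add: cinner_add_left cinner_sum_left coord_mult_eq_adj cinner_adj_left[OF cblinear_bshift]
        cinner_kern_left)
  finally show ?thesis .
qed

lemma norm_bshift:
  "(norm f)\<^sup>2 = (\<Sum>i\<in>UNIV. (norm (bshift i f))\<^sup>2) + (norm (eval f 0))\<^sup>2"
  unfolding norm_sq_Re_cinner by (subst cinner_bshift) simp

lemma eval_bshift:
  fixes f :: "('n::finite, 'e::chilbert_space) drury_arveson"
  assumes "w \<in> ball 0 1"
  shows "eval f w = eval f 0 + (\<Sum>i\<in>UNIV. w $ i *\<^sub>C eval (bshift i f) w)"
proof -
  have "eval f w = eval ((\<Sum>i\<in>UNIV. coord_mult i (bshift i f)) + kern 0 (eval f 0)) w"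
    by (simp only: bshift_expansion)
  also have "\<dots> = eval f 0 + (\<Sum>i\<in>UNIV. w $ i *\<^sub>C eval (bshift i f) w)"
    using assms by (simp add: eval_add cblinear_sum[OF cblinear_eval] eval_coord_mult eval_kern)
  finally show ?thesis .
qed

text \<open>Subtracting the kernel function with the same value at the origin leaves a joint
  eigenvector \<open>r\<close> with \<open>eval r 0 = 0\<close>. Then \<open>norm_bshift\<close>
  gives \<open>(norm r)\<^sup>2 = (norm w)\<^sup>2 * (norm r)\<^sup>2\<close>, which forces
  \<open>r = 0\<close>.\<close>

lemma kern_if_joint_eigenvector:
  fixes f :: "('n::finite, 'e::chilbert_space) drury_arveson"
  assumes w: "w \<in> ball 0 1" and eig: "\<And>i. bshift i f = cnj (w $ i) *\<^sub>C f"
  shows "f = kern w (eval f 0)"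
proof -
  define r where "r = f - kern w (eval f 0)"
  have 0: "eval r 0 = 0" using w by (simp add: r_def eval_diff eval_kern)
  have "bshift i r = cnj (w $ i) *\<^sub>C r" for i
    by (simp add: r_def cblinear_diff[OF cblinear_bshift] eig bshift_kern[OF w] scaleC_diff_right)
  then have "(norm r)\<^sup>2 = (\<Sum>i\<in>UNIV. (cmod (w $ i))\<^sup>2 * (norm r)\<^sup>2)"
    using norm_bshift[of r] by (simp add: 0 norm_scaleC power_mult_distrib)
  also have "\<dots> = (norm w)\<^sup>2 * (norm r)\<^sup>2" by (simp add: norm_vec_square sum_distrib_right)
  finally have "(1 - (norm w)\<^sup>2) * (norm r)\<^sup>2 = 0" by (simp add: algebra_simps)
  moreover have "(norm w)\<^sup>2 < 1" using w by (simp add: power_less_one_iff abs_square_less_1)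
  ultimately have "r = 0" by simp
  then show ?thesis by (simp add: r_def)
qed

section \<open>Iterating the backward shifts\<close>

lemma sum_coord_shrink:
  fixes e :: "complex ^ 'n \<Rightarrow> 'e::complex_inner"
  assumes "\<And>w. w \<in> J \<Longrightarrow> norm w \<le> r" "0 \<le> r"
  shows "(\<Sum>i\<in>UNIV. \<Sum>w\<in>J. (norm (cnj (w $ i) *\<^sub>C e w))\<^sup>2) \<le> r\<^sup>2 * (\<Sum>w\<in>J. (norm (e w))\<^sup>2)"
proof -
  have "(\<Sum>i\<in>UNIV. \<Sum>w\<in>J. (norm (cnj (w $ i) *\<^sub>C e w))\<^sup>2) = (\<Sum>w\<in>J. (norm w)\<^sup>2 * (norm (e w))\<^sup>2)"
    by (subst sum.swap) (simp add: norm_scaleC power_mult_distrib norm_vec_square sum_distrib_right)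
  also have "\<dots> \<le> (\<Sum>w\<in>J. r\<^sup>2 * (norm (e w))\<^sup>2)"
    using assms by (intro sum_mono mult_right_mono power_mono) auto
  finally show ?thesis by (simp add: sum_distrib_left)
qed

lemma finite_subset_ball_radius:
  assumes "finite J" "J \<subseteq> ball (0 :: 'a::real_normed_vector) 1"
  obtains r where "0 \<le> r" "r < 1" "\<And>w. w \<in> J \<Longrightarrow> norm w \<le> r"
proof
  show "0 \<le> Max (insert 0 (norm ` J))" "Max (insert 0 (norm ` J)) < 1"
    "\<And>w. w \<in> J \<Longrightarrow> norm w \<le> Max (insert 0 (norm ` J))"
    using assms by (auto intro: Max_ge)
qed

text \<open>Apply \<open>step\<close> repeatedly: each pass multiplies the coefficient mass by at
  most \<open>r\<^sup>2 < 1\<close>, so the crude lower bound tends to zero. Any nonnegative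
  \<open>K\<close> serves, even one depending on \<open>J\<close>.\<close>

lemma nonneg_by_kernel_iteration:
  fixes d :: "(complex ^ 'n \<Rightarrow> 'e::complex_inner) \<Rightarrow> real"
  assumes J: "finite J" "J \<subseteq> ball 0 1"
    and step: "\<And>e. (\<Sum>i\<in>UNIV. d (\<lambda>w. cnj (w $ i) *\<^sub>C e w)) \<le> d e"
    and bound: "\<And>e. - (K * (\<Sum>w\<in>J. (norm (e w))\<^sup>2)) \<le> d e" and K: "0 \<le> K"
  shows "0 \<le> d e"
proof -
  obtain r where r: "0 \<le> r" "r < 1" "\<And>w. w \<in> J \<Longrightarrow> norm w \<le> r"
    using finite_subset_ball_radius[OF J] by blast
  have it: "- (K * (r\<^sup>2) ^ m * (\<Sum>w\<in>J. (norm (e w))\<^sup>2)) \<le> d e" for m e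
  proof (induction m arbitrary: e)
    case 0
    then show ?case using bound by simp
  next
    case (Suc m)
    have "K * (r\<^sup>2) ^ m * (\<Sum>i\<in>UNIV. \<Sum>w\<in>J. (norm (cnj (w $ i) *\<^sub>C e w))\<^sup>2) \<le>
        K * (r\<^sup>2) ^ m * (r\<^sup>2 * (\<Sum>w\<in>J. (norm (e w))\<^sup>2))"
      using r K by (intro mult_left_mono sum_coord_shrink) auto
    then have "- (K * (r\<^sup>2) ^ Suc m * (\<Sum>w\<in>J. (norm (e w))\<^sup>2)) \<le>
        (\<Sum>i\<in>UNIV. - (K * (r\<^sup>2) ^ m * (\<Sum>w\<in>J. (norm (cnj (w $ i) *\<^sub>C e w))\<^sup>2)))"
      by (simp add: sum_negf sum_distrib_left mult_ac)
    also have "\<dots> \<le> (\<Sum>i\<in>UNIV. d (\<lambda>w. cnj (w $ i) *\<^sub>C e w))" by (intro sum_mono Suc)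
    also have "\<dots> \<le> d e" by (rule step)
    finally show ?case .
  qed
  have "(\<lambda>m. - (K * (r\<^sup>2) ^ m * (\<Sum>w\<in>J. (norm (e w))\<^sup>2))) \<longlonglongrightarrow> - (K * 0 * (\<Sum>w\<in>J. (norm (e w))\<^sup>2))"
    using r by (intro tendsto_intros LIMSEQ_realpow_zero) (auto simp: power_less_one_iff abs_square_less_1)
  then show ?thesis using it by (intro LIMSEQ_le_const2[where X = "\<lambda>m. - (K * (r\<^sup>2) ^ m * (\<Sum>w\<in>J. (norm (e w))\<^sup>2))"]) auto
qed

text \<open>The sum of \<open>(norm (B f))\<^sup>2\<close> over all products \<open>B\<close> of
  \<open>m\<close> backward shifts, indexed by words of length \<open>m\<close>.\<close>

primrec shift_mass :: "nat \<Rightarrow> ('n::finite, 'e::chilbert_space) drury_arveson \<Rightarrow> real" where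
  "shift_mass 0 f = (norm f)\<^sup>2"
| "shift_mass (Suc m) f = (\<Sum>i\<in>UNIV. shift_mass m (bshift i f))"

lemma shift_mass_nonneg: "0 \<le> shift_mass m f"
  by (induction m arbitrary: f) (auto intro: sum_nonneg)

lemma shift_mass_le: "shift_mass m f \<le> (norm f)\<^sup>2"
proof (induction m arbitrary: f)
  case (Suc m)
  have "shift_mass (Suc m) f \<le> (\<Sum>i\<in>UNIV. (norm (bshift i f))\<^sup>2)" by (auto intro: sum_mono Suc)
  then show ?case using norm_bshift[of f] by (smt (verit) zero_le_power2)
qed simp

lemma shift_mass_add: "shift_mass m (f + g) \<le> 2 * shift_mass m f + 2 * shift_mass m g"
proof (induction m arbitrary: f g)
  case (Suc m)
  have "shift_mass (Suc m) (f + g) \<le> (\<Sum>i\<in>UNIV. 2 * shift_mass m (bshift i f) + 2 * shift_mass m (bshift i g))"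
    by (auto simp: cblinear_add[OF cblinear_bshift] intro: sum_mono Suc)
  then show ?case by (simp add: sum.distrib sum_distrib_left)
qed (simp add: norm_add_square_le)

lemma norm_sum_square_le:
  fixes x :: "'w \<Rightarrow> 'b::real_normed_vector"
  assumes "finite J" "\<And>w. w \<in> J \<Longrightarrow> norm (x w) \<le> a w * b w" "\<And>w. w \<in> J \<Longrightarrow> 0 \<le> a w"
    "\<And>w. w \<in> J \<Longrightarrow> 0 \<le> b w"
  shows "(norm (\<Sum>w\<in>J. x w))\<^sup>2 \<le> (\<Sum>w\<in>J. (a w)\<^sup>2) * (\<Sum>w\<in>J. (b w)\<^sup>2)"
proof -
  have "norm (\<Sum>w\<in>J. x w) \<le> (\<Sum>w\<in>J. \<bar>a w\<bar> * \<bar>b w\<bar>)"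
    using assms by (intro sum_norm_le) auto
  also have "\<dots> \<le> L2_set a J * L2_set b J" by (rule L2_set_mult_ineq)
  finally have "(norm (\<Sum>w\<in>J. x w))\<^sup>2 \<le> (L2_set a J * L2_set b J)\<^sup>2" by (intro power_mono) auto
  then show ?thesis by (simp add: power_mult_distrib L2_set_def sum_nonneg)
qed

text \<open>A backward shift multiplies the coefficient at \<open>w\<close> by
  \<open>cnj (w $ i)\<close>, so each level gains a factor \<open>r\<^sup>2\<close>.\<close>

lemma shift_mass_kern_sum:
  fixes e :: "complex ^ 'n \<Rightarrow> 'e::chilbert_space"
  assumes J: "finite J" "J \<subseteq> ball 0 1" and r: "\<And>w. w \<in> J \<Longrightarrow> norm w \<le> r" "0 \<le> r"
  shows "shift_mass m (\<Sum>w\<in>J. kern w (e w)) \<le>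
    (\<Sum>w\<in>J. (1 / (1 - norm w))\<^sup>2) * (r\<^sup>2) ^ m * (\<Sum>w\<in>J. (norm (e w))\<^sup>2)"
proof (induction m arbitrary: e)
  case 0
  have "(norm (\<Sum>w\<in>J. kern w (e w)))\<^sup>2 \<le> (\<Sum>w\<in>J. (1 / (1 - norm w))\<^sup>2) * (\<Sum>w\<in>J. (norm (e w))\<^sup>2)"
  proof (rule norm_sum_square_le[OF J(1)])
    fix w assume "w \<in> J"
    then have "w \<in> ball 0 1" using J by blast
    then show "norm (kern w (e w)) \<le> 1 / (1 - norm w) * norm (e w)" "0 \<le> 1 / (1 - norm w)"
      by (auto simp: norm_kern_le[simplified])
  qed simp
  then show ?case by simp
next
  case (Suc m)
  let ?C = "\<Sum>w\<in>J. (1 / (1 - norm w))\<^sup>2"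
  have "bshift i (\<Sum>w\<in>J. kern w (e w)) = (\<Sum>w\<in>J. kern w (cnj (w $ i) *\<^sub>C e w))" for i
    unfolding cblinear_sum[OF cblinear_bshift]
  proof (intro sum.cong refl)
    fix w assume "w \<in> J"
    then have "w \<in> ball 0 1" using J by blast
    then show "bshift i (kern w (e w)) = kern w (cnj (w $ i) *\<^sub>C e w)"
      by (simp only: bshift_kern kern_scaleC)
  qed
  then have "shift_mass (Suc m) (\<Sum>w\<in>J. kern w (e w)) =
      (\<Sum>i\<in>UNIV. shift_mass m (\<Sum>w\<in>J. kern w (cnj (w $ i) *\<^sub>C e w)))" by simp
  also have "\<dots> \<le> (\<Sum>i\<in>UNIV. ?C * (r\<^sup>2) ^ m * (\<Sum>w\<in>J. (norm (cnj (w $ i) *\<^sub>C e w))\<^sup>2))"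
    by (intro sum_mono Suc)
  also have "\<dots> = ?C * (r\<^sup>2) ^ m * (\<Sum>i\<in>UNIV. \<Sum>w\<in>J. (norm (cnj (w $ i) *\<^sub>C e w))\<^sup>2)"
    by (simp add: sum_distrib_left)
  also have "\<dots> \<le> ?C * (r\<^sup>2) ^ m * (r\<^sup>2 * (\<Sum>w\<in>J. (norm (e w))\<^sup>2))"
    by (intro mult_left_mono sum_coord_shrink mult_nonneg_nonneg sum_nonneg r) auto
  finally show ?case by (simp add: mult_ac)
qed

text \<open>Purity of the backward shifts. The mass of a combination of kernel functions decays
  geometrically, and \<open>shift_mass_le\<close> controls the approximation error uniformly in
  \<open>m\<close>.\<close>

lemma shift_mass_small:
  fixes f :: "('n::finite, 'e::chilbert_space) drury_arveson"
  assumes "\<epsilon> > 0"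
  shows "\<exists>m. shift_mass m f < \<epsilon>"
proof -
  have "f \<in> closure kern_span" by (simp add: closure_kern_span)
  moreover have "sqrt (\<epsilon> / 8) > 0" using assms by simp
  ultimately obtain g where g: "g \<in> kern_span" "dist g f < sqrt (\<epsilon> / 8)"
    unfolding closure_approachable by blast
  then obtain J e where J: "finite J" "J \<subseteq> ball 0 1" and g_eq: "g = (\<Sum>w\<in>J. kern w (e w))"
    unfolding kern_span_def by blast
  obtain r where r: "0 \<le> r" "r < 1" "\<And>w. w \<in> J \<Longrightarrow> norm w \<le> r"
    using finite_subset_ball_radius[OF J] by blast
  define C D where "C = (\<Sum>w\<in>J. (1 / (1 - norm w))\<^sup>2)" and "D = (\<Sum>w\<in>J. (norm (e w))\<^sup>2)"
  have "(\<lambda>m. C * (r\<^sup>2) ^ m * D) \<longlonglongrightarrow> C * 0 * D"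
    using r by (intro tendsto_intros LIMSEQ_realpow_zero) (auto simp: power_less_one_iff abs_square_less_1)
  then have "\<forall>\<^sub>F m in sequentially. C * (r\<^sup>2) ^ m * D < \<epsilon> / 4"
    using assms by (intro order_tendstoD) auto
  then obtain m where m: "C * (r\<^sup>2) ^ m * D < \<epsilon> / 4" 
    using eventually_happens'[OF sequentially_bot] by blast
  have "shift_mass m f \<le> 2 * shift_mass m g + 2 * shift_mass m (f - g)"
    using shift_mass_add[of m g "f - g"] by simp
  moreover have "shift_mass m g < \<epsilon> / 4"
    using shift_mass_kern_sum[OF J r(3,1), of m e] m by (simp add: g_eq C_def D_def)
  moreover have "shift_mass m (f - g) < \<epsilon> / 4"
  proof -
    have "shift_mass m (f - g) \<le> (dist g f)\<^sup>2"
      using shift_mass_le[of m "f - g"] by (simp add: dist_norm norm_minus_commute)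
    also have "\<dots> < (sqrt (\<epsilon> / 8))\<^sup>2" using g(2) by (intro power_strict_mono) auto
    finally show ?thesis using assms by simp
  qed
  ultimately have "shift_mass m f < \<epsilon>" by linarith
  then show ?thesis ..
qed

text \<open>Iterating along \<open>F\<close> bounds \<open>\<phi> f\<close> by \<open>K\<close>
  times a mass that becomes arbitrarily small. It serves as a uniqueness principle on
  \<open>F\<close>.\<close>

lemma nonpos_by_shift_iteration:
  fixes \<phi> :: "('n::finite, 'e::chilbert_space) drury_arveson \<Rightarrow> real"
  assumes inv: "\<And>f i. f \<in> F \<Longrightarrow> bshift i f \<in> F"
    and step: "\<And>f. f \<in> F \<Longrightarrow> \<phi> f \<le> (\<Sum>i\<in>UNIV. \<phi> (bshift i f))"
    and bound: "\<And>f. f \<in> F \<Longrightarrow> \<phi> f \<le> K * (norm f)\<^sup>2" and K: "0 \<le> K" and f: "f \<in> F"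
  shows "\<phi> f \<le> 0"
proof (rule ccontr)
  assume "\<not> \<phi> f \<le> 0"
  then have pos: "\<phi> f > 0" by simp
  have it: "\<phi> f \<le> K * shift_mass m f" if "f \<in> F" for m f
    using that
  proof (induction m arbitrary: f)
    case 0
    then show ?case using bound by simp
  next
    case (Suc m)
    have "\<phi> f \<le> (\<Sum>i\<in>UNIV. \<phi> (bshift i f))" by (rule step[OF Suc.prems])
    also have "\<dots> \<le> (\<Sum>i\<in>UNIV. K * shift_mass m (bshift i f))"
      by (intro sum_mono Suc.IH inv Suc.prems)
    finally show ?case by (simp add: sum_distrib_left)
  qed
  \<comment> \<open>Dividing by \<open>K + 1\<close> rather than \<open>K\<close> covers
    \<open>K = 0\<close>.\<close>
  obtain m where "shift_mass m f < \<phi> f / (K + 1)"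
    using shift_mass_small[of "\<phi> f / (K + 1)" f] pos K by auto
  then have "(K + 1) * shift_mass m f < \<phi> f" using K by (simp add: field_simps)
  moreover have "K * shift_mass m f \<le> (K + 1) * shift_mass m f"
    using shift_mass_nonneg[of m f] by (simp add: mult_right_mono)
  ultimately show False using it[OF f, of m] by linarith
qed

section \<open>Module maps are multiplication operators\<close>

definition module_map ::
    "(('n::finite, 'e::chilbert_space) drury_arveson \<Rightarrow> ('n, 'f::chilbert_space) drury_arveson) \<Rightarrow> bool"
  where
  "module_map T \<longleftrightarrow> cblinear T \<and> (\<forall>i f. T (coord_mult i f) = coord_mult i (T f))"

text \<open>The constant function with value \<open>x\<close> is \<open>kern 0 x\<close>; its image
  under \<open>T\<close>, evaluated at \<open>w\<close>, is the candidate for the multiplier at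
  \<open>w\<close>.\<close>

definition symbol ::
    "(('n::finite, 'e::chilbert_space) drury_arveson \<Rightarrow> ('n, 'f::chilbert_space) drury_arveson)
      \<Rightarrow> complex ^ 'n \<Rightarrow> 'e \<Rightarrow>\<^sub>L 'f" where
  "symbol T w = Blinfun (\<lambda>x. eval (T (kern 0 x)) w)"

lemma module_map_cblinear: "module_map T \<Longrightarrow> cblinear T"
  by (simp add: module_map_def)

lemma module_map_coord_mult: "module_map T \<Longrightarrow> T (coord_mult i f) = coord_mult i (T f)"
  by (simp add: module_map_def)

lemma bshift_adj:
  assumes T: "module_map T"
  shows "bshift i (adj T g) = adj T (bshift i g)"
proof -
  note c = module_map_cblinear[OF T]
  have "adj (\<lambda>x. T (coord_mult i x)) g = adj (\<lambda>x. coord_mult i (T x)) g"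
    by (simp only: module_map_coord_mult[OF T])
  then show ?thesis
    by (simp only: adj_compose[OF c cblinear_coord_mult] adj_compose[OF cblinear_coord_mult c]
        adj_coord_mult)
qed

lemma module_map_adjI:
  assumes S: "cblinear S" and comm: "\<And>i f. S (bshift i f) = bshift i (S f)"
  shows "module_map (adj S)"
  unfolding module_map_def
proof (intro conjI allI cblinear_adj S)
  show "adj S (coord_mult i f) = coord_mult i (adj S f)" for i f
    unfolding coord_mult_eq_adj
    by (simp only: adj_compose[OF cblinear_bshift S, symmetric] adj_compose[OF S cblinear_bshift, symmetric]
        comm)
qed

text \<open>The adjoint of \<open>T\<close> sends \<open>kern w e\<close> to a joint eigenvector of
  the backward shifts, hence to a kernel function at \<open>w\<close>. So
  \<open>eval (T f) w\<close> depends on \<open>f\<close> through \<open>eval f w\<close> alone, and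
  \<open>f\<close> may be replaced by a constant.\<close>

lemma eval_module_map:
  assumes T: "module_map T" and w: "w \<in> ball 0 1"
  shows "eval (T f) w = eval (T (kern 0 (eval f w))) w"
proof (rule cinner_eqI)
  fix e
  note c = module_map_cblinear[OF T]
  define g where "g = adj T (kern w e)"
  have "bshift i g = cnj (w $ i) *\<^sub>C g" for i
    unfolding g_def bshift_adj[OF T] bshift_kern[OF w] by (rule cblinear_scaleC[OF cblinear_adj[OF c]])
  then have g: "g = kern w (eval g 0)" by (rule kern_if_joint_eigenvector[OF w])
  have *: "cinner (eval (T h) w) e = cinner (eval h w) (eval g 0)" for h
  proof -
    have "cinner (eval (T h) w) e = cinner h g"
      unfolding g_def cinner_adj_right[OF c] by (rule cinner_kern_right[OF w, symmetric])
    also have "\<dots> = cinner (eval h w) (eval g 0)" by (subst g) (rule cinner_kern_right[OF w])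
    finally show ?thesis .
  qed
  have "eval (kern 0 (eval f w)) w = eval f w" using w by (simp add: eval_kern)
  then show "cinner (eval (T f) w) e = cinner (eval (T (kern 0 (eval f w))) w) e"
    by (simp only: *)
qed

section \<open>Symbols and their holomorphy\<close>

lemma bounded_linear_eval_comp: "cblinear S \<Longrightarrow> bounded_linear (\<lambda>x. eval (S x) w)"
  by (intro cblinear_bounded_linear cblinear_compose[OF cblinear_eval])

lemma symbol_apply:
  assumes "module_map T"
  shows "blinfun_apply (symbol T w) x = eval (T (kern 0 x)) w"
proof -
  have "cblinear (\<lambda>x. T (kern 0 x))"
    by (rule cblinear_compose[OF module_map_cblinear[OF assms] cblinear_kern]) simp
  then show ?thesis
    unfolding symbol_def
    by (rule bounded_linear_Blinfun_apply[OF bounded_linear_eval_comp, THEN fun_cong])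
qed

text \<open>In operator terms, evaluation at \<open>w\<close> is evaluation at the origin composed with the inverse of
  \<open>I - shift_pencil w\<close>; this resolvent formula yields the complex derivative in operator norm.\<close>

definition shift_pencil ::
    "complex ^ 'n::finite \<Rightarrow> ('n, 'e::chilbert_space) drury_arveson \<Rightarrow> ('n, 'e) drury_arveson" where
  "shift_pencil h f = (\<Sum>i\<in>UNIV. h $ i *\<^sub>C bshift i f)"

lemma cblinear_shift_pencil: "cblinear (shift_pencil h)"
  unfolding shift_pencil_def by (intro cblinear_sum_fun cblinear_scaleC_fun cblinear_bshift)

lemma shift_pencil_add: "shift_pencil (h + k) f = shift_pencil h f + shift_pencil k f"
  by (simp add: shift_pencil_def scaleC_add_left sum.distrib)

lemma shift_pencil_scale: "shift_pencil (c *s h) f = c *\<^sub>C shift_pencil h f"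
  by (simp add: shift_pencil_def scaleC_sum_right scaleC_scaleC)

lemma shift_pencil_scaleR: "shift_pencil (r *\<^sub>R h) f = r *\<^sub>R shift_pencil h f"
  by (simp add: shift_pencil_def scaleC_of_real[symmetric] scaleC_sum_right scaleC_scaleC
      scaleC_complex_def)

lemma shift_pencil_diff: "shift_pencil (h - k) f = shift_pencil h f - shift_pencil k f"
  using shift_pencil_add[of "h - k" k f] by simp

lemma norm_shift_pencil_le: "norm (shift_pencil h f) \<le> norm h * norm f"
proof -
  have "norm (shift_pencil h f) \<le> (\<Sum>i\<in>UNIV. \<bar>cmod (h $ i)\<bar> * \<bar>norm (bshift i f)\<bar>)"
    unfolding shift_pencil_def by (rule sum_norm_le) (simp add: norm_scaleC)
  also have "\<dots> \<le> L2_set (\<lambda>i. cmod (h $ i)) UNIV * L2_set (\<lambda>i. norm (bshift i f)) UNIV"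
    by (rule L2_set_mult_ineq)
  also have "\<dots> \<le> norm h * norm f"
  proof (rule mult_mono)
    show "L2_set (\<lambda>i. norm (bshift i f)) UNIV \<le> norm f"
      unfolding L2_set_def using norm_bshift[of f] by (intro real_le_lsqrt) auto
  qed (auto simp: norm_vec_def)
  finally show ?thesis .
qed

text \<open>By \<open>norm_shift_pencil_le\<close> the operator \<open>I - shift_pencil w\<close> is
  coercive with constant \<open>1 - norm w\<close>, so it is onto by \<open>lax_milgram\<close>; the
  same estimate gives injectivity and bounds the inverse.\<close>

lemma shift_resolvent:
  assumes w: "w \<in> ball 0 1"
  obtains R :: "('n::finite, 'e::chilbert_space) drury_arveson \<Rightarrow> ('n, 'e) drury_arveson"
  where "cblinear R" "\<And>g. R g - shift_pencil w (R g) = g"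
proof -
  let ?N = "\<lambda>f :: ('n, 'e) drury_arveson. f - shift_pencil w f"
  define \<delta> where "\<delta> = 1 - norm w"
  have d: "\<delta> > 0" using w by (simp add: \<delta>_def)
  have N: "cblinear ?N" by (intro cblinear_diff_fun cblinear_ident cblinear_shift_pencil)
  have coer: "\<delta> * (norm f)\<^sup>2 \<le> Re (cinner (?N f) f)" for f
  proof -
    have "Re (cinner (shift_pencil w f) f) \<le> norm (shift_pencil w f) * norm f"
      using cinner_cauchy_schwarz complex_Re_le_cmod order_trans by blast
    also have "\<dots> \<le> norm w * norm f * norm f" by (intro mult_right_mono norm_shift_pencil_le) simp
    finally show ?thesis
      by (simp add: \<delta>_def cinner_diff_left norm_sq_Re_cinner[symmetric] algebra_simps power2_eq_square)
  qed
  have "\<exists>f. ?N f = g" for g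
  proof (rule lax_milgram[OF csubspace_UNIV closed_UNIV N d coer])
    fix f assume "\<And>y. y \<in> UNIV \<Longrightarrow> cinner (?N f) y = cinner g y"
    then have "?N f = g" by - (rule cinner_eqI, simp)
    then show ?thesis ..
  qed
  then obtain R where R: "\<And>g. ?N (R g) = g" by metis
  have bound: "norm f \<le> 1 / \<delta> * norm (?N f)" for f
  proof -
    have "\<delta> * (norm f)\<^sup>2 \<le> norm (?N f) * norm f"
      using coer[of f] cinner_cauchy_schwarz[of "?N f" f] complex_Re_le_cmod[of "cinner (?N f) f"]
      by linarith
    then have "\<delta> * norm f \<le> norm (?N f)"
      by (cases "f = 0") (auto simp: power2_eq_square mult.assoc[symmetric])
    then show ?thesis using d by (simp add: field_simps)
  qed
  have inj: "f = g" if "?N f = ?N g" for f g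
    using bound[of "f - g"] that by (simp add: cblinear_diff[OF cblinear_shift_pencil] algebra_simps)
  have "cblinear R"
  proof (rule cblinearI[where K = "1 / \<delta>"])
    show "R (x + y) = R x + R y" for x y by (rule inj) (simp only: cblinear_add[OF N] R)
    show "R (c *\<^sub>C x) = c *\<^sub>C R x" for c x by (rule inj) (simp only: cblinear_scaleC[OF N] R)
    show "norm (R x) \<le> 1 / \<delta> * norm x" for x using bound[of "R x"] by (simp only: R)
  qed
  then show ?thesis using R that by blast
qed

text \<open>Evaluating \<open>f - shift_pencil u f\<close> at \<open>u\<close> returns
  \<open>eval f 0\<close>, by \<open>eval_bshift\<close>. With \<open>f = R g\<close> and
  \<open>u\<close> equal to \<open>w\<close> and to \<open>v\<close>, this eliminates
  \<open>eval (R g) 0\<close>.\<close>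

lemma eval_resolvent_diff:
  assumes v: "v \<in> ball 0 1" and w: "w \<in> ball 0 1" and R: "\<And>g. R g - shift_pencil w (R g) = g"
  shows "eval g v - eval g w = eval (shift_pencil (v - w) (R g)) v"
proof -
  have *: "eval f u - eval (shift_pencil u f) u = eval f 0" if "u \<in> ball 0 1" for f u
    using eval_bshift[OF that, of f]
    by (simp add: shift_pencil_def cblinear_sum[OF cblinear_eval] eval_scaleC)
  have "eval g w = eval (R g) 0" using *[OF w, of "R g"] R[of g] by (metis eval_diff)
  moreover have "eval g v = eval (R g) v - eval (shift_pencil w (R g)) v"
    using R[of g] by (metis eval_diff)
  ultimately show ?thesis
    using *[OF v, of "R g"] by (simp add: shift_pencil_diff eval_diff algebra_simps)
qed

text \<open>The derivative in direction \<open>h\<close> is evaluation at \<open>w\<close> of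
  \<open>shift_pencil h (R (S x))\<close>. A second use of \<open>eval_resolvent_diff\<close>, on
  the remainder, makes it quadratic in \<open>v - w\<close>.\<close>

lemma operator_holomorphic_eval:
  fixes S :: "'x::chilbert_space \<Rightarrow> ('n::finite, 'e::chilbert_space) drury_arveson"
  assumes S: "cblinear S"
  shows "operator_holomorphic_on (\<lambda>w. Blinfun (\<lambda>x. eval (S x) w)) (ball 0 1)"
  unfolding operator_holomorphic_on_def
proof
  fix w :: "complex ^ 'n" assume w: "w \<in> ball 0 1"
  obtain R where R: "cblinear R"
    and Req: "\<And>g :: ('n, 'e) drury_arveson. R g - shift_pencil w (R g) = g"
    using shift_resolvent[OF w] by blast
  obtain K where K: "K \<ge> 0" "\<And>g. norm (R g) \<le> K * norm g" using cblinear_bound[OF R] by blast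
  obtain M where M: "M \<ge> 0" "\<And>x. norm (R (S x)) \<le> M * norm x"
    using cblinear_bound[OF cblinear_compose[OF R S]] by blast
  \<comment> \<open>Half the distance of \<open>w\<close> from the sphere: for
    \<open>dist v w < \<delta>\<close> the evaluation bound \<open>1 / (1 - norm v)\<close> stays
    below \<open>1 / \<delta>\<close>.\<close>
  define \<delta> where "\<delta> = (1 - norm w) / 2"
  have d: "\<delta> > 0" using w by (simp add: \<delta>_def)
  let ?\<Phi> = "\<lambda>w. Blinfun (\<lambda>x. eval (S x) w)"
  have \<Phi>: "blinfun_apply (?\<Phi> v) x = eval (S x) v" for v x
    by (rule bounded_linear_Blinfun_apply[OF bounded_linear_eval_comp[OF S], THEN fun_cong])
  define D where "D h = Blinfun (\<lambda>x. eval (shift_pencil h (R (S x))) w)" for h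
  have D: "blinfun_apply (D h) x = eval (shift_pencil h (R (S x))) w" for h x
    unfolding D_def
    by (rule bounded_linear_Blinfun_apply[OF bounded_linear_eval_comp, THEN fun_cong])
      (intro cblinear_compose[OF cblinear_shift_pencil] cblinear_compose[OF R S])
  have lin: "bounded_linear D"
  proof (rule bounded_linear_intro[where K = "1 / (1 - norm w) * M"])
    show "D (h + k) = D h + D k" for h k
      by (rule blinfun_eqI) (simp add: D blinfun.add_left shift_pencil_add eval_add)
    show "D (r *\<^sub>R h) = r *\<^sub>R D h" for r h
      by (rule blinfun_eqI) (simp add: D blinfun.scaleR_left shift_pencil_scaleR eval_scaleR)
    show "norm (D h) \<le> norm h * (1 / (1 - norm w) * M)" for h
    proof (rule norm_blinfun_bound)
      show "0 \<le> norm h * (1 / (1 - norm w) * M)" using w M by simp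
      fix x
      have "norm (blinfun_apply (D h) x) \<le> 1 / (1 - norm w) * norm (shift_pencil h (R (S x)))"
        unfolding D by (rule norm_eval_le[OF w])
      also have "\<dots> \<le> 1 / (1 - norm w) * (norm h * (M * norm x))"
        using w by (intro mult_left_mono order_trans[OF norm_shift_pencil_le] M) auto
      finally show "norm (blinfun_apply (D h) x) \<le> norm h * (1 / (1 - norm w) * M) * norm x"
        by (simp add: mult_ac)
    qed
  qed
  have rem: "norm (?\<Phi> v - ?\<Phi> w - D (v - w)) \<le> (1 / \<delta> * K * M * norm (v - w)) * norm (v - w)"
    if v: "dist v w < \<delta>" for v
  proof (rule norm_blinfun_bound)
    have nv: "norm v < 1 - \<delta>"
      using v norm_triangle_ineq[of w "v - w"] by (simp add: dist_norm \<delta>_def field_simps)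
    then have vb: "v \<in> ball 0 1" using d by simp
    show "0 \<le> 1 / \<delta> * K * M * norm (v - w) * norm (v - w)" using d K M by simp
    fix x
    have "blinfun_apply (?\<Phi> v - ?\<Phi> w - D (v - w)) x =
        eval (shift_pencil (v - w) (R (S x))) v - eval (shift_pencil (v - w) (R (S x))) w"
      by (simp add: blinfun.diff_left \<Phi> D eval_resolvent_diff[OF vb w Req])
    also have "\<dots> = eval (shift_pencil (v - w) (R (shift_pencil (v - w) (R (S x))))) v"
      by (rule eval_resolvent_diff[OF vb w Req])
    finally have "norm (blinfun_apply (?\<Phi> v - ?\<Phi> w - D (v - w)) x) \<le>
        1 / (1 - norm v) * norm (shift_pencil (v - w) (R (shift_pencil (v - w) (R (S x)))))"
      using norm_eval_le[OF vb] by simp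
    also have "\<dots> \<le> 1 / \<delta> * (norm (v - w) * (K * (norm (v - w) * (M * norm x))))"
    proof (rule mult_mono)
      show "1 / (1 - norm v) \<le> 1 / \<delta>" using nv d by (intro divide_left_mono) auto
      have "norm (R (shift_pencil (v - w) (R (S x)))) \<le> K * (norm (v - w) * (M * norm x))"
        by (intro order_trans[OF K(2)] mult_left_mono order_trans[OF norm_shift_pencil_le] M(2) K(1)) simp
      then show "norm (shift_pencil (v - w) (R (shift_pencil (v - w) (R (S x))))) \<le>
          norm (v - w) * (K * (norm (v - w) * (M * norm x)))"
        by (rule order_trans[OF norm_shift_pencil_le mult_left_mono[OF _ norm_ge_zero]])
    qed (use d in auto)
    finally show "norm (blinfun_apply (?\<Phi> v - ?\<Phi> w - D (v - w)) x) \<le>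
        1 / \<delta> * K * M * norm (v - w) * norm (v - w) * norm x"
      by (simp add: mult_ac)
  qed
  have "(?\<Phi> has_derivative D) (at w)"
  proof (rule has_derivativeI_sandwich[OF d lin])
    show "norm (?\<Phi> v - ?\<Phi> w - D (v - w)) / norm (v - w) \<le> 1 / \<delta> * K * M * norm (v - w)"
      if "v \<noteq> w" "dist v w < \<delta>" for v
      using rem[OF that(2)] that(1) by (simp add: divide_le_eq)
    have "((\<lambda>v. 1 / \<delta> * K * M * norm (v - w)) \<longlongrightarrow> 1 / \<delta> * K * M * norm (w - w)) (at w)"
      by (intro tendsto_intros)
    then show "((\<lambda>v. 1 / \<delta> * K * M * norm (v - w)) \<longlongrightarrow> 0) (at w)" by simp
  qed
  then show "\<exists>D. (?\<Phi> has_derivative D) (at w) \<and>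
      (\<forall>c v x. blinfun_apply (D (c *s v)) x = c *\<^sub>C blinfun_apply (D v) x)"
    by (intro exI[of _ D]) (auto simp: D shift_pencil_scale eval_scaleC)
qed

lemma symbol_multiplier:
  fixes T :: "('n::finite, 'e::chilbert_space) drury_arveson \<Rightarrow> ('n, 'f::chilbert_space) drury_arveson"
  assumes T: "module_map T"
  shows "symbol T \<in> multipliers"
    and "w \<in> ball 0 1 \<Longrightarrow> eval (T f) w = symbol T w (eval f w)"
proof -
  note c = module_map_cblinear[OF T]
  have 0: "(0 :: complex ^ 'n) \<in> ball 0 1" by simp
  have ev: "eval (T f) w = symbol T w (eval f w)" if "w \<in> ball 0 1" for w f
    using eval_module_map[OF T that, of f] by (simp only: symbol_apply[OF T])
  then show "w \<in> ball 0 1 \<Longrightarrow> eval (T f) w = symbol T w (eval f w)" .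
  \<comment> \<open>The multiplication operator of the symbol is \<open>T\<close> itself, so
    boundedness is inherited.\<close>
  have "mult_op (\<lambda>z. blinfun_apply (symbol T z)) f = T f" for f
  proof -
    have "(\<lambda>z. if z \<in> ball 0 1 then blinfun_apply (symbol T z) (eval f z) else 0) = eval (T f)"
      using ev eval_off_ball by fastforce
    then show ?thesis by (simp only: mult_op_def eval_inverse)
  qed
  then have "mult_op (\<lambda>z. blinfun_apply (symbol T z)) = T" by blast
  moreover have "complex_linear (symbol T z)" for z
    unfolding complex_linear_def symbol_apply[OF T] kern_scaleC[OF 0] cblinear_scaleC[OF c] eval_scaleC
    by simp
  moreover have "operator_holomorphic_on (symbol T) (ball 0 1)"
    unfolding symbol_def[abs_def]
    by (rule operator_holomorphic_eval[OF cblinear_compose[OF c cblinear_kern[OF 0]]])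
  ultimately show "symbol T \<in> multipliers"
    unfolding multipliers_def mem_Collect_eq
  proof (intro conjI ballI allI)
    show "\<exists>g. \<forall>z\<in>ball 0 1. eval g z = symbol T z (eval f z)" for f
      using ev by blast
  qed (simp_all only: cblinear_bounded_linear[OF c])
qed

lemma multiplier_module_map:
  fixes \<Theta> :: "complex ^ 'n::finite \<Rightarrow> 'e::chilbert_space \<Rightarrow>\<^sub>L 'f::chilbert_space"
  assumes \<Theta>: "\<Theta> \<in> multipliers"
  shows eval_mult_op: "w \<in> ball 0 1 \<Longrightarrow> eval (mult_op (\<lambda>z. blinfun_apply (\<Theta> z)) f) w = \<Theta> w (eval f w)"
    and "module_map (mult_op (\<lambda>z. blinfun_apply (\<Theta> z)) :: ('n, 'e) drury_arveson \<Rightarrow> _)"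
proof -
  let ?T = "mult_op (\<lambda>z. blinfun_apply (\<Theta> z)) :: ('n, 'e) drury_arveson \<Rightarrow> ('n, 'f) drury_arveson"
  have ev: "eval (?T f) w = \<Theta> w (eval f w)" if w: "w \<in> ball 0 1" for f w
  proof -
    \<comment> \<open>This clause of \<open>multipliers\<close> puts the pointwise product into the
      space, where \<open>Abs_drury_arveson\<close> is specified.\<close>
    obtain g :: "('n, 'f) drury_arveson" where g: "\<And>z. z \<in> ball 0 1 \<Longrightarrow> eval g z = \<Theta> z (eval f z)"
      using \<Theta> unfolding multipliers_def by blast
    have "(\<lambda>z. if z \<in> ball 0 1 then blinfun_apply (\<Theta> z) (eval f z) else 0) = eval g"
      using g eval_off_ball by fastforce
    then have "?T f = g" by (simp only: mult_op_def eval_inverse)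
    then show ?thesis using g[OF w] by simp
  qed
  then show "w \<in> ball 0 1 \<Longrightarrow> eval (mult_op (\<lambda>z. blinfun_apply (\<Theta> z)) f) w = \<Theta> w (eval f w)" .
  have lin: "\<Theta> z (c *\<^sub>C x) = c *\<^sub>C \<Theta> z x" if "z \<in> ball 0 1" for z c x
    using \<Theta> that unfolding multipliers_def complex_linear_def by blast
  show "module_map ?T"
    unfolding module_map_def cblinear_iff
  proof (intro conjI allI)
    show "bounded_linear ?T" using \<Theta> by (simp add: multipliers_def)
    show "?T (c *\<^sub>C x) = c *\<^sub>C ?T x" for c x
      by (rule drury_arveson_eqI) (simp only: ev eval_scaleC lin)
    show "?T (coord_mult i f) = coord_mult i (?T f)" for i f
      by (rule drury_arveson_eqI) (simp only: ev eval_coord_mult lin)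
  qed
qed

section \<open>Range inclusion\<close>

text \<open>Banach-Steinhaus for the functionals \<open>\<lambda>y. cinner a y\<close>: by Baire one
  of the closed sets \<open>C n\<close> contains a ball.\<close>

lemma weakly_bounded_imp_bounded:
  fixes A :: "'a::chilbert_space set"
  assumes weak: "\<And>y. \<exists>K. \<forall>a\<in>A. cmod (cinner a y) \<le> K"
  shows "\<exists>K. \<forall>a\<in>A. norm a \<le> K"
proof -
  define C where "C n = {y. \<forall>a\<in>A. cmod (cinner a y) \<le> real n}" for n :: nat
  have closed: "closed (C n)" for n
  proof -
    have "C n = (\<Inter>a\<in>A. {y. cmod (cinner a y) \<le> real n})" by (auto simp: C_def)
    then show ?thesis
      by (auto intro!: closed_Collect_le continuous_intros
          linear_continuous_on[OF bounded_linear_cinner_right])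
  qed
  have "(\<Union>n. C n) = UNIV"
  proof -
    have "y \<in> (\<Union>n. C n)" for y
    proof -
      obtain K where "\<forall>a\<in>A. cmod (cinner a y) \<le> K" using weak by blast
      moreover obtain n where "K \<le> real n" using real_arch_simple by blast
      ultimately have "y \<in> C n" unfolding C_def by force
      then show ?thesis by blast
    qed
    then show ?thesis by blast
  qed
  moreover have "completely_metrizable_space (euclidean :: 'a topology)"
    by (rule completely_metrizable_space_euclidean)
  ultimately have "\<exists>n. interior (C n) \<noteq> {}"
    using Baire_category_alt[of euclidean "range C"] closed by fastforce
  then obtain n y0 where "y0 \<in> interior (C n)" by blast
  then obtain r where r: "r > 0" "ball y0 r \<subseteq> C n" by (auto simp: mem_interior)
  show ?thesis
  proof (intro exI ballI)
    fix a assume a: "a \<in> A"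
    show "norm a \<le> 4 * real n / r"
    proof (cases "a = 0")
      case False
      \<comment> \<open>The point at distance \<open>r / 2\<close> from \<open>y0\<close> in
        direction \<open>a\<close>; comparing it with \<open>y0\<close> gives
        \<open>r / 2 * norm a \<le> 2 * real n\<close>.\<close>
      define y where "y = y0 + (r / (2 * norm a)) *\<^sub>R a"
      have "y \<in> ball y0 r" using r(1) False by (simp add: y_def dist_norm)
      then have "cmod (cinner a y) \<le> real n" using r(2) a by (auto simp: C_def)
      moreover have "cmod (cinner a y0) \<le> real n" using r a by (auto simp: C_def dest!: subsetD[of _ _ y0])
      moreover have "cinner a y - cinner a y0 = of_real (r / 2 * norm a)"
        using False by (simp add: y_def cinner_add_right cinner_scaleR_right cinner_self power2_eq_square)
      then have "cmod (cinner a y - cinner a y0) = \<bar>r / 2 * norm a\<bar>" by (simp only: norm_of_real)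
      then have "r / 2 * norm a = cmod (cinner a y - cinner a y0)" using r(1) by simp
      ultimately have "r / 2 * norm a \<le> 2 * real n"
        using norm_triangle_ineq4[of "cinner a y" "cinner a y0"] by linarith
      then show ?thesis using r(1) by (simp add: field_simps)
    qed (use r in simp)
  qed
qed

text \<open>If \<open>B y = A z\<close>, then
  \<open>cinner (adj B x) y = cinner (adj A x) z\<close>, so the vectors \<open>adj B x\<close> with
  \<open>norm (adj A x) \<le> 1\<close> are weakly bounded, hence bounded.\<close>

lemma range_inclusion_adj_bound:
  fixes A :: "'a::chilbert_space \<Rightarrow> 'b::chilbert_space" and B :: "'c::chilbert_space \<Rightarrow> 'b"
  assumes A: "cblinear A" and B: "cblinear B" and ran: "range B \<subseteq> range A"
  obtains K where "\<And>x. norm (adj B x) \<le> K * norm (adj A x)"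
proof -
  note A' = cblinear_adj[OF A] and B' = cblinear_adj[OF B]
  have "\<exists>K. \<forall>a\<in>adj B ` {x. norm (adj A x) \<le> 1}. cmod (cinner a y) \<le> K" for y
  proof -
    obtain z where z: "B y = A z" using ran by blast
    have "cmod (cinner (adj B x) y) \<le> norm z" if "norm (adj A x) \<le> 1" for x
    proof -
      have "cinner (adj B x) y = cinner (adj A x) z"
        by (simp only: cinner_adj_left[OF B] cinner_adj_left[OF A] z)
      then have "cmod (cinner (adj B x) y) \<le> norm (adj A x) * norm z"
        by (simp only: cinner_cauchy_schwarz)
      also have "\<dots> \<le> 1 * norm z" by (intro mult_right_mono that) simp
      finally show ?thesis by simp
    qed
    then show ?thesis by blast
  qed
  then have "\<exists>K. \<forall>a\<in>adj B ` {x. norm (adj A x) \<le> 1}. norm a \<le> K"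
    by (rule weakly_bounded_imp_bounded)
  then obtain K where K: "\<And>x. norm (adj A x) \<le> 1 \<Longrightarrow> norm (adj B x) \<le> K" by blast
  show ?thesis
  proof
    fix x
    have scale: "adj A (r *\<^sub>R x) = r *\<^sub>R adj A x" "adj B (r *\<^sub>R x) = r *\<^sub>R adj B x" for r
      using A' B' by (simp_all add: cblinear_scaleC scaleC_of_real[symmetric])
    show "norm (adj B x) \<le> K * norm (adj A x)"
    proof (cases "adj A x = 0")
      case True
      \<comment> \<open>Every multiple of \<open>x\<close> is admissible here, so
        \<open>adj B x\<close> must vanish.\<close>
      then have *: "\<bar>r\<bar> * norm (adj B x) \<le> K" for r using K[of "r *\<^sub>R x"] by (simp add: scale)
      have "adj B x = 0"
      proof (rule ccontr)
        assume "adj B x \<noteq> 0"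
        then have "\<bar>(\<bar>K\<bar> + 1) / norm (adj B x)\<bar> * norm (adj B x) = \<bar>K\<bar> + 1" by simp
        then show False using *[of "(\<bar>K\<bar> + 1) / norm (adj B x)"] by linarith
      qed
      then show ?thesis by (simp add: True)
    next
      case False
      have "norm (adj B ((1 / norm (adj A x)) *\<^sub>R x)) \<le> K" using False by (intro K) (simp add: scale)
      then show ?thesis using False by (simp add: scale field_simps)
    qed
  qed
qed

section \<open>Lifting intertwiners of the backward shifts\<close>

text \<open>\<open>Y\<close> is total but commutes with the shifts only on \<open>F\<close>. The
  condition on \<open>\<kappa>\<close> says that \<open>\<kappa> I - Y\<^sup>* Y\<close> is at least
  the identity, so \<open>cinner (defect f) g\<close> is an inner product equivalent to the original
  one.\<close>

locale shift_intertwiner =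
  fixes F :: "('n::finite, 'a::chilbert_space) drury_arveson set"
    and Y :: "('n, 'a) drury_arveson \<Rightarrow> ('n, 'c::chilbert_space) drury_arveson"
    and \<kappa> :: real
  assumes F: "csubspace F" "closed F"
    and F_bshift: "f \<in> F \<Longrightarrow> bshift i f \<in> F"
    and Y: "cblinear Y"
    and Y_bshift: "f \<in> F \<Longrightarrow> Y (bshift i f) = bshift i (Y f)"
    and \<kappa>: "(norm (Y f))\<^sup>2 + (norm f)\<^sup>2 \<le> \<kappa> * (norm f)\<^sup>2" "1 \<le> \<kappa>"
begin

section \<open>The defect form and its recurrence\<close>

definition defect :: "('n, 'a) drury_arveson \<Rightarrow> ('n, 'a) drury_arveson" where
  "defect f = of_real \<kappa> *\<^sub>C f - adj Y (Y f)"

text \<open>The output map of the realisation: for \<open>f \<in> F\<close> its values on iterated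
  shifts of \<open>f\<close> determine \<open>Y f\<close>.\<close>

definition out :: "('n, 'a) drury_arveson \<Rightarrow> 'c" where
  "out f = eval (Y f) 0"

definition defect_sq :: "('n, 'a) drury_arveson \<Rightarrow> real" where
  "defect_sq f = Re (cinner (defect f) f)"

lemma cblinear_defect: "cblinear defect"
  unfolding defect_def
  by (rule cblinear_diff_fun[OF cblinear_scaleC_const cblinear_compose[OF cblinear_adj[OF Y] Y]])

lemma cblinear_out: "cblinear out"
  unfolding out_def by (rule cblinear_compose[OF cblinear_eval Y])

lemma cinner_defect: "cinner (defect f) g = of_real \<kappa> * cinner f g - cinner (Y f) (Y g)"
  by (simp add: defect_def cinner_diff_left cinner_scaleC_left cinner_adj_left[OF Y])

lemma cinner_defect_commute: "cinner (defect f) g = cnj (cinner (defect g) f)"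
  unfolding cinner_defect by (simp add: cinner_commute[of f g] cinner_commute[of "Y f"])

lemma defect_sq_eq: "defect_sq f = \<kappa> * (norm f)\<^sup>2 - (norm (Y f))\<^sup>2"
  by (simp add: defect_sq_def cinner_defect norm_sq_Re_cinner)

lemma defect_sq_lower: "(norm f)\<^sup>2 \<le> defect_sq f"
  using \<kappa>(1)[of f] by (simp add: defect_sq_eq)

lemma defect_sq_upper: "defect_sq f \<le> \<kappa> * (norm f)\<^sup>2"
  by (simp add: defect_sq_eq)

lemma defect_sq_nonneg: "0 \<le> defect_sq f"
  using defect_sq_lower[of f] by (smt (verit) zero_le_power2)

lemma defect_sq_scaleC: "defect_sq (c *\<^sub>C f) = (cmod c)\<^sup>2 * defect_sq f"
  by (simp add: defect_sq_eq cblinear_scaleC[OF Y] norm_scaleC power_mult_distrib algebra_simps)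

lemma defect_amgm: "2 * Re (cinner (defect f) g) \<le> defect_sq f + defect_sq g"
proof -
  have "defect_sq (f - g) = defect_sq f + defect_sq g - 2 * Re (cinner (defect f) g)"
    using cinner_defect_commute[of g f]
    by (simp add: defect_sq_def cblinear_diff[OF cblinear_defect] cinner_diff_left cinner_diff_right)
  then show ?thesis using defect_sq_nonneg[of "f - g"] by linarith
qed

text \<open>\<open>\<kappa>\<close> times \<open>cinner_bshift\<close> for \<open>f\<close> and
  \<open>g\<close>, minus the same identity for \<open>Y f\<close> and \<open>Y g\<close>. It says
  that sending \<open>(f, out f)\<close> to the shifts of \<open>f\<close> together with
  \<open>eval f 0\<close> is isometric for the defect form, with weight \<open>\<kappa>\<close> on
  the last entry.\<close>

lemma defect_recurrence:
  assumes f: "f \<in> F" and g: "g \<in> F"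
  shows "cinner (defect f) g + cinner (out f) (out g) =
    (\<Sum>i\<in>UNIV. cinner (defect (bshift i f)) (bshift i g)) + of_real \<kappa> * cinner (eval f 0) (eval g 0)"
proof -
  have "cinner (Y f) (Y g) =
      (\<Sum>i\<in>UNIV. cinner (Y (bshift i f)) (Y (bshift i g))) + cinner (out f) (out g)"
    unfolding out_def by (subst cinner_bshift) (simp add: Y_bshift f g)
  moreover have "cinner f g =
      (\<Sum>i\<in>UNIV. cinner (bshift i f) (bshift i g)) + cinner (eval f 0) (eval g 0)"
    by (rule cinner_bshift)
  ultimately show ?thesis
    by (simp add: cinner_defect sum_subtractf sum_distrib_left distrib_left)
qed

lemma defect_sq_recurrence:
  "f \<in> F \<Longrightarrow> defect_sq f + (norm (out f))\<^sup>2 =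
    (\<Sum>i\<in>UNIV. defect_sq (bshift i f)) + \<kappa> * (norm (eval f 0))\<^sup>2"
  using defect_recurrence[of f f, THEN arg_cong, of Re]
  by (simp add: defect_sq_def norm_sq_Re_cinner)

text \<open>The vectors \<open>h i\<close> and \<open>e\<close> stand in for the shifts of
  \<open>f\<close> and its value at the origin. Bounding the cross terms by
  \<open>defect_amgm\<close> produces half of the claimed right-hand side and half of the one in
  \<open>defect_sq_recurrence\<close>, which equals the left-hand side.\<close>

lemma recurrence_inequality:
  assumes f: "f \<in> F"
    and eq: "cinner (defect f) f + cinner (out f) (out f) =
      (\<Sum>i\<in>UNIV. cinner (defect (h i)) (bshift i f)) + of_real \<kappa> * cinner e (eval f 0)"
  shows "defect_sq f + (norm (out f))\<^sup>2 \<le> (\<Sum>i\<in>UNIV. defect_sq (h i)) + \<kappa> * (norm e)\<^sup>2"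
proof -
  have "2 * (defect_sq f + (norm (out f))\<^sup>2) =
      (\<Sum>i\<in>UNIV. 2 * Re (cinner (defect (h i)) (bshift i f))) + \<kappa> * (2 * Re (cinner e (eval f 0)))"
    using arg_cong[OF eq, of Re] by (simp add: defect_sq_def norm_sq_Re_cinner sum_distrib_left)
  also have "\<dots> \<le> (\<Sum>i\<in>UNIV. defect_sq (h i) + defect_sq (bshift i f)) +
      \<kappa> * ((norm e)\<^sup>2 + (norm (eval f 0))\<^sup>2)"
  proof (intro add_mono sum_mono defect_amgm mult_left_mono)
    have "0 \<le> (norm (e - eval f 0))\<^sup>2" by simp
    then show "2 * Re (cinner e (eval f 0)) \<le> (norm e)\<^sup>2 + (norm (eval f 0))\<^sup>2"
      unfolding norm_diff_sq by linarith
  qed (use \<kappa> in simp)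
  finally show ?thesis
    using defect_sq_recurrence[OF f] by (simp add: sum.distrib distrib_left)
qed

text \<open>The operator whose equation \<open>state_op w \<eta> = \<kappa> kern 0 e\<close>, tested against \<open>F\<close>, characterises the
  value \<open>\<eta>\<close> of the state map at \<open>kern w e\<close>. The state map on all of the space is the solution of
  \<open>\<langle>defect (h g), f\<rangle> + \<langle>out (h g), out f\<rangle> = (\<Sum>i. \<langle>defect (h (bshift i g)), bshift i f\<rangle>) + \<kappa> \<langle>g 0, f 0\<rangle>\<close>.\<close>

definition state_op :: "complex ^ 'n \<Rightarrow> ('n, 'a) drury_arveson \<Rightarrow> ('n, 'a) drury_arveson" where
  "state_op w f = defect f + adj out (out f) -
    (\<Sum>i\<in>UNIV. cnj (w $ i) *\<^sub>C adj (bshift i) (defect f))"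

lemma cblinear_state_op: "cblinear (state_op w)"
  unfolding state_op_def
  by (intro cblinear_diff_fun cblinear_add_fun cblinear_sum_fun cblinear_scaleC_fun cblinear_defect
      cblinear_compose[OF cblinear_adj[OF cblinear_out] cblinear_out]
      cblinear_compose[OF cblinear_adj[OF cblinear_bshift] cblinear_defect])

lemma cinner_state_op:
  "cinner (state_op w f) g = cinner (defect f) g + cinner (out f) (out g) -
    (\<Sum>i\<in>UNIV. cnj (w $ i) * cinner (defect f) (bshift i g))"
  by (simp add: state_op_def cinner_diff_left cinner_add_left cinner_sum_left cinner_scaleC_left
      cinner_adj_left[OF cblinear_out] cinner_adj_left[OF cblinear_bshift])

text \<open>The argument of \<open>recurrence_inequality\<close> with
  \<open>cnj (w $ i) *\<^sub>C f\<close> for \<open>h i\<close>: the cross terms cost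
  \<open>(norm w)\<^sup>2 * defect_sq f\<close>, which leaves the factor
  \<open>1 - (norm w)\<^sup>2\<close>.\<close>

lemma state_op_coercive:
  assumes f: "f \<in> F"
  shows "(1 - (norm w)\<^sup>2) / 2 * defect_sq f \<le> Re (cinner (state_op w f) f)"
proof -
  have "2 * Re (cnj (w $ i) * cinner (defect f) (bshift i f)) \<le>
      (cmod (w $ i))\<^sup>2 * defect_sq f + defect_sq (bshift i f)" for i
    using defect_amgm[of "cnj (w $ i) *\<^sub>C f" "bshift i f"]
    by (simp add: cblinear_scaleC[OF cblinear_defect] cinner_scaleC_left defect_sq_scaleC)
  then have "(\<Sum>i\<in>UNIV. 2 * Re (cnj (w $ i) * cinner (defect f) (bshift i f))) \<le>
      (\<Sum>i\<in>UNIV. (cmod (w $ i))\<^sup>2 * defect_sq f + defect_sq (bshift i f))"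
    by (intro sum_mono)
  also have "\<dots> = (norm w)\<^sup>2 * defect_sq f + (\<Sum>i\<in>UNIV. defect_sq (bshift i f))"
    by (simp add: sum.distrib norm_vec_square sum_distrib_right)
  also have "\<dots> \<le> (norm w)\<^sup>2 * defect_sq f + (defect_sq f + (norm (out f))\<^sup>2)"
    using defect_sq_recurrence[OF f] \<kappa>(2) by simp
  finally have "2 * Re (\<Sum>i\<in>UNIV. cnj (w $ i) * cinner (defect f) (bshift i f)) \<le>
      (norm w)\<^sup>2 * defect_sq f + (defect_sq f + (norm (out f))\<^sup>2)"
    by (simp add: sum_distrib_left)
  moreover have "Re (cinner (state_op w f) f) = defect_sq f + (norm (out f))\<^sup>2 -
      Re (\<Sum>i\<in>UNIV. cnj (w $ i) * cinner (defect f) (bshift i f))"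
    by (simp add: cinner_state_op defect_sq_def norm_sq_Re_cinner)
  moreover have "0 \<le> (norm (out f))\<^sup>2" by simp
  ultimately have "defect_sq f - (norm w)\<^sup>2 * defect_sq f \<le> 2 * Re (cinner (state_op w f) f)"
    by argo
  then show ?thesis by (simp add: algebra_simps)
qed

definition gap :: "complex ^ 'n \<Rightarrow> real" where
  "gap w = (1 - (norm w)\<^sup>2) / 2"

lemma gap_pos: "w \<in> ball 0 1 \<Longrightarrow> 0 < gap w"
  by (simp add: gap_def power_less_one_iff abs_square_less_1)

lemma gap_le:
  assumes "f \<in> F" "w \<in> ball 0 1"
  shows "gap w * (norm f)\<^sup>2 \<le> Re (cinner (state_op w f) f)"
proof -
  have "gap w * (norm f)\<^sup>2 \<le> gap w * defect_sq f"
    using gap_pos[OF assms(2)] by (intro mult_left_mono defect_sq_lower) simp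
  also have "\<dots> \<le> Re (cinner (state_op w f) f)"
    using state_op_coercive[OF assms(1), of w] by (simp only: gap_def)
  finally show ?thesis .
qed

section \<open>The state map on kernel functions\<close>

definition state :: "complex ^ 'n \<Rightarrow> 'a \<Rightarrow> ('n, 'a) drury_arveson" where
  "state w e = (SOME x. x \<in> F \<and>
    (\<forall>f\<in>F. cinner (state_op w x) f = of_real \<kappa> * cinner e (eval f 0)))"

lemma state_spec:
  assumes w: "w \<in> ball 0 1"
  shows "state w e \<in> F \<and>
    (\<forall>f\<in>F. cinner (state_op w (state w e)) f = of_real \<kappa> * cinner e (eval f 0))"
proof -
  obtain x where x: "x \<in> F"
    "\<And>f. f \<in> F \<Longrightarrow> cinner (state_op w x) f = cinner (of_real \<kappa> *\<^sub>C kern 0 e) f"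
    using lax_milgram[OF F cblinear_state_op gap_pos[OF w] gap_le[OF _ w], of "of_real \<kappa> *\<^sub>C kern 0 e"]
    by metis
  then have "x \<in> F \<and> (\<forall>f\<in>F. cinner (state_op w x) f = of_real \<kappa> * cinner e (eval f 0))"
    by (simp add: cinner_scaleC_left cinner_kern_left)
  then show ?thesis unfolding state_def by (rule someI)
qed

lemma state_mem: "w \<in> ball 0 1 \<Longrightarrow> state w e \<in> F"
  using state_spec by blast

lemma state_eq:
  assumes "w \<in> ball 0 1" "f \<in> F"
  shows "cinner (defect (state w e)) f + cinner (out (state w e)) (out f) =
    (\<Sum>i\<in>UNIV. cnj (w $ i) * cinner (defect (state w e)) (bshift i f)) + of_real \<kappa> * cinner e (eval f 0)"
  using state_spec[OF assms(1), of e] assms(2) by (simp add: cinner_state_op algebra_simps)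

text \<open>Coercivity applied to the difference. Uniqueness makes \<open>state w\<close> linear
  although it is given by a choice.\<close>

lemma state_unique:
  assumes w: "w \<in> ball 0 1" and x: "x \<in> F"
    and eq: "\<And>f. f \<in> F \<Longrightarrow> cinner (state_op w x) f = of_real \<kappa> * cinner e (eval f 0)"
  shows "state w e = x"
proof -
  let ?d = "state w e - x"
  have d: "?d \<in> F" using state_mem[OF w] x by (rule csubspace_diff[OF F(1)])
  then have "cinner (state_op w ?d) ?d = 0"
    using state_spec[OF w, of e] eq[OF d] by (simp add: cblinear_diff[OF cblinear_state_op] cinner_diff_left)
  then have "gap w * (norm ?d)\<^sup>2 \<le> 0" using gap_le[OF d w] by simp
  then show ?thesis using gap_pos[OF w] by (simp add: mult_le_0_iff)
qed

lemma state_add: "w \<in> ball 0 1 \<Longrightarrow> state w (x + y) = state w x + state w y"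
  using F(1) state_mem state_spec
  by (intro state_unique)
    (auto simp: csubspace_def cblinear_add[OF cblinear_state_op] cinner_add_left distrib_left)

lemma state_scaleC: "w \<in> ball 0 1 \<Longrightarrow> state w (c *\<^sub>C x) = c *\<^sub>C state w x"
  using F(1) state_mem state_spec
  by (intro state_unique)
    (auto simp: csubspace_def cblinear_scaleC[OF cblinear_state_op] cinner_scaleC_left)

lemma norm_state_le:
  assumes w: "w \<in> ball 0 1"
  shows "norm (state w e) \<le> \<kappa> / gap w * norm e"
proof -
  let ?x = "state w e"
  have "norm (eval ?x 0) \<le> norm ?x" using norm_eval_le[of 0 ?x] by simp
  then have "cmod (cinner e (eval ?x 0)) \<le> norm e * norm ?x"
    using cinner_cauchy_schwarz[of e "eval ?x 0"] by (meson mult_left_mono norm_ge_zero order_trans)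
  then have "Re (cinner e (eval ?x 0)) \<le> norm e * norm ?x"
    using complex_Re_le_cmod[of "cinner e (eval ?x 0)"] by linarith
  then have "\<kappa> * Re (cinner e (eval ?x 0)) \<le> \<kappa> * (norm e * norm ?x)" using \<kappa> by simp
  moreover have "Re (cinner (state_op w ?x) ?x) = \<kappa> * Re (cinner e (eval ?x 0))"
    using state_spec[OF w, of e] by simp
  ultimately have "gap w * (norm ?x)\<^sup>2 \<le> \<kappa> * norm e * norm ?x"
    using gap_le[OF state_mem[OF w] w, of e] by (simp add: mult_ac)
  then have "gap w * norm ?x \<le> \<kappa> * norm e"
    using \<kappa>(2) by (cases "?x = 0") (auto simp: power2_eq_square mult.assoc[symmetric])
  then show ?thesis using gap_pos[OF w] by (simp add: field_simps)
qed

lemma norm_eval_0_le: "norm (eval f 0) \<le> norm (f :: ('n, 'b::chilbert_space) drury_arveson)"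
  using norm_eval_le[of 0 f] by simp

lemma norm_out_le: "(norm (out f))\<^sup>2 \<le> \<kappa> * (norm f)\<^sup>2"
proof -
  have "(norm (out f))\<^sup>2 \<le> (norm (Y f))\<^sup>2" unfolding out_def by (intro power_mono norm_eval_0_le) simp
  also have "\<dots> \<le> \<kappa> * (norm f)\<^sup>2" using \<kappa>(1)[of f] by (smt (verit) zero_le_power2)
  finally show ?thesis .
qed

lemma norm_out_le': "norm (out f) \<le> \<kappa> * norm f"
proof (rule power2_le_imp_le)
  have "\<kappa> * 1 \<le> \<kappa> * \<kappa>" using \<kappa>(2) by (intro mult_left_mono) auto
  then have "\<kappa> * (norm f)\<^sup>2 \<le> (\<kappa> * norm f)\<^sup>2"
    by (simp add: power_mult_distrib power2_eq_square[of \<kappa>] mult_right_mono)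
  then show "(norm (out f))\<^sup>2 \<le> (\<kappa> * norm f)\<^sup>2" using norm_out_le[of f] by linarith
qed (use \<kappa> in simp)

text \<open>Bounds at once the state map and the map
  \<open>kern w e \<mapsto> kern w (out (state w e))\<close>. The difference \<open>d\<close> of the
  two sides satisfies the hypotheses of \<open>nonneg_by_kernel_iteration\<close>:
  \<open>kern_gram_identity\<close> handles both kernel sums, \<open>recurrence_inequality\<close>
  the states.\<close>

lemma state_sum_bound:
  fixes e :: "complex ^ 'n \<Rightarrow> 'a"
  assumes J: "finite J" "J \<subseteq> ball 0 1"
  shows "(norm (\<Sum>w\<in>J. kern w (out (state w (e w)))))\<^sup>2 + defect_sq (\<Sum>w\<in>J. state w (e w)) \<le>
    \<kappa> * (norm (\<Sum>w\<in>J. kern w (e w)))\<^sup>2"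
proof -
  have b: "w \<in> ball 0 1" if "w \<in> J" for w using that J by blast
  define G where "G e = (\<Sum>w\<in>J. kern w (e w))" for e :: "complex ^ 'n \<Rightarrow> 'a"
  define Z where "Z e = (\<Sum>w\<in>J. kern w (out (state w (e w))))" for e
  define H where "H e = (\<Sum>w\<in>J. state w (e w))" for e
  define s where "s i e = (\<lambda>w. cnj (w $ i) *\<^sub>C e w)" for i and e :: "complex ^ 'n \<Rightarrow> 'a"
  define d where "d e = \<kappa> * (norm (G e))\<^sup>2 - (norm (Z e))\<^sup>2 - defect_sq (H e)" for e
  have HF: "H e \<in> F" for e unfolding H_def by (intro csubspace_sum F state_mem b)
  have out_H: "out (H e) = (\<Sum>w\<in>J. out (state w (e w)))" for e
    unfolding H_def by (rule cblinear_sum[OF cblinear_out])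
  have def_H: "defect (H e) = (\<Sum>w\<in>J. defect (state w (e w)))" for e
    unfolding H_def by (rule cblinear_sum[OF cblinear_defect])
  have st: "state w (s i e w) = cnj (w $ i) *\<^sub>C state w (e w)" if "w \<in> J" for w i e
    unfolding s_def by (rule state_scaleC[OF b[OF that]])
  \<comment> \<open>The state equation for a whole combination: by linearity of
    \<open>state w\<close> the factors \<open>cnj (w $ i)\<close> move into the coefficients
    \<open>s i e\<close>.\<close>
  have H_eq: "cinner (defect (H e)) f + cinner (out (H e)) (out f) =
      (\<Sum>i\<in>UNIV. cinner (defect (H (s i e))) (bshift i f)) + of_real \<kappa> * cinner (\<Sum>w\<in>J. e w) (eval f 0)"
    if f: "f \<in> F" for e f
  proof -
    have "cinner (defect (H e)) f + cinner (out (H e)) (out f) =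
        (\<Sum>w\<in>J. cinner (defect (state w (e w))) f + cinner (out (state w (e w))) (out f))"
      by (simp add: out_H def_H cinner_sum_left sum.distrib)
    also have "\<dots> = (\<Sum>w\<in>J. (\<Sum>i\<in>UNIV. cnj (w $ i) * cinner (defect (state w (e w))) (bshift i f)) +
        of_real \<kappa> * cinner (e w) (eval f 0))"
      by (intro sum.cong refl state_eq b f)
    also have "\<dots> = (\<Sum>i\<in>UNIV. \<Sum>w\<in>J. cnj (w $ i) * cinner (defect (state w (e w))) (bshift i f)) +
        of_real \<kappa> * cinner (\<Sum>w\<in>J. e w) (eval f 0)"
      by (subst sum.swap) (simp add: sum.distrib cinner_sum_left sum_distrib_left)
    also have "(\<Sum>i\<in>UNIV. \<Sum>w\<in>J. cnj (w $ i) * cinner (defect (state w (e w))) (bshift i f)) =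
        (\<Sum>i\<in>UNIV. cinner (defect (H (s i e))) (bshift i f))"
      by (simp add: def_H st cinner_sum_left cblinear_scaleC[OF cblinear_defect] cinner_scaleC_left
          cong: sum.cong)
    finally show ?thesis .
  qed
  have "0 \<le> d e"
  proof (rule nonneg_by_kernel_iteration[OF J])
    fix e
    have 1: "(norm (G e))\<^sup>2 = (\<Sum>i\<in>UNIV. (norm (G (s i e)))\<^sup>2) + (norm (\<Sum>w\<in>J. e w))\<^sup>2"
      unfolding G_def s_def using kern_gram_identity[OF J(2), of e] by simp
    have "Z (s i e) = (\<Sum>w\<in>J. kern w (cnj (w $ i) *\<^sub>C out (state w (e w))))" for i
      unfolding Z_def by (intro sum.cong refl) (simp add: st cblinear_scaleC[OF cblinear_out])
    then have 2: "(norm (Z e))\<^sup>2 = (\<Sum>i\<in>UNIV. (norm (Z (s i e)))\<^sup>2) + (norm (out (H e)))\<^sup>2"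
      using kern_gram_identity[OF J(2), of "\<lambda>w. out (state w (e w))"] by (simp add: out_H Z_def)
    have 3: "defect_sq (H e) + (norm (out (H e)))\<^sup>2 \<le>
        (\<Sum>i\<in>UNIV. defect_sq (H (s i e))) + \<kappa> * (norm (\<Sum>w\<in>J. e w))\<^sup>2"
      by (rule recurrence_inequality[OF HF H_eq[OF HF]])
    have "(\<Sum>i\<in>UNIV. d (s i e)) = \<kappa> * (\<Sum>i\<in>UNIV. (norm (G (s i e)))\<^sup>2) -
        (\<Sum>i\<in>UNIV. (norm (Z (s i e)))\<^sup>2) - (\<Sum>i\<in>UNIV. defect_sq (H (s i e)))"
      by (simp add: d_def sum_subtractf sum_distrib_left)
    also have "\<dots> \<le> d e" unfolding d_def 1 2 distrib_left using 3 by linarith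
    finally show "(\<Sum>i\<in>UNIV. d (\<lambda>w. cnj (w $ i) *\<^sub>C e w)) \<le> d e" by (simp only: s_def)
  next
    fix e
    \<comment> \<open>A crude bound from estimates at single points; it depends on \<open>J\<close>,
      but the iteration removes it.\<close>
    define a where "a w = 1 / (1 - norm w) * (\<kappa> * (\<kappa> / gap w))" for w :: "complex ^ 'n"
    have "(norm (Z e))\<^sup>2 \<le> (\<Sum>w\<in>J. (a w)\<^sup>2) * (\<Sum>w\<in>J. (norm (e w))\<^sup>2)"
      unfolding Z_def
    proof (rule norm_sum_square_le[OF J(1)])
      fix w assume "w \<in> J"
      then have w: "w \<in> ball 0 1" by (rule b)
      have "norm (kern w (out (state w (e w)))) \<le> 1 / (1 - norm w) * norm (out (state w (e w)))"
        by (rule norm_kern_le[OF w])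
      also have "\<dots> \<le> 1 / (1 - norm w) * (\<kappa> * (\<kappa> / gap w * norm (e w)))"
        using w \<kappa>(2) by (intro mult_left_mono order_trans[OF norm_out_le'] norm_state_le) auto
      finally show "norm (kern w (out (state w (e w)))) \<le> a w * norm (e w)" by (simp add: a_def mult_ac)
      show "0 \<le> a w" using w gap_pos[OF w] \<kappa>(2) by (simp add: a_def)
    qed simp
    moreover have "(norm (H e))\<^sup>2 \<le> (\<Sum>w\<in>J. (\<kappa> / gap w)\<^sup>2) * (\<Sum>w\<in>J. (norm (e w))\<^sup>2)"
      unfolding H_def
    proof (rule norm_sum_square_le[OF J(1)])
      fix w assume "w \<in> J"
      then have w: "w \<in> ball 0 1" by (rule b)
      show "norm (state w (e w)) \<le> \<kappa> / gap w * norm (e w)" by (rule norm_state_le[OF w])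
      show "0 \<le> \<kappa> / gap w" using gap_pos[OF w] \<kappa>(2) by simp
    qed simp
    then have "\<kappa> * (norm (H e))\<^sup>2 \<le> \<kappa> * ((\<Sum>w\<in>J. (\<kappa> / gap w)\<^sup>2) * (\<Sum>w\<in>J. (norm (e w))\<^sup>2))"
      using \<kappa>(2) by (intro mult_left_mono) auto
    then have "defect_sq (H e) \<le> \<kappa> * (\<Sum>w\<in>J. (\<kappa> / gap w)\<^sup>2) * (\<Sum>w\<in>J. (norm (e w))\<^sup>2)"
      using defect_sq_upper[of "H e"] by (simp add: mult.assoc)
    moreover have "0 \<le> \<kappa> * (norm (G e))\<^sup>2" using \<kappa>(2) by simp
    ultimately show "- (((\<Sum>w\<in>J. (a w)\<^sup>2) + \<kappa> * (\<Sum>w\<in>J. (\<kappa> / gap w)\<^sup>2)) * (\<Sum>w\<in>J. (norm (e w))\<^sup>2)) \<le> d e"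
      unfolding d_def distrib_right by linarith
  qed (use \<kappa>(2) in \<open>auto intro!: add_nonneg_nonneg mult_nonneg_nonneg sum_nonneg\<close>)
  then show ?thesis by (simp add: d_def G_def Z_def H_def)
qed

text \<open>\<open>h\<close> extends the state map and \<open>L\<close> reads off its output at the
  origin. On \<open>F\<close> the state equation is solved by \<open>x\<close> itself, by
  \<open>defect_recurrence\<close>, so \<open>h\<close> is the identity there; then \<open>L\<close>
  and \<open>Y\<close> agree at the origin after any number of shifts.\<close>

theorem lifting:
  obtains L where "cblinear L" "\<And>i f. L (bshift i f) = bshift i (L f)" "\<And>f. f \<in> F \<Longrightarrow> L f = Y f"
proof -
  have norms: "norm (\<Sum>w\<in>J. kern w (out (state w (e w)))) \<le> sqrt \<kappa> * norm (\<Sum>w\<in>J. kern w (e w))"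
    "norm (\<Sum>w\<in>J. state w (e w)) \<le> sqrt \<kappa> * norm (\<Sum>w\<in>J. kern w (e w))"
    if J: "finite J" "J \<subseteq> ball 0 1" for J and e :: "complex ^ 'n \<Rightarrow> 'a"
  proof -
    have "(sqrt \<kappa> * norm (\<Sum>w\<in>J. kern w (e w)))\<^sup>2 = \<kappa> * (norm (\<Sum>w\<in>J. kern w (e w)))\<^sup>2"
      using \<kappa>(2) by (simp add: power_mult_distrib)
    note * = state_sum_bound[OF J, of e, folded this]
    have nonneg: "0 \<le> sqrt \<kappa> * norm (\<Sum>w\<in>J. kern w (e w))" using \<kappa>(2) by simp
    show "norm (\<Sum>w\<in>J. kern w (out (state w (e w)))) \<le> sqrt \<kappa> * norm (\<Sum>w\<in>J. kern w (e w))"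
      using * defect_sq_nonneg[of "\<Sum>w\<in>J. state w (e w)"] nonneg
      by - (rule power2_le_imp_le, linarith)
    have "0 \<le> (norm (\<Sum>w\<in>J. kern w (out (state w (e w)))))\<^sup>2" by simp
    then show "norm (\<Sum>w\<in>J. state w (e w)) \<le> sqrt \<kappa> * norm (\<Sum>w\<in>J. kern w (e w))"
      using * defect_sq_lower[of "\<Sum>w\<in>J. state w (e w)"] nonneg
      by - (rule power2_le_imp_le, linarith)
  qed
  obtain h where h: "cblinear h" "\<And>w e. w \<in> ball 0 1 \<Longrightarrow> h (kern w e) = state w e"
    by (rule extend_from_kern[OF state_add state_scaleC norms(2)], assumption+) (rule that)
  have lin: "kern w (out (state w (x + y))) = kern w (out (state w x)) + kern w (out (state w y))"
    "kern w (out (state w (c *\<^sub>C x))) = c *\<^sub>C kern w (out (state w x))"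
    if "w \<in> ball 0 1" for w c x y
    by (simp_all only: state_add[OF that] state_scaleC[OF that] cblinear_add[OF cblinear_out]
        cblinear_scaleC[OF cblinear_out] kern_add[OF that] kern_scaleC[OF that])
  obtain L where L: "cblinear L"
    "\<And>w e. w \<in> ball 0 1 \<Longrightarrow> L (kern w e) = kern w (out (state w e))"
    by (rule extend_from_kern[where \<zeta> = "\<lambda>w e. kern w (out (state w e))", OF lin norms(1)],
        assumption+) (rule that)
  have L_bshift: "L (bshift i x) = bshift i (L x)" for i x
    by (rule cblinear_kern_eqI[OF cblinear_compose[OF L(1) cblinear_bshift]
          cblinear_compose[OF cblinear_bshift L(1)]])
      (simp only: bshift_kern cblinear_scaleC[OF L(1)] L(2))
  \<comment> \<open>The projection onto \<open>F\<close> does not change \<open>h\<close> on kernel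
    functions, hence nowhere.\<close>
  have h_mem: "h x \<in> F" for x
  proof -
    have "orth_projection F (h x) = h x"
      by (rule cblinear_kern_eqI[OF cblinear_compose[OF cblinear_orth_projection[OF F] h(1)] h(1)])
        (simp only: h(2) orth_projection_id[OF F(1) state_mem])
    then show ?thesis using orth_projection_mem[OF F, of "h x"] by simp
  qed
  have L_0: "eval (L x) 0 = out (h x)" for x
    by (rule cblinear_kern_eqI[OF cblinear_compose[OF cblinear_eval L(1)]
          cblinear_compose[OF cblinear_out h(1)]])
      (simp add: h(2) L(2) eval_kern)
  \<comment> \<open>Both sides are linear in \<open>x\<close>, so the equation passes from kernel
    functions, where it is \<open>state_eq\<close>, to the whole space.\<close>
  have h_eq: "cinner (defect (h x)) f + cinner (out (h x)) (out f) =
      (\<Sum>i\<in>UNIV. cinner (defect (h (bshift i x))) (bshift i f)) + of_real \<kappa> *\<^sub>C cinner (eval x 0) (eval f 0)"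
    if f: "f \<in> F" for x f
  proof (rule cblinear_kern_eqI[where x = x])
    show "cblinear (\<lambda>x. cinner (defect (h x)) f + cinner (out (h x)) (out f))"
      by (intro cblinear_add_fun cblinear_compose[OF cblinear_cinner] cblinear_compose[OF cblinear_defect]
          cblinear_compose[OF cblinear_out] h(1))
    show "cblinear (\<lambda>x. (\<Sum>i\<in>UNIV. cinner (defect (h (bshift i x))) (bshift i f)) +
        of_real \<kappa> *\<^sub>C cinner (eval x 0) (eval f 0))"
      by (intro cblinear_add_fun cblinear_sum_fun cblinear_compose[OF cblinear_cinner]
          cblinear_compose[OF cblinear_defect] cblinear_compose[OF h(1)] cblinear_bshift
          cblinear_scaleC_fun cblinear_eval)
    fix w :: "complex ^ 'n" and e :: 'a assume w: "w \<in> ball 0 1"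
    have "eval (kern w e) 0 = e" by (simp add: eval_kern[OF w])
    then show "cinner (defect (h (kern w e))) f + cinner (out (h (kern w e))) (out f) =
      (\<Sum>i\<in>UNIV. cinner (defect (h (bshift i (kern w e)))) (bshift i f)) +
        of_real \<kappa> *\<^sub>C cinner (eval (kern w e) 0) (eval f 0)"
      using state_eq[OF w f, of e]
      by (simp only: h(2)[OF w] bshift_kern[OF w] cblinear_scaleC[OF h(1)]
          cblinear_scaleC[OF cblinear_defect] cinner_scaleC_left scaleC_complex_def)
  qed
  obtain K where K: "K \<ge> 0" "\<And>x. norm (h x - x) \<le> K * norm x"
    using cblinear_bound[OF cblinear_diff_fun[OF h(1) cblinear_ident]] by blast
  have h_id: "h f = f" if f: "f \<in> F" for f
  proof -
    have "defect_sq (h f - f) \<le> 0"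
    proof (rule nonpos_by_shift_iteration[where \<phi> = "\<lambda>f. defect_sq (h f - f)" and F = F])
      fix x assume x: "x \<in> F"
      define \<delta> where "\<delta> = h x - x"
      have \<delta>: "\<delta> \<in> F" unfolding \<delta>_def by (rule csubspace_diff[OF F(1) h_mem x])
      \<comment> \<open>Subtracting \<open>defect_recurrence\<close> for \<open>x\<close> from
        \<open>h_eq\<close>, both tested against \<open>\<delta>\<close>, cancels the terms with
        \<open>eval x 0\<close>.\<close>
      have "cinner (defect \<delta>) \<delta> + cinner (out \<delta>) (out \<delta>) =
          (cinner (defect (h x)) \<delta> + cinner (out (h x)) (out \<delta>)) -
          (cinner (defect x) \<delta> + cinner (out x) (out \<delta>))"
        \<comment> \<open>Only the first arguments are unfolded; the test vector stays
          \<open>\<delta>\<close>.\<close>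
        by (subst (1 3) \<delta>_def) (simp add: cblinear_diff[OF cblinear_defect] cblinear_diff[OF cblinear_out]
            cinner_diff_left)
      also have "\<dots> = (\<Sum>i\<in>UNIV. cinner (defect (h (bshift i x) - bshift i x)) (bshift i \<delta>))"
        unfolding h_eq[OF \<delta>] defect_recurrence[OF x \<delta>]
        by (simp add: cblinear_diff[OF cblinear_defect] cinner_diff_left sum_subtractf scaleC_complex_def)
      \<comment> \<open>\<open>h\<close> is not known to commute with the shifts, so the differences
        \<open>h (bshift i x) - bshift i x\<close> replace the shifts of \<open>\<delta>\<close>,
        with \<open>e = 0\<close>.\<close>
      finally have "defect_sq \<delta> + (norm (out \<delta>))\<^sup>2 \<le>
          (\<Sum>i\<in>UNIV. defect_sq (h (bshift i x) - bshift i x)) + \<kappa> * (norm (0 :: 'a))\<^sup>2"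
        by (intro recurrence_inequality[OF \<delta>]) simp
      then have "defect_sq \<delta> + (norm (out \<delta>))\<^sup>2 \<le> (\<Sum>i\<in>UNIV. defect_sq (h (bshift i x) - bshift i x))"
        by simp
      moreover have "0 \<le> (norm (out \<delta>))\<^sup>2" by simp
      ultimately show "defect_sq (h x - x) \<le> (\<Sum>i\<in>UNIV. defect_sq (h (bshift i x) - bshift i x))"
        unfolding \<delta>_def by linarith
    next
      fix x
      have "defect_sq (h x - x) \<le> \<kappa> * (norm (h x - x))\<^sup>2" by (rule defect_sq_upper)
      also have "\<dots> \<le> \<kappa> * (K * norm x)\<^sup>2" using \<kappa>(2) K by (intro mult_left_mono power_mono) auto
      finally show "defect_sq (h x - x) \<le> \<kappa> * K\<^sup>2 * (norm x)\<^sup>2" by (simp add: power_mult_distrib mult_ac)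
    qed (use \<kappa>(2) F_bshift f in auto)
    then have "(norm (h f - f))\<^sup>2 \<le> 0" using defect_sq_lower[of "h f - f"] by linarith
    then show ?thesis by simp
  qed
  obtain K' where K': "K' \<ge> 0" "\<And>x. norm (L x - Y x) \<le> K' * norm x"
    using cblinear_bound[OF cblinear_diff_fun[OF L(1) Y]] by blast
  have "L f = Y f" if f: "f \<in> F" for f
  proof -
    have "(norm (L f - Y f))\<^sup>2 \<le> 0"
    \<comment> \<open>\<open>L\<close> and \<open>Y\<close> commute with the shifts on
      \<open>F\<close> and agree at the origin, so the step is \<open>norm_bshift\<close>.\<close>
    proof (rule nonpos_by_shift_iteration[where \<phi> = "\<lambda>f. (norm (L f - Y f))\<^sup>2" and F = F])
      fix x assume x: "x \<in> F"
      have "eval (L x - Y x) 0 = 0" using L_0[of x] h_id[OF x] by (simp add: eval_diff out_def)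
      then show "(norm (L x - Y x))\<^sup>2 \<le> (\<Sum>i\<in>UNIV. (norm (L (bshift i x) - Y (bshift i x)))\<^sup>2)"
        using norm_bshift[of "L x - Y x"]
        by (simp add: cblinear_diff[OF cblinear_bshift] L_bshift Y_bshift[OF x])
    next
      fix x
      have "(norm (L x - Y x))\<^sup>2 \<le> (K' * norm x)\<^sup>2" using K' by (intro power_mono) auto
      then show "(norm (L x - Y x))\<^sup>2 \<le> K'\<^sup>2 * (norm x)\<^sup>2" by (simp add: power_mult_distrib)
    qed (use F_bshift f in auto)
    then show ?thesis by simp
  qed
  then show ?thesis using that L(1) L_bshift by blast
qed

end

section \<open>Projectivity and the regular inverse\<close>

theorem module_map_factorization:
  fixes A :: "('n::finite, 'a::chilbert_space) drury_arveson \<Rightarrow> ('n, 'b::chilbert_space) drury_arveson"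
    and B :: "('n, 'c::chilbert_space) drury_arveson \<Rightarrow> ('n, 'b) drury_arveson"
  assumes A: "module_map A" and B: "module_map B" and ran: "range B \<subseteq> range A"
  obtains C where "module_map C" "\<And>f. A (C f) = B f"
proof -
  note a = module_map_cblinear[OF A] and b = module_map_cblinear[OF B]
  note a' = cblinear_adj[OF a] and b' = cblinear_adj[OF b]
  obtain K where K: "\<And>x. norm (adj B x) \<le> K * norm (adj A x)"
    using range_inclusion_adj_bound[OF a b ran] by blast
  \<comment> \<open>The bound \<open>K\<close> makes this relation the graph of an operator.\<close>
  define R where "R = range (\<lambda>x. (adj A x, adj B x))"
  obtain Y where Y: "cblinear Y" "\<And>x y. (x, y) \<in> R \<Longrightarrow> Y x = y"
  proof (rule extend_bounded_relation[of R K])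
    show "(x + x', y + y') \<in> R" if "(x, y) \<in> R" "(x', y') \<in> R" for x y x' y'
      using that by (auto simp: R_def image_iff cblinear_add[OF a', symmetric] cblinear_add[OF b', symmetric])
    show "(c *\<^sub>C x, c *\<^sub>C y) \<in> R" if "(x, y) \<in> R" for c x y
      using that by (auto simp: R_def image_iff cblinear_scaleC[OF a', symmetric] cblinear_scaleC[OF b', symmetric])
  qed (use K in \<open>auto simp: R_def\<close>)
  have YA: "Y (adj A x) = adj B x" for x by (rule Y(2)) (simp add: R_def)
  define F where "F = closure (range (adj A))"
  have bA: "bshift i (adj A x) \<in> F" for i x
    unfolding F_def bshift_adj[OF A] by (intro subsetD[OF closure_subset] rangeI)
  have F_bshift: "bshift i f \<in> F" if "f \<in> F" for i f
    unfolding F_def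
    by (rule cblinear_in_closure[OF cblinear_bshift _ that[unfolded F_def]]) (use bA F_def in auto)
  have Y_bshift: "Y (bshift i f) = bshift i (Y f)" if "f \<in> F" for i f
    by (rule cblinear_eq_on_closure[OF cblinear_compose[OF Y(1) cblinear_bshift]
          cblinear_compose[OF cblinear_bshift Y(1)] _ that[unfolded F_def]])
      (auto simp: YA bshift_adj[OF A] bshift_adj[OF B])
  obtain M where M: "M \<ge> 0" "\<And>f. norm (Y f) \<le> M * norm f" using cblinear_bound[OF Y(1)] by blast
  \<comment> \<open>\<open>M\<close> bounds \<open>Y\<close>; the added 1 pays for the extra
    \<open>(norm f)\<^sup>2\<close> in the locale.\<close>
  interpret shift_intertwiner F Y "M\<^sup>2 + 1"
  proof
    show "csubspace F" "closed F" unfolding F_def by (auto intro: csubspace_closure csubspace_range a')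
    show "(norm (Y f))\<^sup>2 + (norm f)\<^sup>2 \<le> (M\<^sup>2 + 1) * (norm f)\<^sup>2" for f
      using power_mono[OF M(2)[of f], of 2] by (simp add: power_mult_distrib distrib_right)
  qed (use F_bshift Y_bshift Y(1) in auto)
  obtain L where L: "cblinear L" "\<And>i f. L (bshift i f) = bshift i (L f)" "\<And>f. f \<in> F \<Longrightarrow> L f = Y f"
    using lifting by blast
  show ?thesis
  proof
    show "module_map (adj L)" by (rule module_map_adjI[OF L(1,2)])
    show "A (adj L f) = B f" for f
    proof (rule cinner_eqI)
      fix y
      \<comment> \<open>The lift agrees with \<open>Y\<close> on the range of \<open>adj A\<close>;
        taking adjoints in \<open>L (adj A y) = adj B y\<close> gives the factorization.\<close>
      have "adj A y \<in> F" unfolding F_def by (intro subsetD[OF closure_subset] rangeI)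
      then have "L (adj A y) = adj B y" by (simp only: L(3) YA)
      then show "cinner (A (adj L f)) y = cinner (B f) y"
        by (simp only: cinner_adj_right[OF a, symmetric] cinner_adj_left[OF L(1)] cinner_adj_right[OF b])
    qed
  qed
qed

theorem corollary5p7:
  fixes \<Theta> :: "complex ^ 'n \<Rightarrow> 'e::chilbert_space \<Rightarrow>\<^sub>L 'f::chilbert_space"
  assumes "separable_space (euclidean :: 'e topology)"
    and "separable_space (euclidean :: 'f topology)"
    and "separable_space (euclidean :: 'g::chilbert_space topology)"
    and "\<Theta> \<in> multipliers"
    and "closed (mult_range \<Theta>)"
    and "similar_modules
      (orth_complement (mult_range \<Theta>)) (quotient_action coord_mult (mult_range \<Theta>))
      (UNIV :: ('n, 'g) drury_arveson set) coord_mult"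
  shows "\<exists>\<Psi>. regular_inverse \<Theta> \<Psi>"
proof -
  define A :: "('n, 'e) drury_arveson \<Rightarrow> ('n, 'f) drury_arveson"
    where "A = mult_op (\<lambda>z. blinfun_apply (\<Theta> z))"
  define S where "S = mult_range \<Theta>"
  define P where "P = orth_projection (orth_complement S)"
  have S_range: "S = range A" by (simp add: S_def A_def mult_range_def)
  have A: "module_map A" unfolding A_def by (rule multiplier_module_map(2)[OF assms(4)])
  note a = module_map_cblinear[OF A]
  have S: "csubspace S" "closed S"
    using csubspace_range[OF a] assms(5) by (simp_all add: S_range S_def[symmetric])
  note SC = csubspace_orth_complement[of S] closed_orth_complement[of S]
  have P: "cblinear P" "\<And>f. P f \<in> orth_complement S" "\<And>f. P f = f - orth_projection S f"
    unfolding P_def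
    by (rule cblinear_orth_projection[OF SC], rule orth_projection_mem[OF SC],
        rule orth_projection_orth_complement[OF S])
  have P_id: "P f = f" if "f \<in> orth_complement S" for f
    unfolding P_def by (rule orth_projection_id[OF SC(1) that])
  have P_S: "P f = 0" if "f \<in> S" for f
    using orth_projection_id[OF S(1) that] by (simp add: P(3))
  obtain X :: "('n, 'f) drury_arveson \<Rightarrow> ('n, 'g) drury_arveson" where
    bij: "bij_betw X (orth_complement S) UNIV" and
    X: "\<forall>x\<in>orth_complement S. \<forall>y\<in>orth_complement S. X (x + y) = X x + X y"
      "\<forall>c. \<forall>x\<in>orth_complement S. X (c *\<^sub>C x) = c *\<^sub>C X x"
      "\<exists>K. \<forall>x\<in>orth_complement S. norm (X x) \<le> K * norm x"
      "\<forall>i. \<forall>x\<in>orth_complement S. X (quotient_action coord_mult S i x) = coord_mult i (X x)"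
    using assms(6) unfolding similar_modules_def S_def[symmetric] 
    by (elim exE conjE) (rule that, assumption+, rule exI, assumption+)
  obtain K where K: "\<And>x. x \<in> orth_complement S \<Longrightarrow> norm (X x) \<le> K * norm x" using X(3) by blast
  \<comment> \<open>The quotient map, realised by \<open>P\<close>, followed by the
    similarity.\<close>
  define \<rho> where "\<rho> f = X (P f)" for f
  have \<rho>_bound: "norm (\<rho> f) \<le> \<bar>K\<bar> * norm f" for f
  proof -
    have "norm (\<rho> f) \<le> K * norm (P f)" unfolding \<rho>_def by (rule K[OF P(2)])
    also have "\<dots> \<le> \<bar>K\<bar> * norm f"
      unfolding P_def by (intro mult_mono norm_orth_projection_le[OF SC]) auto
    finally show ?thesis .
  qed
  have \<rho>_lin: "cblinear \<rho>"
    by (rule cblinearI[OF _ _ \<rho>_bound])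
      (simp_all only: \<rho>_def cblinear_add[OF P(1)] cblinear_scaleC[OF P(1)]
        X(1)[rule_format, OF P(2) P(2)] X(2)[rule_format, OF P(2)])
  have \<rho>_mult: "\<rho> (coord_mult i f) = coord_mult i (\<rho> f)" for i f
  proof -
    have "orth_projection S f \<in> S" by (rule orth_projection_mem[OF S])
    then obtain g where "orth_projection S f = A g" by (auto simp: S_range)
    \<comment> \<open>\<open>f - P f\<close> lies in \<open>S\<close>, which coordinate
      multiplication preserves, so \<open>P\<close> kills its image.\<close>
    then have "coord_mult i (f - P f) = A (coord_mult i g)"
      by (simp add: P(3) module_map_coord_mult[OF A])
    then have "P (coord_mult i (f - P f)) = 0" by (intro P_S) (simp add: S_range)
    then have "P (coord_mult i f) = P (coord_mult i (P f))"
      by (simp add: cblinear_diff[OF cblinear_coord_mult] cblinear_diff[OF P(1)])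
    then show ?thesis using X(4)[rule_format, OF P(2)] by (simp add: \<rho>_def quotient_action_def P_def)
  qed
  have \<rho>: "module_map \<rho>" using \<rho>_lin \<rho>_mult by (simp add: module_map_def)
  have "y \<in> range \<rho>" for y
  proof -
    have "y \<in> X ` orth_complement S" using bij by (simp add: bij_betw_def)
    then show ?thesis by (rule imageE) (metis \<rho>_def P_id rangeI)
  qed
  then have surj: "range (\<lambda>x. x) \<subseteq> range \<rho>" by blast
  have \<rho>_ker: "f \<in> S" if "\<rho> f = 0" for f
  proof -
    have "0 \<in> orth_complement S" using SC(1) by (simp add: csubspace_def)
    moreover from this have "X 0 = 0" using X(2)[rule_format, of 0 0] by simp
    ultimately have "P f = 0"
      using that bij P(2)[of f] unfolding bij_betw_def inj_on_def \<rho>_def by metis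
    then show ?thesis using orth_projection_mem[OF S, of f] by (simp add: P(3))
  qed
  have "module_map (\<lambda>x :: ('n, 'g) drury_arveson. x)" by (simp add: module_map_def cblinear_ident)
  then obtain \<Gamma> where \<Gamma>: "module_map \<Gamma>" "\<And>f. \<rho> (\<Gamma> f) = f"
    using module_map_factorization[OF \<rho> _ surj] by blast
  \<comment> \<open>The idempotent onto the kernel of \<open>\<rho>\<close> along the range of
    \<open>\<Gamma>\<close>.\<close>
  define Q where "Q f = f - \<Gamma> (\<rho> f)" for f
  have Q: "module_map Q"
    unfolding module_map_def Q_def
    using cblinear_diff_fun[OF cblinear_ident cblinear_compose[OF module_map_cblinear[OF \<Gamma>(1)] \<rho>_lin]]
    by (simp add: \<rho>_mult module_map_coord_mult[OF \<Gamma>(1)] cblinear_diff[OF cblinear_coord_mult])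
  have "\<rho> (Q f) = 0" for f by (simp add: Q_def cblinear_diff[OF \<rho>_lin] \<Gamma>(2))
  then have "range Q \<subseteq> range A" using \<rho>_ker unfolding S_range by blast
  then obtain C where C: "module_map C" "\<And>f. A (C f) = Q f"
    using module_map_factorization[OF A Q] by blast
  have ACA: "A (C (A f)) = A f" for f
  proof -
    \<comment> \<open>\<open>\<rho>\<close> kills the range of \<open>A\<close>, so \<open>Q\<close>
      fixes it.\<close>
    have "\<rho> (A f) = \<rho> 0" by (simp add: \<rho>_def P_S S_range cblinear_0[OF P(1)])
    then have "\<rho> (A f) = 0" by (simp only: cblinear_0[OF \<rho>_lin])
    then show ?thesis by (simp add: C(2) Q_def cblinear_0[OF module_map_cblinear[OF \<Gamma>(1)]])
  qed
  have "\<Theta> z o\<^sub>L symbol C z o\<^sub>L \<Theta> z = \<Theta> z" if z: "z \<in> ball 0 1" for z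
  proof (rule blinfun_eqI)
    fix x :: 'e
    have A_eval: "eval (A f) z = \<Theta> z (eval f z)" for f
      unfolding A_def by (rule eval_mult_op[OF assms(4) z])
    \<comment> \<open>The constant function \<open>kern 0 x\<close> has value \<open>x\<close> at
      \<open>z\<close>, so evaluating \<open>ACA\<close> at \<open>z\<close> gives the pointwise
      identity.\<close>
    have "eval (kern 0 x) z = x" using z by (simp add: eval_kern)
    then show "blinfun_apply (\<Theta> z o\<^sub>L symbol C z o\<^sub>L \<Theta> z) x = blinfun_apply (\<Theta> z) x"
      using arg_cong[OF ACA[of "kern 0 x"], of "\<lambda>f. eval f z"]
      by (simp add: A_eval symbol_multiplier(2)[OF C(1) z])
  qed
  then have "regular_inverse \<Theta> (symbol C)"
    unfolding regular_inverse_def using symbol_multiplier(1)[OF C(1)] by blast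
  then show ?thesis by blast
qed

end
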